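(* Let $dim\in\{3,4,5\}$ and let $V,\Lambda$ be as in the context, with $V\cong\mathbb{R}^{dim-1}$ carrying the Euclidean norm $|z|=\sqrt{\mathrm{nrm}(z)}$, and identify $\partial\mathbb{H}^{dim}$ with $V\cup\{\infty\}$. Let $K$ be the group of isometries of $\mathbb{H}^{dim}$ generated by the (unique extensions of the) maps $\phi_\alpha(z)=\overline{(z-\alpha)}^{-1}+\alpha$ and $T_\alpha(z)=z+\alpha$ for $\alpha\in\Lambda$. Then $K$ is a lattice (i.e., a discrete group of isometries of $\mathbb{H}^{dim}$ with a fundamental domain of finite hyperbolic volume) if and only if the covering radius $\sup_{v\in V}\min_{\lambda\in\Lambda}|v-\lambda|$ of $\Lambda$ is at most $1$. Moreover, $K$ always admits a convex fundamental polyhedron with finitely many faces; consequently it is geometrically finite.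
   Context: If $dim=3$: $\mathcal{O}$ is an order in an imaginary quadratic field, $V=\mathbb{C}$, $\Lambda=\mathcal{O}$, bar is complex conjugation and $\mathrm{nrm}(z)=|z|^2$. If $dim=5$: $\mathcal{O}$ is an order (subring that is a full $\mathbb{Z}$-lattice) in a rational definite quaternion algebra $H=\left(\frac{a,b}{\mathbb{Q}}\right)$ ($i^2=a<0$, $j^2=b<0$, $ij=-ji$), $V=H\otimes\mathbb{R}$, $\Lambda=\mathcal{O}$, bar is the standard involution $\overline{x+yi+zj+tij}=x-yi-zj-tij$ and $\mathrm{nrm}(z)=z\bar z$. If $dim=4$: $H$ as before carries the orthogonal involution $(x+yi+zj+tij)^\ddagger=x+yi+zj-tij$, $\mathcal{O}$ is an order with $\mathcal{O}^\ddagger=\mathcal{O}$, $V=\{x+yi+zj\}\subset H\otimes\mathbb{R}$, $\Lambda=\mathcal{O}^+$ the $\ddagger$-fixed elements of $\mathcal{O}$, bar the standard involution, $\mathrm{nrm}(z)=z\bar z$. Each Möbius transformation of $V\cup\{\infty\}$ extends uniquely to an isometry of the upper half-space model $\mathbb{H}^{dim}$. *)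

theory Defs
  imports
    "HOL-Analysis.Analysis"
    "HOL-Algebra.Bij"
    "HOL-Algebra.Generated_Groups"
begin

section \<open>Orders and covering radius\<close>

abbreviation int_span :: "'a::real_vector set \<Rightarrow> 'a set" where
  "int_span \<equiv> module.span (\<lambda>(k::int) x. of_int k *\<^sub>R x)"

abbreviation rat_span :: "'a::real_vector set \<Rightarrow> 'a set" where
  "rat_span \<equiv> module.span (\<lambda>(r::rat) x. of_rat r *\<^sub>R x)"

definition full_int_lattice :: "'a::real_vector set \<Rightarrow> 'a set \<Rightarrow> bool" where
  "full_int_lattice F L \<longleftrightarrow> (\<exists>B. finite B \<and> L = int_span B) \<and> rat_span L = F"

text \<open>The multiplication and the unit are parameters, because the quaternion product
  below depends on the structure constants. Closure under addition and negation is part of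
  being a \<open>\<int>\<close>-lattice.\<close>

definition is_order :: "('a \<Rightarrow> 'a \<Rightarrow> 'a) \<Rightarrow> 'a \<Rightarrow> 'a::real_vector set \<Rightarrow> 'a set \<Rightarrow> bool" where
  "is_order mlt e F R \<longleftrightarrow>
     full_int_lattice F R \<and> e \<in> R \<and> (\<forall>x\<in>R. \<forall>y\<in>R. mlt x y \<in> R)"

definition covering_radius :: "('a::ab_group_add \<Rightarrow> real) \<Rightarrow> 'a set \<Rightarrow> 'a set \<Rightarrow> ereal" where
  "covering_radius nrm V \<Lambda> = (SUP v\<in>V. INF l\<in>\<Lambda>. ereal (sqrt (nrm (v - l))))"

text \<open>Every imaginary quadratic field is \<open>\<rat>(\<surd>-d)\<close> for some integer \<open>d > 0\<close>, and conversely.\<close>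

definition imag_quadratic_field :: "nat \<Rightarrow> complex set" where
  "imag_quadratic_field d =
     {of_rat x + of_rat y * (\<i> * of_real (sqrt (real d))) | x y. True}"


section \<open>Definite quaternion algebras\<close>

text \<open>The vector with components \<open>x, y, z, t\<close> stands for the element \<open>x + yi + zj + tij\<close> of
  \<open>H \<otimes> \<real>\<close>, where \<open>i\<^sup>2 = a\<close>, \<open>j\<^sup>2 = b\<close> and \<open>ij = -ji\<close>. Only the linear structure (and hence the
  topology) of \<^typ>\<open>real ^ 4\<close> is used; its own norm is not the quaternion norm.\<close>

type_synonym quat = "real ^ 4"

definition quat_one :: quat where
  "quat_one = vector [1, 0, 0, 0]"

definition quat_mult :: "real \<Rightarrow> real \<Rightarrow> quat \<Rightarrow> quat \<Rightarrow> quat" where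
  "quat_mult a b p q = vector
     [p$1 * q$1 + a * (p$2 * q$2) + b * (p$3 * q$3) - a * b * (p$4 * q$4),
      p$1 * q$2 + p$2 * q$1 - b * (p$3 * q$4) + b * (p$4 * q$3),
      p$1 * q$3 + p$3 * q$1 + a * (p$2 * q$4) - a * (p$4 * q$2),
      p$1 * q$4 + p$4 * q$1 + p$2 * q$3 - p$3 * q$2]"

definition quat_conj :: "quat \<Rightarrow> quat" where
  "quat_conj q = vector [q$1, - q$2, - q$3, - q$4]"

definition quat_ddag :: "quat \<Rightarrow> quat" where
  "quat_ddag q = vector [q$1, q$2, q$3, - q$4]"

definition quat_nrm :: "real \<Rightarrow> real \<Rightarrow> quat \<Rightarrow> real" where
  "quat_nrm a b q = quat_mult a b q (quat_conj q) $ 1"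

definition quat_inverse :: "real \<Rightarrow> real \<Rightarrow> quat \<Rightarrow> quat" where
  "quat_inverse a b q = (1 / quat_nrm a b q) *\<^sub>R quat_conj q"

definition rat_quat :: "quat set" where
  "rat_quat = {q. \<forall>i. q$i \<in> \<rat>}"

definition quat_V4 :: "quat set" where
  "quat_V4 = {q. q$4 = 0}"

text \<open>Coordinates in which \<open>\<surd>(nrm z)\<close> is the standard Euclidean norm, for \<open>a, b < 0\<close>.\<close>

definition quat_coords5 :: "real \<Rightarrow> real \<Rightarrow> quat \<Rightarrow> real ^ 4" where
  "quat_coords5 a b q = vector [q$1, sqrt (- a) * q$2, sqrt (- b) * q$3, sqrt (a * b) * q$4]"

definition quat_coords4 :: "real \<Rightarrow> real \<Rightarrow> quat \<Rightarrow> real ^ 3" where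
  "quat_coords4 a b q = vector [q$1, sqrt (- a) * q$2, sqrt (- b) * q$3]"

lemma vector_4:
  "(vector [x, y, z, t] :: real ^ 4) $ 1 = x" "(vector [x, y, z, t] :: real ^ 4) $ 2 = y"
  "(vector [x, y, z, t] :: real ^ 4) $ 3 = z" "(vector [x, y, z, t] :: real ^ 4) $ 4 = t"
  unfolding vector_def by simp_all

lemma quat_mult_assoc: "quat_mult a b (quat_mult a b p q) r = quat_mult a b p (quat_mult a b q r)"
  by (simp add: vec_eq_iff forall_4 quat_mult_def vector_4 algebra_simps)

lemma quat_nrm_eq:
  "quat_nrm a b q = (q$1)\<^sup>2 - a * (q$2)\<^sup>2 - b * (q$3)\<^sup>2 + a * b * (q$4)\<^sup>2"
  by (simp add: quat_nrm_def quat_mult_def quat_conj_def vector_4 power2_eq_square)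

lemma norm_quat_coords5:
  assumes "a < 0" "b < 0"
  shows "norm (quat_coords5 a b q) = sqrt (quat_nrm a b q)"
  using assms mult_neg_neg[OF assms]
  by (simp add: norm_vec_def L2_set_def sum_4 quat_coords5_def quat_nrm_eq vector_4
      power_mult_distrib)

lemma norm_quat_coords4:
  assumes "a < 0" "b < 0" "q \<in> quat_V4"
  shows "norm (quat_coords4 a b q) = sqrt (quat_nrm a b q)"
  using assms
  by (simp add: norm_vec_def L2_set_def sum_3 quat_coords4_def quat_nrm_eq quat_V4_def
      power_mult_distrib)


section \<open>Upper half-space\<close>

definition uhs :: "('v::euclidean_space \<times> real) set" where
  "uhs = {p. snd p > 0}"

definition hdist :: "'v::euclidean_space \<times> real \<Rightarrow> 'v \<times> real \<Rightarrow> real" where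
  "hdist p q = arcosh (1 + (dist p q)\<^sup>2 / (2 * snd p * snd q))"

definition hyp_isometries :: "('v::euclidean_space \<times> real \<Rightarrow> 'v \<times> real) set" where
  "hyp_isometries = {f \<in> Bij uhs. \<forall>p\<in>uhs. \<forall>q\<in>uhs. hdist (f p) (f q) = hdist p q}"

text \<open>In the half-space model of dimension \<open>n\<close> the volume element is \<open>dx/t\<^sup>n\<close>.\<close>

definition hyp_volume :: "('v::euclidean_space \<times> real) measure" where
  "hyp_volume =
     density lborel (\<lambda>p. indicator uhs p * ennreal (1 / snd p ^ DIM('v \<times> real)))"

text \<open>The ideal boundary is \<^typ>\<open>'v option\<close>, with \<^const>\<open>None\<close> as the point at infinity.
  \<open>ideal_nhds \<xi>\<close> is the trace on the half-space of the neighbourhoods of \<open>\<xi>\<close> in the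
  compactification.\<close>

definition ideal_nhds :: "'v::euclidean_space option \<Rightarrow> ('v \<times> real) filter" where
  "ideal_nhds \<xi> = inf (case \<xi> of None \<Rightarrow> at_infinity | Some v \<Rightarrow> nhds (v, 0)) (principal uhs)"

definition ideal_closure :: "('v::euclidean_space \<times> real) set \<Rightarrow> 'v option set" where
  "ideal_closure A = {\<xi>. \<exists>\<^sub>F p in ideal_nhds \<xi>. p \<in> A}"


section \<open>The group generated by sphere inversions and translations\<close>

text \<open>\<open>extends \<iota> V f g\<close>: the map \<open>f\<close> of the half-space has the map \<open>g\<close> of \<open>V \<union> {\<infinity>}\<close> as its
  boundary values, where \<open>V\<close> is identified with Euclidean space by \<open>\<iota>\<close>.\<close>

definition extends ::
  "('a \<Rightarrow> 'v::euclidean_space) \<Rightarrow> 'a set \<Rightarrow> ('v \<times> real \<Rightarrow> 'v \<times> real)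
     \<Rightarrow> ('a option \<Rightarrow> 'a option) \<Rightarrow> bool" where
  "extends \<iota> V f g \<longleftrightarrow>
     (\<forall>\<xi> \<in> insert None (Some ` V).
        filterlim f (ideal_nhds (map_option \<iota> (g \<xi>))) (ideal_nhds (map_option \<iota> \<xi>)))"

definition translation :: "'a::ab_group_add \<Rightarrow> 'a option \<Rightarrow> 'a option" where
  "translation \<alpha> = map_option (\<lambda>z. z + \<alpha>)"

definition sphere_inversion ::
  "('a \<Rightarrow> 'a) \<Rightarrow> ('a \<Rightarrow> 'a) \<Rightarrow> 'a::ab_group_add \<Rightarrow> 'a option \<Rightarrow> 'a option" where
  "sphere_inversion invr bar \<alpha> \<xi> =
     (case \<xi> of None \<Rightarrow> Some \<alpha>
      | Some z \<Rightarrow> if z = \<alpha> then None else Some (invr (bar (z - \<alpha>)) + \<alpha>))"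

definition inversion_group ::
  "('a \<Rightarrow> 'a) \<Rightarrow> ('a \<Rightarrow> 'a) \<Rightarrow> ('a \<Rightarrow> 'v::euclidean_space) \<Rightarrow> 'a set \<Rightarrow> 'a::ab_group_add set
     \<Rightarrow> ('v \<times> real \<Rightarrow> 'v \<times> real) set" where
  "inversion_group invr bar \<iota> V \<Lambda> =
     generate (BijGroup uhs)
       {f \<in> hyp_isometries. \<exists>\<alpha>\<in>\<Lambda>. extends \<iota> V f (sphere_inversion invr bar \<alpha>)
                                \<or> extends \<iota> V f (translation \<alpha>)}"


section \<open>Discrete groups and fundamental polyhedra\<close>

text \<open>On isometries the topology of pointwise convergence, which is the topology of the
  function type, coincides with the compact-open topology.\<close>

definition discrete_group :: "('v::euclidean_space \<times> real \<Rightarrow> 'v \<times> real) set \<Rightarrow> bool" where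
  "discrete_group K \<longleftrightarrow> subgroup K (BijGroup uhs) \<and> K \<subseteq> hyp_isometries \<and> discrete K"

definition fundamental_domain ::
  "('v::euclidean_space \<times> real \<Rightarrow> 'v \<times> real) set \<Rightarrow> ('v \<times> real) set \<Rightarrow> bool" where
  "fundamental_domain K D \<longleftrightarrow>
     D \<subseteq> uhs \<and> open D \<and> connected D \<and>
     (\<forall>f\<in>K. \<forall>g\<in>K. f \<noteq> g \<longrightarrow> f ` D \<inter> g ` D = {}) \<and>
     (\<Union>f\<in>K. f ` (closure D \<inter> uhs)) = uhs"

text \<open>The boundary of the domain has to be a null set: otherwise the volume depends on the
  domain, because any connected, open, dense subset of a fundamental domain, of however
  small a volume, is a fundamental domain as well.\<close>

definition hyp_lattice :: "('v::euclidean_space \<times> real \<Rightarrow> 'v \<times> real) set \<Rightarrow> bool" where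
  "hyp_lattice K \<longleftrightarrow> discrete_group K \<and>
     (\<exists>D. fundamental_domain K D \<and> emeasure hyp_volume (frontier D) = 0 \<and>
          emeasure hyp_volume D < \<infinity>)"

definition hyp_segment ::
  "'v::euclidean_space \<times> real \<Rightarrow> 'v \<times> real \<Rightarrow> ('v \<times> real) set" where
  "hyp_segment p q = {r \<in> uhs. hdist p r + hdist r q = hdist p q}"

definition hyp_convex :: "('v::euclidean_space \<times> real) set \<Rightarrow> bool" where
  "hyp_convex C \<longleftrightarrow> C \<subseteq> uhs \<and> (\<forall>p\<in>C. \<forall>q\<in>C. hyp_segment p q \<subseteq> C)"

text \<open>The sides (faces of codimension one) of a convex set with nonempty interior are the
  maximal nonempty convex subsets of its boundary.\<close>

definition sides :: "('v::euclidean_space \<times> real) set \<Rightarrow> ('v \<times> real) set set" where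
  "sides P =
     {S. S \<noteq> {} \<and> S \<subseteq> frontier P \<inter> uhs \<and> hyp_convex S \<and>
         (\<forall>S'. S' \<subseteq> frontier P \<inter> uhs \<and> hyp_convex S' \<and> S \<subseteq> S' \<longrightarrow> S' = S)}"

definition convex_polyhedron :: "('v::euclidean_space \<times> real) set \<Rightarrow> bool" where
  "convex_polyhedron P \<longleftrightarrow>
     interior P \<noteq> {} \<and> closedin (top_of_set uhs) P \<and> hyp_convex P \<and>
     locally_finite_in (top_of_set uhs) (sides P)"

definition convex_fundamental_polyhedron ::
  "('v::euclidean_space \<times> real \<Rightarrow> 'v \<times> real) set \<Rightarrow> ('v \<times> real) set \<Rightarrow> bool" where
  "convex_fundamental_polyhedron K P \<longleftrightarrow>
     convex_polyhedron P \<and> fundamental_domain K (interior P) \<and>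
     locally_finite_in (top_of_set uhs) ((\<lambda>f. f ` P) ` K)"

definition exact_polyhedron ::
  "('v::euclidean_space \<times> real \<Rightarrow> 'v \<times> real) set \<Rightarrow> ('v \<times> real) set \<Rightarrow> bool" where
  "exact_polyhedron K P \<longleftrightarrow> (\<forall>S\<in>sides P. \<exists>f\<in>K. S = P \<inter> f ` P)"

text \<open>Each ideal point of the polyhedron has a neighbourhood that meets only those sides
  whose closure contains it.\<close>

definition geometrically_finite_polyhedron :: "('v::euclidean_space \<times> real) set \<Rightarrow> bool" where
  "geometrically_finite_polyhedron P \<longleftrightarrow>
     (\<forall>\<xi> \<in> ideal_closure P.
        \<forall>\<^sub>F p in ideal_nhds \<xi>. \<forall>S\<in>sides P. p \<in> S \<longrightarrow> \<xi> \<in> ideal_closure S)"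

definition geometrically_finite :: "('v::euclidean_space \<times> real \<Rightarrow> 'v \<times> real) set \<Rightarrow> bool" where
  "geometrically_finite K \<longleftrightarrow> discrete_group K \<and>
     (\<exists>P. convex_fundamental_polyhedron K P \<and> exact_polyhedron K P \<and>
          geometrically_finite_polyhedron P)"

end

theory Submission
  imports Defs
begin

text \<open>In the hyperboloid model, the generators act linearly and preserve the lattice
  \<open>\<int> \<oplus> L \<oplus> \<int>\<close>, where \<open>L\<close> is the image of \<open>\<Lambda>\<close> in Euclidean space and \<open>|l|\<^sup>2 \<in> \<int>\<close> on \<open>L\<close>. The inversions are the
  reflections in roots \<open>sroot \<alpha>\<close>; they also generate the reflections in the bisectors of points of
  \<open>L\<close> at distance \<open>1\<close>. The unit hemispheres about points of \<open>L\<close> in one alcove of the vertical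
  reflection group, together with the walls of this alcove, have integral and nonpositive mutual
  inner products, hence form a simple system, and Tits' argument shows that the reflection group
  acts freely on its open chamber. It follows that the points outside all unit
  balls and over a Dirichlet domain of the stabiliser of \<open>\<infinity>\<close> form a fundamental polyhedron, with
  finitely many walls, each of which is its intersection with a translate. This polyhedron reaches
  down to an open subset of the boundary if the covering radius exceeds \<open>1\<close>; otherwise it meets
  the boundary in isolated cusps only, and its slice at height \<open>t\<close> has volume \<open>O(t\<^sup>2\<^sup>d)\<close> with \<open>d = dim V\<close>,
  which makes the volume finite.\<close>

section \<open>Reflection groups with a simple system\<close>

text \<open>Integrality leaves one obstruction to a simple system: hemispheres centred at distance
  1, whose roots have product +1. The vertical mirrors remove it, since the bisector of two such
  centres is a mirror and no alcove contains both. All remaining products are 0, -1 or at most -2,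
  so only dihedral groups of order 4, 6 and infinity occur. The alcove may be unbounded, which makes
  the simple system infinite and its roots dependent; Tits' argument is therefore run on the maps
  themselves, with word length as the only combinatorial datum. \<open>K\<close> is not simply this
  reflection group, because a translation need not be a product of the reflections. Every element is
  written as a reflection word after a translation, and a Dirichlet domain for all of the stabiliser
  of infinity takes the place of the alcove. Two further tasks come from the form of the claim. The
  generators are specified by boundary values, so uniqueness of the extension has to be proved. And
  a lattice may come with any fundamental domain, so infinite volume of one polyhedron must be
  transferred to all domains, which requires invariance of the volume.\<close>

definition reflection :: "('m \<Rightarrow> 'm \<Rightarrow> real) \<Rightarrow> 'm \<Rightarrow> 'm \<Rightarrow> 'm::real_vector" where
  "reflection B n y = y - B y n *\<^sub>R n"

definition word_map :: "('m \<Rightarrow> 'm \<Rightarrow> real) \<Rightarrow> 'm list \<Rightarrow> 'm \<Rightarrow> 'm::real_vector" where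
  "word_map B ns = foldr (\<lambda>n g. reflection B n \<circ> g) ns id"

lemma word_map_Nil [simp]: "word_map B [] = id"
  and word_map_Cons [simp]: "word_map B (n # ns) = reflection B n \<circ> word_map B ns"
  by (simp_all add: word_map_def)

lemma word_map_append: "word_map B (xs @ ys) = word_map B xs \<circ> word_map B ys"
  by (induction xs) (auto simp: comp_assoc)

locale sym_form =
  fixes B :: "'m::real_vector \<Rightarrow> 'm \<Rightarrow> real"
  assumes sym: "B x y = B y x"
    and add: "B (x + y) z = B x z + B y z"
    and scale: "B (r *\<^sub>R x) z = r * B x z"
begin

lemma add_right: "B z (x + y) = B z x + B z y"
  using add sym by metis

lemma scale_right: "B z (r *\<^sub>R x) = r * B z x"
  using scale sym by metis

lemma zero [simp]: "B 0 z = 0" "B z 0 = 0"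
  using scale[of 0 0 z] sym[of z 0] by auto

lemma minus: "B (- x) z = - B x z" "B z (- x) = - B z x"
  using scale[of "-1" x z] scale_right[of z "-1" x] by auto

lemma diff: "B (x - y) z = B x z - B y z" "B z (x - y) = B z x - B z y"
  using add[of x "- y" z] add_right[of z x "- y"] by (auto simp: minus)

lemmas form_simps = add add_right scale scale_right minus diff

lemma reflection_linear: "linear (reflection B n)"
  by (rule linearI) (simp_all add: reflection_def form_simps algebra_simps)

lemma reflection_involutive: "B n n = 2 \<Longrightarrow> reflection B n (reflection B n y) = y"
  by (simp add: reflection_def form_simps algebra_simps)

lemma reflection_form: "B n n = 2 \<Longrightarrow> B (reflection B n x) (reflection B n y) = B x y"
  by (simp add: reflection_def form_simps sym[of n y] algebra_simps)

lemma reflection_conj: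
  assumes "linear g" and "\<And>x y. B (g x) (g y) = B x y"
  shows "g (reflection B n y) = reflection B (g n) (g y)"
  using assms by (simp add: reflection_def linear_diff linear_cmul)

lemma reflection_uminus: "reflection B (- n) = reflection B n"
  by (simp add: reflection_def form_simps fun_eq_iff)

end

text \<open>The cases of \<open>cartan\<close> correspond to dihedral groups of order 4, 6 and
  infinity. \<open>S\<close> may be infinite and linearly dependent and \<open>B\<close> indefinite,
  so lengths are attached to maps and not to elements of an abstract Coxeter group.\<close>

locale simple_system = sym_form B for B :: "'m::real_vector \<Rightarrow> 'm \<Rightarrow> real" +
  fixes S :: "'m::real_vector set"
  assumes norm2: "s \<in> S \<Longrightarrow> B s s = 2"
    and cartan: "s \<in> S \<Longrightarrow> t \<in> S \<Longrightarrow> s \<noteq> t \<Longrightarrow> B s t = 0 \<or> B s t = -1 \<or> B s t \<le> -2"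
begin

abbreviation r where "r \<equiv> reflection B"
abbreviation wm where "wm \<equiv> word_map B"

text \<open>For \<open>T \<subseteq> S\<close> this is the group generated by the reflections in
  \<open>T\<close>: each of them is its own inverse, so words suffice.\<close>

definition maps_of :: "'m set \<Rightarrow> ('m \<Rightarrow> 'm) set" where
  "maps_of T = {wm ns | ns. set ns \<subseteq> T}"

definition len :: "'m set \<Rightarrow> ('m \<Rightarrow> 'm) \<Rightarrow> nat" where
  "len T g = (LEAST k. \<exists>ns. set ns \<subseteq> T \<and> length ns = k \<and> wm ns = g)"

definition chamber :: "'m set" where
  "chamber = {y. \<forall>s\<in>S. B y s > 0}"

lemma len_witness:
  assumes "g \<in> maps_of T"
  obtains ns where "set ns \<subseteq> T" "length ns = len T g" "wm ns = g"
proof -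
  obtain ms where "set ms \<subseteq> T" "wm ms = g" using assms by (auto simp: maps_of_def)
  then have "\<exists>k ns. set ns \<subseteq> T \<and> length ns = k \<and> wm ns = g" by blast
  then have "\<exists>ns. set ns \<subseteq> T \<and> length ns = len T g \<and> wm ns = g"
    unfolding len_def by (rule LeastI_ex)
  then show ?thesis using that by blast
qed

lemma len_le: "set ns \<subseteq> T \<Longrightarrow> len T (wm ns) \<le> length ns"
  unfolding len_def by (rule Least_le) blast

lemma maps_of_comp: "g \<in> maps_of T \<Longrightarrow> h \<in> maps_of T \<Longrightarrow> g \<circ> h \<in> maps_of T"
  by (auto simp: maps_of_def) (metis Un_least set_append word_map_append)

lemma maps_of_mono: "T \<subseteq> U \<Longrightarrow> maps_of T \<subseteq> maps_of U"
  by (auto simp: maps_of_def)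

lemma id_maps_of: "id \<in> maps_of T"
  unfolding maps_of_def by (auto intro!: exI[of _ "[]"])

lemma r_maps_of: "s \<in> T \<Longrightarrow> r s \<in> maps_of T"
  unfolding maps_of_def by (auto intro!: exI[of _ "[s]"])

lemma len_comp:
  assumes "g \<in> maps_of T" "h \<in> maps_of T"
  shows "len T (g \<circ> h) \<le> len T g + len T h"
proof -
  obtain xs where x: "set xs \<subseteq> T" "length xs = len T g" "wm xs = g" using assms len_witness by blast
  obtain ys where y: "set ys \<subseteq> T" "length ys = len T h" "wm ys = h" using assms len_witness by blast
  show ?thesis using len_le[of "xs @ ys" T] x y by (simp add: word_map_append)
qed

lemma len_mono:
  assumes "g \<in> maps_of T" "T \<subseteq> U"
  shows "len U g \<le> len T g"
  using assms by (metis len_le len_witness order_trans)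

lemma len_r: "s \<in> T \<Longrightarrow> len T (r s) \<le> 1"
  using len_le[of "[s]" T] by simp

lemma rr: "s \<in> S \<Longrightarrow> r s \<circ> r s = id"
  by (auto simp: fun_eq_iff reflection_involutive norm2)

lemma rr_comp: "s \<in> S \<Longrightarrow> r s \<circ> (r s \<circ> g) = g"
  by (simp add: comp_assoc[symmetric] rr)

lemma braid2:
  assumes "B s t = 0"
  shows "r t \<circ> r s = r s \<circ> r t"
  using assms sym[of s t] by (auto simp: fun_eq_iff reflection_def form_simps)

lemma braid3:
  assumes "B s t = -1" "s \<in> S" "t \<in> S"
  shows "r t \<circ> (r s \<circ> r t) = r s \<circ> (r t \<circ> r s)"
  using assms sym[of s t] norm2[of s] norm2[of t]
  by (auto simp: fun_eq_iff reflection_def form_simps algebra_simps)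

text \<open>For \<open>B s t \<le> -2\<close> the dihedral group is infinite and the two mirrors do not meet: this is the
  table-tennis argument with the invariant \<open>B y s + B y t > 0\<close>.\<close>

lemma ping_pong:
  assumes st: "s \<in> S" "t \<in> S" "B s t \<le> -2" and y: "B y s > 0" "B y t > 0"
    and "set ns \<subseteq> {s, t}" "successively (\<noteq>) ns"
  shows "B (wm ns y) s + B (wm ns y) t > 0 \<and>
    (ns \<noteq> [] \<longrightarrow> hd ns = s \<longrightarrow> B (wm ns y) t > 0) \<and>
    (ns \<noteq> [] \<longrightarrow> hd ns = t \<longrightarrow> B (wm ns y) s > 0)"
  using assms(6,7)
proof (induction ns)
  case Nil
  then show ?case using y by simp
next
  case (Cons n ns)
  define x where "x = wm ns y"
  have ne: "s \<noteq> t" using st norm2[of s] by auto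
  have suc: "successively (\<noteq>) ns" and hdne: "ns \<noteq> [] \<Longrightarrow> hd ns \<noteq> n"
    using Cons.prems(2) by (auto simp: successively_Cons)
  note IH = Cons.IH[OF _ suc]
  have sum: "B x s + B x t > 0" using IH Cons.prems(1) x_def by auto
  have hdst: "ns \<noteq> [] \<Longrightarrow> hd ns \<in> {s, t}"
    using Cons.prems(1) hd_in_set[of ns] by (auto dest!: subsetD)
  \<comment> \<open>Reflecting in \<open>n\<close> costs the \<open>n\<close>-value 2
    \<open>B x n\<close>, and the \<open>m\<close>-value gains at least as much because
    \<open>B n m\<close> is at most -2. So the sum does not drop, and the \<open>m\<close>-value
    becomes positive.\<close>
  have key: "B (r n x) n + B (r n x) m > 0 \<and> B (r n x) m > 0"
    if nm: "n \<in> S" "B n n = 2" "B n m \<le> -2" "B x n > 0" "B x n + B x m > 0" for m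
  proof -
    have 1: "B (r n x) n = - B x n" using nm by (simp add: reflection_def form_simps)
    have 2: "B (r n x) m = B x m - B x n * B n m" by (simp add: reflection_def form_simps)
    have "B x n * 2 \<le> B x n * (- B n m)" using nm by (intro mult_left_mono) auto
    then show ?thesis using 1 2 nm by auto
  qed
  have n: "n = s \<or> n = t" using Cons.prems by auto
  then show ?case
  proof
    assume n: "n = s"
    have "B x s > 0" using IH Cons.prems(1) y hdst hdne n x_def by (cases "ns = []") auto
    then show ?thesis using key[of t] st norm2 n ne sum x_def by auto
  next
    assume n: "n = t"
    have "B x t > 0" using IH Cons.prems(1) y hdst hdne n x_def by (cases "ns = []") auto
    then show ?thesis using key[of s] st norm2 n ne sum x_def sym[of s t] by (auto simp: add_ac)
  qed
qed

lemma not_successively_neq: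
  "\<not> successively (\<noteq>) ns \<Longrightarrow> \<exists>xs a ys. ns = xs @ a # a # ys"
proof (induction ns rule: induct_list012)
  case (3 a b ns)
  show ?case
  proof (cases "a = b")
    case True
    then show ?thesis by (metis append_Nil)
  next
    case False
    then have "\<not> successively (\<noteq>) (b # ns)" using 3 by auto
    then obtain xs c ys where "b # ns = xs @ c # c # ys" using 3 by blast
    then show ?thesis by (metis append_Cons)
  qed
qed auto

lemma shortest_successively:
  assumes "T \<subseteq> S" "set ns \<subseteq> T" "length ns = len T (wm ns)"
  shows "successively (\<noteq>) ns"
proof (rule ccontr)
  assume "\<not> successively (\<noteq>) ns"
  then obtain xs ys a where ns: "ns = xs @ a # a # ys"
    using not_successively_neq by blast
  have "a \<in> S" using assms ns by auto
  then have "wm ns = wm (xs @ ys)"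
    using ns by (simp add: word_map_append rr_comp comp_assoc)
  then show False using len_le[of "xs @ ys" T] assms ns by auto
qed

text \<open>The length hypothesis says that a shortest word for \<open>u\<close> does not begin with
  \<open>s\<close>. Shortest words alternate. If the product is 0 or -1, a braid relation would
  bring \<open>s\<close> to the front of a longer word, so only \<open>[]\<close>,
  \<open>[t]\<close> and, for -1, \<open>[t, s]\<close> remain; if it is at most -2,
  \<open>ping_pong\<close> applies.\<close>

lemma dihedral:
  assumes st: "s \<in> S" "t \<in> S" "s \<noteq> t" and u: "u \<in> maps_of {s, t}"
    and l: "len {s, t} (r s \<circ> u) \<ge> len {s, t} u" and y: "B y s > 0" "B y t > 0"
  shows "B (u y) s > 0"
proof -
  let ?T = "{s, t}"
  have TS: "?T \<subseteq> S" using st by auto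
  obtain ns where ns: "set ns \<subseteq> ?T" "length ns = len ?T u" "wm ns = u"
    using len_witness[OF u] by blast
  have suc: "successively (\<noteq>) ns" using shortest_successively[OF TS ns(1)] ns by simp
  have shorter: False if "set ms \<subseteq> ?T" "wm ms = wm ns" "length ms < length ns" for ms
    using len_le[OF that(1)] that ns by simp
  have hd: "hd ns = t" if ne: "ns \<noteq> []"
  proof (rule ccontr)
    assume "hd ns \<noteq> t"
    then obtain ms where ms: "ns = s # ms" using ne ns(1) by (cases ns) auto
    then have "wm ms = r s \<circ> u" using ns st by (auto simp: rr_comp)
    then show False using len_le[of ms ?T] ns ms l by auto
  qed
  consider "B s t \<le> -2" | "B s t = 0" | "B s t = -1" using cartan st by blast
  then show ?thesis
  proof cases
    case 1
    then show ?thesis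
      using ping_pong[OF st(1,2) 1 y ns(1) suc] hd ns y by (cases "ns = []") auto
  next
    case 2
    show ?thesis
    proof (cases "ns = [] \<or> ns = [t]")
      case True
      then show ?thesis using ns(3) y 2 sym[of s t] by (auto simp: reflection_def form_simps)
    next
      case False
      then obtain ms where ms: "ns = t # s # ms"
        using hd ns(1) suc by (cases ns; cases "tl ns") auto
      have sm: "successively (\<noteq>) (s # ms)" using suc ms by auto
      have "wm ns = r s \<circ> (r t \<circ> wm ms)"
        using ms braid2[OF 2] by (simp add: comp_assoc[symmetric])
      then have "r s \<circ> u = wm (t # ms)" using ns(3) st by (simp add: rr_comp)
      then have "len ?T (r s \<circ> u) \<le> length (t # ms)" using len_le[of "t # ms" ?T] ms ns(1) by auto
      then show ?thesis using l ns ms by auto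
    qed
  next
    case 3
    show ?thesis
    proof (cases "ns = [] \<or> ns = [t] \<or> ns = [t, s]")
      case True
      then show ?thesis using ns(3) y 3 sym[of s t] norm2[OF st(1)]
        by (auto simp: reflection_def form_simps algebra_simps)
    next
      case False
      then obtain ms where ms: "ns = t # s # t # ms"
        using hd ns(1) suc by (cases ns; cases "tl ns"; cases "tl (tl ns)") auto
      have "r t \<circ> (r s \<circ> (r t \<circ> wm ms)) = (r t \<circ> (r s \<circ> r t)) \<circ> wm ms"
        by (simp only: comp_assoc)
      also have "\<dots> = r s \<circ> (r t \<circ> (r s \<circ> wm ms))"
        by (simp only: braid3[OF 3 st(1,2)] comp_assoc)
      finally have "u = r s \<circ> (r t \<circ> (r s \<circ> wm ms))" using ns(3) ms by simp
      then have "r s \<circ> u = wm (t # s # ms)" using st by (simp only: rr_comp word_map_Cons)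
      then have "len ?T (r s \<circ> u) \<le> length (t # s # ms)"
        using len_le[of "t # s # ms" ?T] ms ns(1) by auto
      then show ?thesis using l ns ms by auto
    qed
  qed
qed

text \<open>Tits' argument: split off from \<open>g\<close> the longest possible dihedral left factor.\<close>

lemma chamber_side:
  assumes "g \<in> maps_of S" "s \<in> S" "len S (r s \<circ> g) \<ge> len S g" "y \<in> chamber"
  shows "B (g y) s > 0"
  using assms
proof (induction "len S g" arbitrary: g s rule: less_induct)
  case less
  obtain ns where ns: "set ns \<subseteq> S" "length ns = len S g" "wm ns = g"
    using len_witness[OF less.prems(1)] by blast
  show ?case
  proof (cases ns)
    case Nil
    then show ?thesis using ns less.prems by (auto simp: chamber_def)
  next
    case (Cons t ms)
    have t: "t \<in> S" using ns Cons by auto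
    have ms: "wm ms \<in> maps_of S" "len S (wm ms) < len S g" "g = r t \<circ> wm ms"
      using ns Cons len_le[of ms S] by (auto simp: maps_of_def)
    have ne: "s \<noteq> t"
    proof
      assume "s = t"
      then have "r s \<circ> g = wm ms" using ms t by (simp add: rr_comp)
      then show False using less.prems(3) ms by simp
    qed
    let ?T = "{s, t}"
    \<comment> \<open>\<open>v\<close> ranges over the right factors of length-additive splittings
      of \<open>g\<close> with left factor in the dihedral group. The shortest such \<open>v\<close>
      leaves the longest dihedral factor.\<close>
    define Q where "Q v \<longleftrightarrow> v \<in> maps_of S \<and>
      (\<exists>u\<in>maps_of ?T. g = u \<circ> v \<and> len ?T u + len S v \<le> len S g)" for v
    have TS: "?T \<subseteq> S" using less.prems t by auto
    have "len ?T (r t) \<le> 1" by (rule len_r) simp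
    then have Q0: "Q (wm ms)"
      unfolding Q_def using ms by (intro conjI bexI[of _ "r t"]) (auto intro: r_maps_of)
    define v where "v = arg_min (len S) Q"
    have Qv: "Q v" and min: "\<And>x. Q x \<Longrightarrow> len S v \<le> len S x"
      unfolding v_def using arg_min_natI[of Q _ "len S"] arg_min_nat_le[of Q _ "len S"] Q0 by auto
    obtain u where u: "u \<in> maps_of ?T" "g = u \<circ> v" "len ?T u + len S v \<le> len S g"
      using Qv Q_def by auto
    have v: "v \<in> maps_of S" using Qv Q_def by auto
    have less_v: "len S v < len S g" using min[OF Q0] ms by simp
    \<comment> \<open>If \<open>r a\<close> shortened \<open>v\<close>, the letter \<open>a\<close>
      could be moved over to \<open>u\<close>, against the minimal length of \<open>v\<close>. So
      the induction hypothesis puts \<open>v y\<close> on the positive side of both mirrors.\<close>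
    have up: "len S (r a \<circ> v) \<ge> len S v" if a: "a \<in> ?T" for a
    proof (rule ccontr)
      assume n: "\<not> ?thesis"
      have aS: "a \<in> S" using a TS by auto
      have "r a \<circ> (r a \<circ> v) = v" using aS by (simp add: rr_comp)
      then have "g = (u \<circ> r a) \<circ> (r a \<circ> v)" using u(2) by (simp add: comp_assoc)
      moreover have "len ?T (u \<circ> r a) \<le> len ?T u + 1"
        using len_comp[OF u(1) r_maps_of[OF a]] len_r[OF a] by simp
      ultimately have "Q (r a \<circ> v)"
        unfolding Q_def using n u(3) maps_of_comp[OF u(1) r_maps_of[OF a]]
          maps_of_comp[OF r_maps_of[OF aS] v]
        by (intro conjI bexI[of _ "u \<circ> r a"]) auto
      then show False using min n by auto
    qed
    have pos: "B (v y) a > 0" if a: "a \<in> ?T" for a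
      using less.hyps[OF less_v v _ up[OF a] less.prems(4)] a TS by auto
    \<comment> \<open>Lengths add up in \<open>g = u \<circ> v\<close>, so a letter that shortened
      \<open>u\<close> would shorten \<open>g\<close> as well.\<close>
    have "len ?T (r s \<circ> u) \<ge> len ?T u"
    proof (rule ccontr)
      assume n: "\<not> ?thesis"
      have su: "r s \<circ> u \<in> maps_of ?T" using maps_of_comp[OF r_maps_of u(1)] by auto
      have "len S (r s \<circ> g) \<le> len S (r s \<circ> u) + len S v"
        using len_comp[of "r s \<circ> u" S v] su v maps_of_mono[OF TS] u(2) by (auto simp: comp_assoc)
      also have "\<dots> \<le> len ?T (r s \<circ> u) + len S v" using len_mono[OF su TS] by simp
      also have "\<dots> < len S g" using n u by simp
      finally show False using less.prems(3) by simp
    qed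
    then show ?thesis
      using dihedral[OF less.prems(2) t ne u(1) _ pos pos] u(2) by simp
  qed
qed

lemma first_letter:
  assumes "g \<in> maps_of S" "g \<noteq> id"
  obtains s h where "s \<in> S" "h \<in> maps_of S" "g = r s \<circ> h" "len S h < len S g"
    "len S (r s \<circ> h) \<ge> len S h"
proof -
  obtain ns where ns: "set ns \<subseteq> S" "length ns = len S g" "wm ns = g"
    using len_witness[OF assms(1)] by blast
  then obtain s ms where c: "ns = s # ms" using assms by (cases ns) auto
  have "len S (wm ms) < len S g" using c ns len_le[of ms S] by auto
  then show ?thesis using that[of s "wm ms"] ns c by (auto simp: maps_of_def)
qed

text \<open>Split off the first letter \<open>s\<close> of a shortest word:
  \<open>chamber_side\<close> puts the image under the rest on the positive side of
  \<open>s\<close>, so the full image lies on the negative side.\<close>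

theorem chamber_disjoint:
  assumes "g \<in> maps_of S" "y \<in> chamber" "g y \<in> chamber"
  shows "g = id"
proof (rule ccontr)
  assume "g \<noteq> id"
  then obtain s h where h: "s \<in> S" "h \<in> maps_of S" "g = r s \<circ> h" "len S (r s \<circ> h) \<ge> len S h"
    using first_letter assms by metis
  have "B (h y) s > 0" using chamber_side h assms by blast
  moreover have "B (g y) s = - B (h y) s"
    using h norm2[OF h(1)] by (simp add: reflection_def form_simps)
  ultimately show False using assms(3) h(1) by (auto simp: chamber_def)
qed

text \<open>Each letter of a shortest word subtracts the product of two nonnegative numbers from the
  pairing with \<open>e\<close>. With \<open>e\<close> the ideal point at infinity this says that
  chamber points are the highest of their orbits. Here \<open>y\<close> is only in the closed
  chamber, whereas \<open>chamber_side\<close> speaks of open chamber points, hence the perturbation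
  below.\<close>

theorem chamber_minimal:
  assumes "g \<in> maps_of S" "\<And>s. s \<in> S \<Longrightarrow> B y s \<ge> 0" "\<And>s. s \<in> S \<Longrightarrow> B e s \<ge> 0"
    and "chamber \<noteq> {}"
  shows "B (g y) e \<le> B y e"
  using assms(1)
proof (induction "len S g" arbitrary: g rule: less_induct)
  case less
  show ?case
  proof (cases "g = id")
    case False
    then obtain s h where h: "s \<in> S" "h \<in> maps_of S" "g = r s \<circ> h" "len S h < len S g"
      "len S (r s \<circ> h) \<ge> len S h"
      using first_letter less.prems by metis
    obtain c where c: "c \<in> chamber" using assms(4) by auto
    have lin: "linear h" using h(2) unfolding maps_of_def
    proof clarsimp
      fix ns show "linear (wm ns)"
        by (induction ns) (simp_all only: word_map_Nil word_map_Cons linear_id linear_compose[OF _ reflection_linear])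
    qed
    \<comment> \<open>Adding a small multiple of an open chamber point \<open>c\<close> moves
      \<open>y\<close> into the open chamber.\<close>
    have lim: "B (h y) s + \<epsilon> * B (h c) s > 0" if e: "\<epsilon> > 0" for \<epsilon>
    proof -
      have "B (y + \<epsilon> *\<^sub>R c) t > 0" if "t \<in> S" for t
      proof -
        have "\<epsilon> * B c t > 0" using c e that by (simp add: chamber_def)
        then show ?thesis using assms(2)[OF that] by (simp add: form_simps)
      qed
      then have "y + \<epsilon> *\<^sub>R c \<in> chamber" by (simp add: chamber_def)
      then have "B (h (y + \<epsilon> *\<^sub>R c)) s > 0" by (rule chamber_side[OF h(2,1,5)])
      then show ?thesis using lin by (simp add: linear_add linear_cmul form_simps)
    qed
    have hy: "B (h y) s \<ge> 0"
    proof (rule ccontr)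
      assume n: "\<not> ?thesis"
      define b where "b = B (h c) s"
      \<comment> \<open>Small enough that the contribution of \<open>c\<close>, at most
        \<open>\<epsilon>\<close> times \<open>\<bar>b\<bar> + 1\<close>, cannot outweigh the
        negative value at \<open>y\<close>; the 1 keeps the denominator positive.\<close>
      define \<epsilon> where "\<epsilon> = - B (h y) s / (\<bar>b\<bar> + 1)"
      have "\<epsilon> > 0" unfolding \<epsilon>_def using n by (intro divide_pos_pos) auto
      moreover have "\<epsilon> * (\<bar>b\<bar> + 1) = - B (h y) s" by (simp add: \<epsilon>_def)
      moreover have "\<epsilon> * b \<le> \<epsilon> * (\<bar>b\<bar> + 1)" using \<open>\<epsilon> > 0\<close> by (intro mult_left_mono) auto
      ultimately show False using lim[of \<epsilon>] by (simp add: b_def)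
    qed
    have 1: "B (h y) s * B e s \<ge> 0" by (rule mult_nonneg_nonneg[OF hy assms(3)[OF h(1)]])
    have "g y = r s (h y)" by (subst h(3)) (rule comp_apply)
    then have 2: "B (g y) e = B (h y) e - B (h y) s * B e s"
      by (simp add: reflection_def form_simps sym[of s e])
    have 3: "B (h y) e \<le> B y e" by (rule less.hyps[OF h(4,2)])
    show ?thesis using 1 2 3 by linarith
  qed simp
qed

end

section \<open>The hyperboloid model\<close>

text \<open>Coordinates \<open>(u, v, w)\<close> in which the quadratic form is \<open>2 (|v|\<^sup>2 - u w)\<close>; the ideal point
  \<open>\<infinity>\<close> is the null vector \<open>(1, 0, 0)\<close>.\<close>

definition mform :: "real \<times> 'v::euclidean_space \<times> real \<Rightarrow> real \<times> 'v \<times> real \<Rightarrow> real" where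
  "mform x y = 2 * (fst (snd x) \<bullet> fst (snd y)) - fst x * snd (snd y) - snd (snd x) * fst y"

lemma mform_eq: "mform (u, v, w) (u', v', w') = 2 * (v \<bullet> v') - u * w' - w * u'"
  by (simp add: mform_def)

interpretation mf: sym_form mform
  by unfold_locales (auto simp: mform_def inner_commute inner_add_left algebra_simps)

text \<open>The image is the sheet \<open>u w - |v|\<^sup>2 = 1\<close>, \<open>w > 0\<close>, where
  \<open>mform\<close> is -2. The last coordinate is the reciprocal height, so comparing heights
  means pairing with the ideal point at infinity.\<close>

definition hyp :: "'v::euclidean_space \<times> real \<Rightarrow> real \<times> 'v \<times> real" where
  "hyp p = ((p \<bullet> p) / snd p, (1 / snd p) *\<^sub>R fst p, 1 / snd p)"

definition side :: "real \<times> 'v::euclidean_space \<times> real \<Rightarrow> 'v \<times> real \<Rightarrow> real" where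
  "side n p = mform (hyp p) n"

lemma uhs_iff: "(z, t) \<in> uhs \<longleftrightarrow> t > 0"
  by (simp add: uhs_def)

lemma uhsD: "p \<in> uhs \<Longrightarrow> snd p > 0"
  by (simp add: uhs_def)

lemma open_uhs: "open (uhs :: ('v::euclidean_space \<times> real) set)"
proof -
  have "open (snd -` {0::real<..} :: ('v::euclidean_space \<times> real) set)"
    by (rule open_vimage_snd) simp
  also have "(snd -` {0::real<..} :: ('v \<times> real) set) = uhs" by (auto simp: uhs_def)
  finally show ?thesis .
qed

lemma hyp_inj: "p \<in> uhs \<Longrightarrow> q \<in> uhs \<Longrightarrow> hyp p = hyp q \<Longrightarrow> p = q"
  by (auto simp: hyp_def uhs_def prod_eq_iff)

lemma mform_hyp:
  assumes "p \<in> uhs" "q \<in> uhs"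
  shows "mform (hyp p) (hyp q) = - 2 - (dist p q)\<^sup>2 / (snd p * snd q)"
proof -
  obtain z t z' t' where pq: "p = (z, t)" "q = (z', t')" by (cases p, cases q) auto
  have "(dist p q)\<^sup>2 = (z - z') \<bullet> (z - z') + (t - t')\<^sup>2"
    by (simp add: pq dist_prod_def dist_norm power2_norm_eq_inner[symmetric] dist_real_def)
  also have "\<dots> = z \<bullet> z - 2 * (z \<bullet> z') + z' \<bullet> z' + (t - t')\<^sup>2"
    by (simp add: inner_diff_left inner_diff_right inner_commute)
  finally have d: "(dist p q)\<^sup>2 = z \<bullet> z - 2 * (z \<bullet> z') + z' \<bullet> z' + (t - t')\<^sup>2" .
  show ?thesis
    using assms unfolding d
    by (simp add: pq hyp_def mform_eq uhs_iff inner_prod_def field_simps power2_eq_square)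
qed

lemma mform_hyp_self: "p \<in> uhs \<Longrightarrow> mform (hyp p) (hyp p) = - 2"
  by (simp add: mform_hyp)

lemma cosh_hdist:
  assumes "p \<in> uhs" "q \<in> uhs"
  shows "cosh (hdist p q) = - mform (hyp p) (hyp q) / 2" "hdist p q \<ge> 0"
proof -
  have "1 + (dist p q)\<^sup>2 / (2 * snd p * snd q) \<ge> 1"
    using assms by (auto dest!: uhsD)
  then show "cosh (hdist p q) = - mform (hyp p) (hyp q) / 2" "hdist p q \<ge> 0"
    using assms by (auto simp: hdist_def cosh_arcosh_real mform_hyp field_simps arcosh_nonneg_real)
qed

lemma hdist_alt:
  assumes "p \<in> uhs" "q \<in> uhs"
  shows "hdist p q = arcosh (- mform (hyp p) (hyp q) / 2)"
proof -
  have "- mform (hyp p) (hyp q) / 2 = 1 + (dist p q)\<^sup>2 / (2 * snd p * snd q)"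
    using assms by (simp add: mform_hyp add_divide_distrib mult_ac)
  then show ?thesis by (simp only: hdist_def)
qed

lemma hyp_surj:
  assumes "w > 0" "u * w - v \<bullet> v = 1"
  obtains p where "p \<in> uhs" "hyp p = (u, v, w)"
proof
  show "(v /\<^sub>R w, 1 / w) \<in> uhs" using assms by (simp add: uhs_iff)
  show "hyp (v /\<^sub>R w, 1 / w) = (u, v, w)"
  proof -
    have "u * w = 1 + v \<bullet> v" using assms by simp
    then have "u = (1 + v \<bullet> v) / w" using assms(1) by (simp add: nonzero_eq_divide_eq)
    then show ?thesis using assms(1) by (simp only:) (simp add: hyp_def inner_prod_def field_simps)
  qed
qed

text \<open>The form has signature (n, 1), so it is positive definite on the complement of a
  timelike vector. This serves to prove equations in the hyperboloid from inner products
  alone.\<close>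

lemma null_orthogonal:
  assumes "mform y y = 0" "mform y x = 0" "mform x x < 0"
  shows "y = (0, 0, 0)"
proof -
  obtain u v w where y: "y = (u, v, w)" by (cases y) auto
  obtain a b c where x: "x = (a, b, c)" by (cases x) auto
  have 1: "v \<bullet> v = u * w" using assms(1) by (simp add: y mform_eq)
  have 2: "2 * (v \<bullet> b) = u * c + w * a" using assms(2) by (simp add: x y mform_eq)
  have 3: "a * c - b \<bullet> b > 0" using assms(3) by (simp add: x mform_eq algebra_simps)
  \<comment> \<open>This is half the form value of \<open>c y - w x\<close>: the last coordinate of
    that vector vanishes, so only its middle coordinate contributes.\<close>
  have "(c *\<^sub>R v - w *\<^sub>R b) \<bullet> (c *\<^sub>R v - w *\<^sub>R b)
      = c\<^sup>2 * (v \<bullet> v) - c * w * (2 * (v \<bullet> b)) + w\<^sup>2 * (b \<bullet> b)"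
    by (simp add: inner_diff_left inner_diff_right inner_commute power2_eq_square algebra_simps)
  also have "\<dots> = - (w\<^sup>2 * (a * c - b \<bullet> b))"
    unfolding 1 2 by (simp add: power2_eq_square algebra_simps)
  finally have eq: "(c *\<^sub>R v - w *\<^sub>R b) \<bullet> (c *\<^sub>R v - w *\<^sub>R b) = - (w\<^sup>2 * (a * c - b \<bullet> b))" .
  then have "w\<^sup>2 * (a * c - b \<bullet> b) \<le> 0"
    by (metis inner_ge_zero neg_0_le_iff_le)
  then have w: "w = 0" using 3 by (simp add: mult_le_0_iff)
  then have "v = 0" using 1 by simp
  moreover have "c \<noteq> 0" using 3 inner_ge_zero[of b] by (metis diff_0 mult_zero_right neg_0_less_iff_less not_le)
  ultimately have "u = 0" using 2 w by simp
  then show ?thesis using w \<open>v = 0\<close> y by simp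
qed

lemma hdist_0_imp_eq:
  assumes "p \<in> uhs" "q \<in> uhs" "hdist p q = 0"
  shows "p = q"
proof -
  have "mform (hyp p) (hyp q) = - 2" using cosh_hdist[OF assms(1,2)] assms(3) by simp
  then have "(dist p q)\<^sup>2 / (snd p * snd q) = 0" using mform_hyp[OF assms(1,2)] by simp
  then show ?thesis using assms by (auto simp: uhs_def)
qed

text \<open>With \<open>a\<close> and \<open>b\<close> the distances from \<open>r\<close> to the
  ends, the coefficients are those of hyperbolic interpolation, \<open>sinh b / sinh (a + b)\<close>
  and \<open>sinh a / sinh (a + b)\<close>. The difference \<open>y\<close> of the two sides
  (cleared of denominators) is null and orthogonal to \<open>hyp r\<close>, so
  \<open>null_orthogonal\<close> makes it vanish. Linear inequalities thereby pass to
  segments.\<close>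

lemma segment_hyp:
  assumes p: "p \<in> uhs" and q: "q \<in> uhs" and r: "r \<in> hyp_segment p q"
  obtains l m where "l \<ge> 0" "m \<ge> 0" "hyp r = l *\<^sub>R hyp p + m *\<^sub>R hyp q"
    "r \<noteq> q \<Longrightarrow> l > 0" "r \<noteq> p \<Longrightarrow> m > 0"
proof -
  have ru: "r \<in> uhs" using r by (simp add: hyp_segment_def)
  define a b where "a = hdist p r" and "b = hdist r q"
  have ab: "hdist p q = a + b" using r by (simp add: hyp_segment_def a_def b_def)
  have nn: "a \<ge> 0" "b \<ge> 0" using cosh_hdist(2)[OF p ru] cosh_hdist(2)[OF ru q] by (simp_all add: a_def b_def)
  show ?thesis
  proof (cases "a + b = 0")
    case True
    then have "a = 0" "b = 0" using nn by auto
    then have "p = r" "r = q" using hdist_0_imp_eq[OF p ru] hdist_0_imp_eq[OF ru q] by (simp_all add: a_def b_def)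
    then show ?thesis using that[of 1 0] by auto
  next
    case False
    then have pos: "sinh (a + b) > 0" using nn by simp
    define y where "y = sinh b *\<^sub>R hyp p + sinh a *\<^sub>R hyp q - sinh (a + b) *\<^sub>R hyp r"
    have B: "mform (hyp p) (hyp r) = - 2 * cosh a" "mform (hyp r) (hyp p) = - 2 * cosh a"
      "mform (hyp r) (hyp q) = - 2 * cosh b" "mform (hyp q) (hyp r) = - 2 * cosh b"
      "mform (hyp p) (hyp q) = - 2 * cosh (a + b)" "mform (hyp q) (hyp p) = - 2 * cosh (a + b)"
      
      using cosh_hdist(1)[OF p ru] cosh_hdist(1)[OF ru q] cosh_hdist(1)[OF p q] ab
        mf.sym[of "hyp p" "hyp r"] mf.sym[of "hyp q" "hyp r"] mf.sym[of "hyp p" "hyp q"]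
      by (simp_all add: a_def b_def)
    have S: "sinh (a + b) = sinh b * cosh a + sinh a * cosh b"
      by (simp add: sinh_add)
    have yr: "mform y (hyp r) = 0"
      using p q ru S by (simp add: y_def mf.form_simps B mform_hyp_self algebra_simps)
    have "mform y y = sinh b * mform y (hyp p) + sinh a * mform y (hyp q) - sinh (a + b) * mform y (hyp r)"
      by (subst (2) y_def) (simp add: mf.form_simps)
    also have "\<dots> = sinh b * mform y (hyp p) + sinh a * mform y (hyp q)" using yr by simp
    also have "\<dots> = - 2 * (sinh a)\<^sup>2 - 2 * (sinh b)\<^sup>2 - 4 * sinh a * sinh b * cosh (a + b)
       + 2 * sinh (a + b) * (sinh b * cosh a + sinh a * cosh b)"
      using p q ru by (simp add: y_def mf.form_simps B mform_hyp_self algebra_simps power2_eq_square)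
    also have "\<dots> = 2 * (sinh a)\<^sup>2 * ((cosh b)\<^sup>2 - (sinh b)\<^sup>2 - 1) + 2 * (sinh b)\<^sup>2 * ((cosh a)\<^sup>2 - (sinh a)\<^sup>2 - 1)"
      unfolding S cosh_add by (simp add: algebra_simps power2_eq_square)
    also have "\<dots> = 0" by (simp add: hyperbolic_pythagoras)
    finally have "y = (0, 0, 0)"
      using yr mform_hyp_self[OF ru] by (intro null_orthogonal[of y "hyp r"]) auto
    then have "sinh (a + b) *\<^sub>R hyp r = sinh b *\<^sub>R hyp p + sinh a *\<^sub>R hyp q"
      by (simp add: y_def zero_prod_def[symmetric])
    then have "hyp r = (sinh b / sinh (a + b)) *\<^sub>R hyp p + (sinh a / sinh (a + b)) *\<^sub>R hyp q"
      using pos by (metis (no_types, lifting) divide_inverse_commute less_numeral_extra(3)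
          real_vector_affinity_eq scaleR_add_right scaleR_scaleR vector_fraction_eq_iff 
          pth_1 left_inverse scaleR_one)
    moreover have "r \<noteq> q \<Longrightarrow> b > 0" "r \<noteq> p \<Longrightarrow> a > 0"
      using hdist_0_imp_eq[OF ru q] hdist_0_imp_eq[OF p ru] nn
      by (auto simp: a_def b_def less_le)
    ultimately show ?thesis using that[of "sinh b / sinh (a + b)" "sinh a / sinh (a + b)"] pos nn
      by auto
  qed
qed

text \<open>Segments are defined metrically, so points on them have to be exhibited; midpoints are
  enough to show that a convex set is not contained in the union of two mirrors unless it lies in
  one of them.\<close>

lemma midpoint_exists:
  assumes p: "p \<in> uhs" and q: "q \<in> uhs"
  obtains r l where "r \<in> hyp_segment p q" "l > 0" "hyp r = l *\<^sub>R (hyp p + hyp q)"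
proof -
  define d where "d = hdist p q / 2"
  have d: "hdist p q = 2 * d" "d \<ge> 0" using cosh_hdist[OF p q] by (auto simp: d_def)
  have B: "mform (hyp p) (hyp q) = - 2 * cosh (2 * d)"
    using cosh_hdist[OF p q] d by simp
  have c2: "cosh (2 * d) = 2 * (cosh d)\<^sup>2 - 1" by (simp add: cosh_double_cosh)
  have cpos: "cosh d > 0" by simp
  \<comment> \<open>The sum of the two vectors has form value -8 \<open>(cosh d)\<^sup>2\<close>;
    this factor scales it back to -2.\<close>
  define l where "l = 1 / (2 * cosh d)"
  define x where "x = l *\<^sub>R (hyp p + hyp q)"
  have xx: "mform x x = - 2"
  proof -
    have "mform x x = l\<^sup>2 * (- 4 - 4 * cosh (2 * d))"
      using p q B mf.sym[of "hyp q" "hyp p"]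
      by (simp add: x_def mf.form_simps mform_hyp_self power2_eq_square algebra_simps)
    also have "\<dots> = - 2 * (2 * l * cosh d)\<^sup>2"
      unfolding c2 by (simp add: power2_eq_square algebra_simps)
    finally show ?thesis by (simp add: l_def)
  qed
  obtain u v w where x: "x = (u, v, w)" by (cases x) auto
  have w: "w = l * (1 / snd p + 1 / snd q)" using x by (simp add: x_def hyp_def)
  have "w > 0" using p q by (simp add: w l_def uhs_def add_pos_pos)
  moreover have "u * w - v \<bullet> v = 1" using xx by (simp add: x mform_eq algebra_simps)
  ultimately obtain r where r: "r \<in> uhs" "hyp r = x" using hyp_surj x by metis
  have "mform (hyp p) (hyp r) = - 2 * cosh d" "mform (hyp r) (hyp q) = - 2 * cosh d"
  proof -
    have "mform (hyp p) (hyp r) = l * (- 2 - 2 * cosh (2 * d))" 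
      "mform (hyp r) (hyp q) = l * (- 2 - 2 * cosh (2 * d))"
      using p q B unfolding r(2) x_def by (simp_all add: mf.form_simps mform_hyp_self algebra_simps)
    moreover have "l * (- 2 - 2 * cosh (2 * d)) = - (2 * l * cosh d) * (2 * cosh d)"
      unfolding c2 by (simp add: power2_eq_square algebra_simps)
    moreover have "2 * l * cosh d = 1" by (simp add: l_def)
    ultimately show "mform (hyp p) (hyp r) = - 2 * cosh d" "mform (hyp r) (hyp q) = - 2 * cosh d" by simp_all
  qed
  then have "hdist p r = d" "hdist r q = d"
    using hdist_alt[OF p r(1)] hdist_alt[OF r(1) q] d by (simp_all add: arcosh_cosh_real)
  then have "r \<in> hyp_segment p q" using r d by (simp add: hyp_segment_def)
  moreover have "l > 0" by (simp add: l_def)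
  ultimately show ?thesis using that r x_def by simp
qed

section \<open>Polyhedra with finitely many walls\<close>

definition polyh :: "(real \<times> 'v::euclidean_space \<times> real) set \<Rightarrow> ('v \<times> real) set" where
  "polyh N = {p \<in> uhs. \<forall>n\<in>N. side n p \<ge> 0}"

definition polyh_open :: "(real \<times> 'v::euclidean_space \<times> real) set \<Rightarrow> ('v \<times> real) set" where
  "polyh_open N = {p \<in> uhs. \<forall>n\<in>N. side n p > 0}"

lemma side_segment:
  assumes "p \<in> uhs" "q \<in> uhs" "r \<in> hyp_segment p q"
  obtains l m where "l \<ge> 0" "m \<ge> 0" "\<And>n. side n r = l * side n p + m * side n q"
    "r \<noteq> q \<Longrightarrow> l > 0" "r \<noteq> p \<Longrightarrow> m > 0"
proof -
  obtain l m where "l \<ge> 0" "m \<ge> 0" "hyp r = l *\<^sub>R hyp p + m *\<^sub>R hyp q"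
    "r \<noteq> q \<Longrightarrow> l > 0" "r \<noteq> p \<Longrightarrow> m > 0"
    using segment_hyp[OF assms] by metis
  then show ?thesis using that[of l m] by (simp add: side_def mf.form_simps)
qed

lemma hyp_convex_polyh_slice: "hyp_convex {p \<in> polyh N. \<forall>n\<in>N'. side n p = 0}"
proof -
  have "r \<in> {p \<in> polyh N. \<forall>n\<in>N'. side n p = 0}"
    if pq: "p \<in> {p \<in> polyh N. \<forall>n\<in>N'. side n p = 0}" "q \<in> {p \<in> polyh N. \<forall>n\<in>N'. side n p = 0}"
      and r: "r \<in> hyp_segment p q" for p q r
  proof -
    have u: "p \<in> uhs" "q \<in> uhs" "r \<in> uhs" using pq r by (auto simp: polyh_def hyp_segment_def)
    obtain l m where "l \<ge> 0" "m \<ge> 0" "\<And>n. side n r = l * side n p + m * side n q"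
      using side_segment[OF u(1,2) r] by metis
    then show ?thesis using pq u by (auto simp: polyh_def)
  qed
  moreover have "{p \<in> polyh N. \<forall>n\<in>N'. side n p = 0} \<subseteq> uhs" by (auto simp: polyh_def)
  ultimately show ?thesis unfolding hyp_convex_def by blast
qed

lemma hyp_convex_polyh: "hyp_convex (polyh N)"
  using hyp_convex_polyh_slice[of N "{}"] by simp

lemma continuous_side: "continuous_on uhs (side n)"
  unfolding side_def[abs_def] hyp_def mform_def
  by (intro continuous_intros) (auto simp: uhs_def)

lemma closedin_polyh:
  fixes N :: "(real \<times> 'v::euclidean_space \<times> real) set"
  shows "closedin (top_of_set uhs) (polyh N)"
proof -
  have "closedin (top_of_set uhs) (uhs \<inter> side n -` {0..})" for n :: "real \<times> 'v \<times> real"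
    by (intro continuous_closedin_preimage continuous_side) simp
  then have "N \<noteq> {} \<Longrightarrow> closedin (top_of_set uhs) (\<Inter>n\<in>N. uhs \<inter> side n -` {0..})"
    by (intro closedin_INT)
  then have "closedin (top_of_set uhs) (uhs \<inter> (\<Inter>n\<in>N. uhs \<inter> side n -` {0..}))"
    by (cases "N = {}") (use closedin_topspace[of "top_of_set uhs"] in \<open>auto intro!: closedin_Int\<close>)
  moreover have "uhs \<inter> (\<Inter>n\<in>N. uhs \<inter> side n -` {0..}) = polyh N"
    by (auto simp: polyh_def)
  ultimately show ?thesis by simp
qed

lemma open_polyh_open:
  fixes N :: "(real \<times> 'v::euclidean_space \<times> real) set"
  assumes "finite N"
  shows "open (polyh_open N)"
proof -
  have "open (uhs \<inter> side n -` {0<..})" for n :: "real \<times> 'v \<times> real"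
    by (intro continuous_open_preimage continuous_side open_uhs) simp
  then have "open (uhs \<inter> (\<Inter>n\<in>N. uhs \<inter> side n -` {0<..}))"
    using assms by (intro open_Int open_INT open_uhs) auto
  moreover have "uhs \<inter> (\<Inter>n\<in>N. uhs \<inter> side n -` {0<..}) = polyh_open N"
    by (auto simp: polyh_open_def)
  ultimately show ?thesis by simp
qed

lemma side_scaled:
  "snd p \<noteq> 0 \<Longrightarrow> snd p * side (a, v, b) p = 2 * (fst p \<bullet> v) - b * (p \<bullet> p) - a"
  by (simp add: side_def hyp_def mform_eq field_simps)

text \<open>After multiplication by the height, \<open>side\<close> is a polynomial that is explicit
  enough to be made negative nearby: by a vertical move if the mirror is a hemisphere, and by a move
  along \<open>v\<close> if it is a vertical plane, where \<open>mform n n > 0\<close> ensures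
  \<open>v \<noteq> 0\<close>.\<close>

lemma mirror_not_interior:
  assumes n: "mform n n > 0" and p: "p \<in> uhs" "side n p = 0" and P: "\<And>q. q \<in> P \<Longrightarrow> q \<in> uhs \<Longrightarrow> side n q \<ge> 0"
  shows "p \<notin> interior P"
proof
  assume "p \<in> interior P"
  then have "p \<in> interior P \<inter> uhs" using p by simp
  moreover have "open (interior P \<inter> uhs)" by (intro open_Int open_interior open_uhs)
  ultimately obtain e where e: "e > 0" "ball p e \<subseteq> interior P \<inter> uhs"
    by (meson openE)
  obtain a v b where nn: "n = (a, v, b)" by (cases n) auto
  obtain z t where pp: "p = (z, t)" by (cases p)
  have t: "t > 0" using p by (simp add: pp uhs_iff)
  have ge: "2 * (z' \<bullet> v) - b * (z' \<bullet> z' + t' * t') - a \<ge> 0" if "dist (z', t') p < e" for z' t'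
  proof -
    have "(z', t') \<in> P" "(z', t') \<in> uhs" using e that interior_subset
      by (auto simp: dist_commute subset_iff)
    then have "side n (z', t') \<ge> 0" "t' > 0" using P by (auto simp: uhs_iff)
    then have "t' * side n (z', t') \<ge> 0" by simp
    then show ?thesis using \<open>t' > 0\<close> side_scaled[of "(z', t')" a v b] by (simp add: nn inner_prod_def)
  qed
  have 0: "2 * (z \<bullet> v) - b * (z \<bullet> z + t * t) - a = 0"
    using side_scaled[of p a v b] p t by (simp add: nn pp inner_prod_def)
  define \<epsilon> where "\<epsilon> = min (e / 2) t"
  have \<epsilon>: "\<epsilon> > 0" "\<epsilon> < e" "\<epsilon> \<le> t" using e t by (auto simp: \<epsilon>_def)
  show False
  proof (cases "b = 0")
    case False
    have "dist (z, t + \<epsilon>) p < e" "dist (z, t - \<epsilon>) p < e"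
      using \<epsilon> by (auto simp: pp dist_prod_def dist_real_def)
    from ge[OF this(1)] ge[OF this(2)] 0
    have "b * ((t + \<epsilon>) * (t + \<epsilon>) - t * t) \<le> 0" "b * ((t - \<epsilon>) * (t - \<epsilon>) - t * t) \<le> 0"
      by (auto simp: algebra_simps)
    moreover have "(t + \<epsilon>) * (t + \<epsilon>) - t * t > 0" using \<epsilon> t by (simp add: algebra_simps add_pos_pos)
    moreover have "(t - \<epsilon>) * (t - \<epsilon>) - t * t < 0"
    proof -
      have "(t - \<epsilon>) * (t - \<epsilon>) \<le> (t - \<epsilon>) * t" using \<epsilon> by (intro mult_left_mono) auto
      also have "\<dots> < t * t" using \<epsilon> t by (intro mult_strict_right_mono) auto
      finally show ?thesis by simp
    qed
    ultimately show False using False by (smt (verit) mult_pos_pos mult_neg_neg)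
  next
    case True
    then have v: "v \<noteq> 0" using n by (auto simp: nn mform_eq)
    have "dist (z - (\<epsilon> / norm v) *\<^sub>R v, t) p < e"
      using \<epsilon> v by (simp add: pp dist_prod_def dist_norm)
    from ge[OF this] 0 have "(\<epsilon> / norm v) * (v \<bullet> v) \<le> 0"
      using True by (simp add: inner_diff_left)
    moreover have "(\<epsilon> / norm v) * (v \<bullet> v) > 0"
      using \<epsilon> v by (intro mult_pos_pos divide_pos_pos) auto
    ultimately show False by linarith
  qed
qed

lemma interior_polyh:
  assumes "finite N" "\<And>n. n \<in> N \<Longrightarrow> mform n n > 0"
  shows "interior (polyh N) = polyh_open N"
proof
  show "polyh_open N \<subseteq> interior (polyh N)"
    using open_polyh_open[OF assms(1)]
    by (intro interior_maximal) (auto simp: polyh_def polyh_open_def less_imp_le)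
  have nz: "side n p \<noteq> 0" if "p \<in> interior (polyh N)" "n \<in> N" for n p
    using that mirror_not_interior[OF assms(2), of n p "polyh N"] interior_subset[of "polyh N"]
    by (auto simp: polyh_def)
  show "interior (polyh N) \<subseteq> polyh_open N"
  proof
    fix p assume p: "p \<in> interior (polyh N)"
    then have "p \<in> polyh N" using interior_subset by auto
    then have "side n p > 0" if "n \<in> N" for n
      using nz[OF p that] that unfolding polyh_def by (simp add: order_less_le)
    then show "p \<in> polyh_open N"
      using \<open>p \<in> polyh N\<close> by (simp add: polyh_def polyh_open_def)
  qed
qed

lemma frontier_polyh:
  assumes "finite N" "\<And>n. n \<in> N \<Longrightarrow> mform n n > 0"
  shows "frontier (polyh N) \<inter> uhs = polyh N - polyh_open N"
proof -
  obtain T where T: "closed T" "polyh N = uhs \<inter> T"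
    using closedin_polyh[of N] by (auto simp: closedin_closed)
  then have "closure (polyh N) \<subseteq> T" by (intro closure_minimal) auto
  then have "closure (polyh N) \<inter> uhs = polyh N"
    using T(2) closure_subset[of "polyh N"] by blast
  then show ?thesis using interior_polyh[OF assms] unfolding frontier_def by blast
qed

text \<open>Taking midpoints adds up the nonnegative side values, so strict positivity can be
  collected one mirror at a time. By contraposition, a convex subset of the boundary of a polyhedron
  lies in a single mirror.\<close>

lemma convex_in_mirror:
  assumes C: "hyp_convex C" "C \<noteq> {}" and N: "finite N" and nn: "\<And>p n. p \<in> C \<Longrightarrow> n \<in> N \<Longrightarrow> side n p \<ge> 0"
    and ex: "\<And>n. n \<in> N \<Longrightarrow> \<exists>p\<in>C. side n p > 0"
  shows "\<exists>p\<in>C. \<forall>n\<in>N. side n p > 0"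
  using N nn ex
proof (induction N)
  case empty
  obtain p where "p \<in> C" using C(2) by blast
  then show ?case by (intro bexI[of _ p]) simp_all
next
  case (insert n N)
  obtain p where p: "p \<in> C" "\<forall>m\<in>N. side m p > 0" using insert by blast
  obtain q where q: "q \<in> C" "side n q > 0" using insert by blast
  have nnp: "side m p \<ge> 0" "side m q \<ge> 0" if "m \<in> insert n N" for m
    using insert.prems(1) that p(1) q(1) by blast+
  have u: "p \<in> uhs" "q \<in> uhs" using p q C by (auto simp: hyp_convex_def)
  obtain r l where r: "r \<in> hyp_segment p q" "l > 0" "hyp r = l *\<^sub>R (hyp p + hyp q)"
    using midpoint_exists[OF u] by blast
  have "side m r = l * (side m p + side m q)" for m
    using r(3) by (simp add: side_def mf.form_simps)
  moreover have "r \<in> C" using r(1) p(1) q(1) C(1) unfolding hyp_convex_def by blast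
  moreover have "side m p + side m q > 0" if "m \<in> insert n N" for m
    using nnp[OF that] p(2) q(2) that by (cases "m = n") (simp_all add: add_nonneg_pos add_pos_nonneg)
  ultimately show ?case using r(2) by (metis mult_pos_pos)
qed

text \<open>A side lies in one mirror by \<open>convex_in_mirror\<close> and then fills the slice by
  maximality. Only an inclusion holds in general, since a redundant wall cuts out a slice that is
  empty or not maximal.\<close>

theorem sides_polyh:
  assumes "finite N" "\<And>n. n \<in> N \<Longrightarrow> mform n n > 0"
  shows "sides (polyh N) \<subseteq> (\<lambda>n. {p \<in> polyh N. side n p = 0}) ` N"
proof
  fix C assume C: "C \<in> sides (polyh N)"
  note fr = frontier_polyh[OF assms]
  have C1: "C \<noteq> {}" "C \<subseteq> polyh N - polyh_open N" "hyp_convex C"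
    using C fr by (auto simp: sides_def)
  have "\<exists>n\<in>N. \<forall>p\<in>C. side n p = 0"
  proof (rule ccontr)
    assume "\<not> ?thesis"
    moreover have nn: "\<And>p n. p \<in> C \<Longrightarrow> n \<in> N \<Longrightarrow> side n p \<ge> 0" using C1 by (auto simp: polyh_def)
    ultimately have "\<And>n. n \<in> N \<Longrightarrow> \<exists>p\<in>C. side n p > 0" by (fastforce simp: less_le)
    from convex_in_mirror[OF C1(3,1) assms(1) nn this] obtain p where
      "p \<in> C" "\<forall>n\<in>N. side n p > 0" by blast
    then show False using C1 by (auto simp: polyh_def polyh_open_def)
  qed
  then obtain n where n: "n \<in> N" "\<forall>p\<in>C. side n p = 0" by blast
  let ?S = "{p \<in> polyh N. side n p = 0}"
  have "?S \<subseteq> frontier (polyh N) \<inter> uhs" using n(1) fr by (auto simp: polyh_open_def)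
  moreover have "hyp_convex ?S" using hyp_convex_polyh_slice[of N "{n}"] by simp
  moreover have "C \<subseteq> ?S" using C1 n by auto
  ultimately have "?S = C" using C by (auto simp: sides_def)
  then show "C \<in> (\<lambda>n. {p \<in> polyh N. side n p = 0}) ` N" using n by auto
qed

section \<open>Sphere inversions and vertical extensions\<close>

definition inv_map :: "'v::euclidean_space \<Rightarrow> 'v \<times> real \<Rightarrow> 'v \<times> real" where
  "inv_map \<alpha> p = (\<alpha>, 0) + (1 / ((p - (\<alpha>, 0)) \<bullet> (p - (\<alpha>, 0)))) *\<^sub>R (p - (\<alpha>, 0))"

definition vmap :: "('v \<Rightarrow> 'v) \<Rightarrow> 'v \<times> real \<Rightarrow> 'v \<times> real" where
  "vmap a p = (a (fst p), snd p)"

text \<open>\<open>sroot \<alpha>\<close> is the mirror of the unit hemisphere about \<open>\<alpha>\<close>, \<open>proot u k\<close> that of the vertical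
  plane \<open>2 \<langle>z, u\<rangle> + k = 0\<close>.\<close>

definition sroot :: "'v::euclidean_space \<Rightarrow> real \<times> 'v \<times> real" where
  "sroot \<alpha> = (1 - \<alpha> \<bullet> \<alpha>, - \<alpha>, - 1)"

definition proot :: "'v::euclidean_space \<Rightarrow> real \<Rightarrow> real \<times> 'v \<times> real" where
  "proot u k = (- k, u, 0)"

definition val :: "'v::euclidean_space \<Rightarrow> real \<Rightarrow> 'v \<Rightarrow> real" where
  "val u k z = 2 * (z \<bullet> u) + k"

definition prefl :: "'v::euclidean_space \<Rightarrow> real \<Rightarrow> 'v \<Rightarrow> 'v" where
  "prefl u k z = z - val u k z *\<^sub>R u"

text \<open>The unipotent isometry of the form that fixes the ideal point at infinity; it is the
  translation by \<open>l\<close> in hyperboloid coordinates.\<close>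

definition tlin :: "'v::euclidean_space \<Rightarrow> real \<times> 'v \<times> real \<Rightarrow> real \<times> 'v \<times> real" where
  "tlin l x = (fst x + 2 * (fst (snd x) \<bullet> l) + snd (snd x) * (l \<bullet> l),
     fst (snd x) + snd (snd x) *\<^sub>R l, snd (snd x))"

definition einf :: "real \<times> 'v::euclidean_space \<times> real" where
  "einf = (1, 0, 0)"

text \<open>For distinct centres with integral squared distance, distance 1 is the only one with a
  positive product; squared distances 2, 3 and at least 4 give 0, -1 and at most -2.\<close>

lemma mform_sroot: "mform (sroot \<alpha>) (sroot \<beta>) = 2 - (\<alpha> - \<beta>) \<bullet> (\<alpha> - \<beta>)"
  by (simp add: sroot_def mform_eq inner_diff_left inner_diff_right inner_commute)

lemma mform_sroot_self [simp]: "mform (sroot \<alpha>) (sroot \<alpha>) = 2"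
  by (simp add: mform_sroot)

lemma mform_proot: "mform (proot u k) (proot u' k') = 2 * (u \<bullet> u')"
  by (simp add: proot_def mform_eq)

lemma mform_proot_sroot: "mform (proot u k) (sroot \<alpha>) = - val u k \<alpha>"
  by (simp add: proot_def sroot_def mform_eq val_def inner_commute)

lemma mform_einf: "mform (sroot \<alpha>) einf = 1" "mform (proot u k) einf = 0"
  by (simp_all add: proot_def sroot_def einf_def mform_eq)

lemma mform_hyp_einf: "mform (hyp p) einf = - 1 / snd p"
  by (simp add: hyp_def einf_def mform_eq)

lemma side_sroot:
  assumes "p \<in> uhs"
  shows "side (sroot \<alpha>) p = ((dist p (\<alpha>, 0))\<^sup>2 - 1) / snd p"
proof -
  have "(dist p (\<alpha>, 0))\<^sup>2 = p \<bullet> p - 2 * (fst p \<bullet> \<alpha>) + \<alpha> \<bullet> \<alpha>"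
    by (simp add: dist_norm power2_norm_eq_inner inner_diff_left inner_diff_right inner_prod_def
        inner_commute)
  then show ?thesis
    using assms by (simp only:) (simp add: side_def sroot_def hyp_def mform_eq uhs_def field_simps)
qed

lemma side_proot: "side (proot u k) p = val u k (fst p) / snd p"
  by (simp add: side_def proot_def hyp_def mform_eq val_def add_divide_distrib)

lemma inv_map_uhs:
  assumes "p \<in> uhs"
  shows "inv_map \<alpha> p \<in> uhs" "snd (inv_map \<alpha> p) = snd p / (dist p (\<alpha>, 0))\<^sup>2"
proof -
  have "dist p (\<alpha>, 0) > 0" using assms by (auto simp: uhs_def)
  moreover show "snd (inv_map \<alpha> p) = snd p / (dist p (\<alpha>, 0))\<^sup>2"
    by (simp add: inv_map_def dist_norm power2_norm_eq_inner)
  ultimately show "inv_map \<alpha> p \<in> uhs" using assms by (simp add: uhs_def)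
qed

lemma hyp_inv_map:
  assumes "p \<in> uhs"
  shows "hyp (inv_map \<alpha> p) = reflection mform (sroot \<alpha>) (hyp p)"
proof -
  obtain d t where p: "p = (\<alpha> + d, t)" by (cases p) (metis add_diff_cancel_left' add.commute diff_add_cancel)
  have t: "t > 0" using assms by (simp add: p uhs_iff)
  \<comment> \<open>The squared distance from the centre of inversion. The inversion divides both
    the horizontal offset \<open>d\<close> and the height \<open>t\<close> by it.\<close>
  define N where "N = d \<bullet> d + t * t"
  have N: "N > 0" using t by (simp add: N_def add_nonneg_pos)
  have inv: "inv_map \<alpha> p = (\<alpha> + (1 / N) *\<^sub>R d, t / N)"
    by (simp add: inv_map_def p N_def inner_prod_def)
  have pp: "p \<bullet> p = N + 2 * (\<alpha> \<bullet> d) + \<alpha> \<bullet> \<alpha>"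
    by (simp add: p N_def inner_prod_def inner_add_left inner_add_right inner_commute)
  have "(dist p (\<alpha>, 0))\<^sup>2 = N"
    by (simp add: p dist_norm power2_norm_eq_inner N_def inner_prod_def)
  then have B: "mform (hyp p) (sroot \<alpha>) = (N - 1) / t"
    using side_sroot[OF assms, of \<alpha>] by (simp add: side_def p)
  have "inv_map \<alpha> p \<bullet> inv_map \<alpha> p = \<alpha> \<bullet> \<alpha> + 2 * (\<alpha> \<bullet> d) / N + (d \<bullet> d + t * t) / (N * N)"
    by (simp add: inv inner_prod_def inner_add_left inner_add_right inner_commute add_divide_distrib)
  also have "\<dots> = \<alpha> \<bullet> \<alpha> + (2 * (\<alpha> \<bullet> d) + 1) / N"
    using N by (simp add: N_def[symmetric] add_divide_distrib)
  finally have ii: "inv_map \<alpha> p \<bullet> inv_map \<alpha> p = \<alpha> \<bullet> \<alpha> + (2 * (\<alpha> \<bullet> d) + 1) / N" .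
  have fs: "fst (inv_map \<alpha> p) = \<alpha> + (1 / N) *\<^sub>R d" "1 / snd (inv_map \<alpha> p) = N / t"
      "snd (inv_map \<alpha> p) = t / N" "fst p = \<alpha> + d" "snd p = t"
    using N t by (simp_all only: inv) (simp_all add: p)
  have 1: "(\<alpha> \<bullet> \<alpha> + (2 * (\<alpha> \<bullet> d) + 1) / N) / (t / N)
      = (N + 2 * (\<alpha> \<bullet> d) + \<alpha> \<bullet> \<alpha>) / t - (N - 1) / t * (1 - \<alpha> \<bullet> \<alpha>)"
    using t N by (simp add: field_simps)
  have 2: "(N / t) *\<^sub>R (\<alpha> + (1 / N) *\<^sub>R d) = (1 / t) *\<^sub>R (\<alpha> + d) - ((N - 1) / t) *\<^sub>R (- \<alpha>)"
    using t N by (simp add: algebra_simps diff_divide_distrib)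
  have 3: "N / t = 1 / t + (N - 1) / t" by (simp add: diff_divide_distrib)
  show ?thesis
    unfolding reflection_def B unfolding hyp_def ii pp sroot_def fs(2)
    unfolding fs 1 2 by (simp add: 3)
qed

lemma vmap_uhs: "vmap a p \<in> uhs \<longleftrightarrow> p \<in> uhs"
  by (simp add: vmap_def uhs_def)

lemma vmap_simps [simp]: "fst (vmap a p) = a (fst p)" "snd (vmap a p) = snd p"
  by (simp_all add: vmap_def)

lemma vmap_comp: "vmap a (vmap b p) = vmap (a \<circ> b) p"
  by (simp add: vmap_def)

lemma vmap_id [simp]: "vmap id p = p" "vmap (\<lambda>z. z) p = p"
  by (simp_all add: vmap_def)

lemma hyp_vmap_translation:
  assumes "p \<in> uhs"
  shows "hyp (vmap (\<lambda>z. z + l) p) = tlin l (hyp p)"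
  using assms
  by (simp add: hyp_def tlin_def vmap_def uhs_def inner_prod_def inner_add_left inner_add_right
      inner_commute scaleR_add_right add_divide_distrib)

lemma hyp_vmap_prefl:
  assumes "u \<bullet> u = 1"
  shows "hyp (vmap (prefl u k) p) = reflection mform (proot u k) (hyp p)"
proof -
  have B: "mform (hyp p) (proot u k) = val u k (fst p) / snd p"
    using side_proot[of u k p] by (simp add: side_def)
  have "prefl u k z \<bullet> prefl u k z = z \<bullet> z + val u k z * k" for z
    using assms
    by (simp add: prefl_def val_def inner_diff_left inner_diff_right inner_commute algebra_simps)
  then show ?thesis
    unfolding reflection_def B
    by (simp add: hyp_def proot_def inner_prod_def prefl_def scaleR_diff_right add_divide_distrib)
qed

lemma reflection_proot_sroot:
  assumes "u \<bullet> u = 1"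
  shows "reflection mform (proot u k) (sroot \<alpha>) = sroot (prefl u k \<alpha>)"
proof -
  have "prefl u k z \<bullet> prefl u k z = z \<bullet> z + val u k z * k" for z
    using assms
    by (simp add: prefl_def val_def inner_diff_left inner_diff_right inner_commute algebra_simps)
  then show ?thesis
    unfolding reflection_def mf.sym[of "sroot \<alpha>"] mform_proot_sroot
    by (simp add: sroot_def proot_def prefl_def)
qed

lemma dist_prefl:
  assumes "u \<bullet> u = 1"
  shows "dist (prefl u k x) (prefl u k y) = dist x y"
proof -
  have "prefl u k x - prefl u k y = (x - y) - (2 * ((x - y) \<bullet> u)) *\<^sub>R u"
    by (simp add: prefl_def val_def inner_diff_left algebra_simps)
  moreover have "(w - (2 * (w \<bullet> u)) *\<^sub>R u) \<bullet> (w - (2 * (w \<bullet> u)) *\<^sub>R u) = w \<bullet> w" for w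
    using assms by (simp add: inner_diff_left inner_diff_right inner_commute algebra_simps)
  ultimately show ?thesis by (simp only: dist_norm norm_eq_sqrt_inner)
qed

lemma prefl_prefl: "u \<bullet> u = 1 \<Longrightarrow> prefl u k (prefl u k z) = z"
  by (simp add: prefl_def val_def inner_diff_left algebra_simps)

text \<open>Reflecting \<open>z\<close> brings it closer to \<open>c\<close> exactly when the mirror
  separates them. This drives the descent in \<open>to_alcove\<close>.\<close>

lemma dist_prefl_c:
  assumes "u \<bullet> u = 1"
  shows "(dist (prefl u k z) c)\<^sup>2 = (dist z c)\<^sup>2 + val u k z * val u k c"
proof -
  have "(prefl u k z - c) \<bullet> (prefl u k z - c) = (z - c) \<bullet> (z - c) + val u k z * val u k c"
    using assms
    by (simp add: prefl_def val_def inner_diff_left inner_diff_right inner_commute algebra_simps)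
  then show ?thesis by (simp add: dist_norm power2_norm_eq_inner)
qed

lemma mform_tlin: "mform (tlin l x) (tlin l y) = mform x y"
  by (simp add: mform_def tlin_def inner_add_left inner_add_right inner_commute algebra_simps)

lemma linear_tlin: "linear (tlin l)"
  by (rule linearI) (auto simp: tlin_def inner_add_left algebra_simps)

lemma tlin_tlin: "tlin l (tlin m x) = tlin (l + m) x"
  by (simp add: tlin_def inner_add_left inner_add_right inner_commute algebra_simps)

lemma tlin_0 [simp]: "tlin 0 x = x"
  by (simp add: tlin_def)

lemma tlin_sroot: "tlin l (sroot \<alpha>) = sroot (\<alpha> + l)"
  by (simp add: tlin_def sroot_def inner_add_left inner_add_right inner_commute)

lemma tlin_reflection: "tlin l (reflection mform n y) = reflection mform (tlin l n) (tlin l y)"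
  by (rule mf.reflection_conj) (simp_all add: linear_tlin mform_tlin)

lemma tlin_word: "tlin l (word_map mform ns y) = word_map mform (map (tlin l) ns) (tlin l y)"
  by (induction ns) (simp_all add: tlin_reflection)

text \<open>Reflections are self-adjoint, so the transpose of a word is the reversed word. For roots
  of norm 2 the reversed word is also the inverse, which makes words isometries.\<close>

lemma word_adjoint:
  "mform (word_map mform ns x) y = mform x (word_map mform (rev ns) y)"
proof (induction ns arbitrary: y)
  case (Cons n ns)
  have "mform (reflection mform n a) b = mform a (reflection mform n b)" for a b
    by (simp add: reflection_def mf.form_simps mf.sym[of n b])
  then show ?case using Cons by (simp add: word_map_append)
qed simp

lemma word_rev:
  assumes "\<And>n. n \<in> set ns \<Longrightarrow> mform n n = 2"
  shows "word_map mform (rev ns) (word_map mform ns x) = x"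
    "word_map mform ns (word_map mform (rev ns) x) = x"
  using assms by (induction ns arbitrary: x) (simp_all add: word_map_append mf.reflection_involutive)

lemma word_form:
  assumes "\<And>n. n \<in> set ns \<Longrightarrow> mform n n = 2"
  shows "mform (word_map mform ns x) (word_map mform ns y) = mform x y"
  using word_adjoint word_rev[OF assms] by metis

lemma continuous_hyp: "continuous_on uhs hyp"
  unfolding hyp_def by (intro continuous_intros) (auto simp: uhs_def)

section \<open>Integral lattices and the stabiliser of infinity\<close>

text \<open>Integral squared norms do double duty: polarisation makes twice the inner products
  integral, and nonzero vectors have norm at least 1, which gives discreteness.\<close>

locale int_lattice =
  fixes L :: "'v::euclidean_space set"
  assumes zero: "0 \<in> L"
    and diff: "x \<in> L \<Longrightarrow> y \<in> L \<Longrightarrow> x - y \<in> L"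
    and integral: "x \<in> L \<Longrightarrow> x \<bullet> x \<in> \<int>"
    and span: "span L = UNIV"
begin

lemma uminus: "x \<in> L \<Longrightarrow> - x \<in> L"
  using diff[OF zero] by simp

lemma add: "x \<in> L \<Longrightarrow> y \<in> L \<Longrightarrow> x + y \<in> L"
  using diff[of x "- y"] uminus by simp

lemma of_int_mult: "x \<in> L \<Longrightarrow> of_int k *\<^sub>R x \<in> L"
proof (induction k rule: int_induct[where k = 0])
  case base
  then show ?case using zero by simp
next
  case (step1 i)
  then show ?case by (simp add: scaleR_left_distrib add)
next
  case (step2 i)
  then show ?case by (simp add: scaleR_left_diff_distrib diff)
qed

lemma scaleR_closed: "x \<in> L \<Longrightarrow> k \<in> \<int> \<Longrightarrow> k *\<^sub>R x \<in> L"
  using of_int_mult by (auto elim: Ints_cases)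

lemma twice_inner_Ints: "x \<in> L \<Longrightarrow> y \<in> L \<Longrightarrow> 2 * (x \<bullet> y) \<in> \<int>"
proof -
  assume a: "x \<in> L" "y \<in> L"
  have "2 * (x \<bullet> y) = (x + y) \<bullet> (x + y) - x \<bullet> x - y \<bullet> y"
    by (simp add: inner_add_left inner_add_right inner_commute)
  then show ?thesis using a integral add by (metis Ints_diff)
qed

lemma norm_ge_1:
  assumes "x \<in> L" "x \<noteq> 0"
  shows "norm x \<ge> 1"
proof -
  obtain k where k: "x \<bullet> x = of_int k" using integral[OF assms(1)] by (auto elim: Ints_cases)
  have "x \<bullet> x > 0" using assms by simp
  then have "x \<bullet> x \<ge> 1" unfolding k by simp
  then show ?thesis by (simp add: norm_eq_sqrt_inner)
qed

text \<open>An accumulation point would have two distinct lattice points within distance 1/2,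
  against \<open>norm_ge_1\<close>.\<close>

lemma finite_cball: "finite {x \<in> L. dist x z \<le> r}"
proof (rule ccontr)
  assume inf: "infinite {x \<in> L. dist x z \<le> r}"
  have "{x \<in> L. dist x z \<le> r} \<subseteq> cball z r" by (auto simp: dist_commute)
  then obtain l where "l islimpt {x \<in> L. dist x z \<le> r}"
    using Heine_Borel_imp_Bolzano_Weierstrass[OF compact_cball inf] by blast
  then have 1: "infinite ({x \<in> L. dist x z \<le> r} \<inter> ball l (1/2))"
    by (simp add: islimpt_eq_infinite_ball)
  then have "{x \<in> L. dist x z \<le> r} \<inter> ball l (1/2) \<noteq> {}" by fastforce
  then obtain x where x: "x \<in> L" "dist x l < 1/2" by (auto simp: dist_commute)
  have "infinite ({x \<in> L. dist x z \<le> r} \<inter> ball l (1/2) - {x})" using 1 by simp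
  then have "\<exists>y. y \<in> {x \<in> L. dist x z \<le> r} \<inter> ball l (1/2) - {x}"
    using infinite_imp_nonempty by blast
  then obtain y where y: "y \<in> L" "dist y l < 1/2" "y \<noteq> x"
    by (auto simp: dist_commute)
  have "norm (y - x) \<ge> 1" using norm_ge_1[OF diff[OF y(1) x(1)]] y(3) by simp
  moreover have "dist y x < 1" using x y dist_triangle_half_l[of y l 1 x] by simp
  ultimately show False by (simp add: dist_norm)
qed

lemma finite_basis:
  obtains B where "finite B" "B \<subseteq> L" "span B = UNIV"
proof -
  obtain B where "B \<subseteq> L" "independent B" "L \<subseteq> span B"
    using maximal_independent_subset by blast
  then show ?thesis
    using that independent_imp_finite span span_mono[of L "span B"] by (metis span_span top.extremum_uniqueI)
qed

text \<open>Round down the coefficients with respect to a basis contained in \<open>L\<close>; the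
  fractional parts contribute at most the sum of the norms.\<close>

lemma covering: obtains R where "R \<ge> 0" "\<And>z. \<exists>x\<in>L. dist z x \<le> R"
proof -
  obtain B where B: "finite B" "B \<subseteq> L" "span B = UNIV" by (rule finite_basis)
  have "\<exists>x\<in>L. dist z x \<le> (\<Sum>b\<in>B. norm b)" for z
  proof -
    obtain c where z: "z = (\<Sum>b\<in>B. c b *\<^sub>R b)"
      using B(3) span_finite[OF B(1)] by (metis (no_types, lifting) UNIV_I imageE)
    define x where "x = (\<Sum>b\<in>B. of_int \<lfloor>c b\<rfloor> *\<^sub>R b)"
    have "(\<Sum>b\<in>C. of_int \<lfloor>c b\<rfloor> *\<^sub>R b) \<in> L" if "finite C" "C \<subseteq> B" for C
      using that by (induction C) (use zero add of_int_mult B(2) in \<open>auto simp: subset_iff\<close>)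
    then have "x \<in> L" using B x_def by auto
    have "z - x = (\<Sum>b\<in>B. frac (c b) *\<^sub>R b)"
      by (simp add: z x_def sum_subtractf[symmetric] frac_def scaleR_left_diff_distrib)
    also have "norm \<dots> \<le> (\<Sum>b\<in>B. norm b)"
      by (rule order_trans[OF norm_sum sum_mono])
        (auto intro!: mult_left_le_one_le simp: less_imp_le[OF frac_lt_1])
    finally show ?thesis using \<open>x \<in> L\<close> by (auto simp: dist_norm)
  qed
  then show ?thesis using that[of "\<Sum>b\<in>B. norm b"] by (simp add: sum_nonneg)
qed

text \<open>These are the differences of lattice points whose unit hemispheres have product +1.
  Their bisectors supply the vertical mirrors.\<close>

definition U :: "'v set" where
  "U = {u \<in> L. u \<bullet> u = 1}"

lemma finite_U: "finite U"
proof -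
  have "U \<subseteq> {x \<in> L. dist x 0 \<le> 1}" by (auto simp: U_def norm_eq_sqrt_inner)
  then show ?thesis using finite_cball finite_subset by blast
qed

lemma UD: "u \<in> U \<Longrightarrow> u \<in> L" "u \<in> U \<Longrightarrow> u \<bullet> u = 1"
  by (auto simp: U_def)

lemma val_Ints: "u \<in> U \<Longrightarrow> k \<in> \<int> \<Longrightarrow> x \<in> L \<Longrightarrow> val u k x \<in> \<int>"
  unfolding val_def using twice_inner_Ints[of x u] UD(1)[of u] by simp

text \<open>The affine group induced on \<open>V\<close> by the height-preserving elements of
  \<open>K\<close>: \<open>Vert_K\<close> lifts it into \<open>K\<close> and
  \<open>stabiliser\<close> is the converse. With left multiplication by generators as the only
  rule, every invariant is a plain induction.\<close>

inductive_set A :: "('v \<Rightarrow> 'v) set" where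
  id: "id \<in> A"
| trans: "a \<in> A \<Longrightarrow> l \<in> L \<Longrightarrow> (\<lambda>z. z + l) \<circ> a \<in> A"
| refl: "a \<in> A \<Longrightarrow> u \<in> U \<Longrightarrow> k \<in> \<int> \<Longrightarrow> prefl u k \<circ> a \<in> A"

lemma A_trans: "l \<in> L \<Longrightarrow> (\<lambda>z. z + l) \<in> A"
  using A.trans[OF A.id] by simp

lemma A_refl: "u \<in> U \<Longrightarrow> k \<in> \<int> \<Longrightarrow> prefl u k \<in> A"
  using A.refl[OF A.id] by simp

lemma A_comp: "a \<in> A \<Longrightarrow> b \<in> A \<Longrightarrow> a \<circ> b \<in> A"
  by (induction rule: A.induct) (auto simp: comp_assoc intro: A.trans A.refl)

lemma A_inverse: "a \<in> A \<Longrightarrow> \<exists>b\<in>A. a \<circ> b = id \<and> b \<circ> a = id"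
proof (induction rule: A.induct)
  case id
  then show ?case by (intro bexI[of _ id] A.id) simp
next
  case (trans a l)
  then obtain b where b: "b \<in> A" "a \<circ> b = id" "b \<circ> a = id" by blast
  have "(\<lambda>z. z + - l) \<in> A" using trans uminus by (intro A_trans)
  then have "b \<circ> (\<lambda>z. z + - l) \<in> A" using b A_comp by blast
  then show ?case
    using b by (intro bexI[of _ "b \<circ> (\<lambda>z. z + - l)"]) (auto simp: fun_eq_iff)
next
  case (refl a u k)
  then obtain b where b: "b \<in> A" "a \<circ> b = id" "b \<circ> a = id" by blast
  have "b \<circ> prefl u k \<in> A" using b A_comp A_refl refl by blast
  then show ?case
    using b UD(2)[OF \<open>u \<in> U\<close>]
    by (intro bexI[of _ "b \<circ> prefl u k"]) (auto simp: fun_eq_iff prefl_prefl)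
qed

lemma A_dist: "a \<in> A \<Longrightarrow> dist (a x) (a y) = dist x y"
  by (induction rule: A.induct) (auto simp: dist_prefl UD)

lemma A_L: "a \<in> A \<Longrightarrow> x \<in> L \<Longrightarrow> a x \<in> L"
proof (induction rule: A.induct)
  case (refl a u k)
  then have "val u k (a x) *\<^sub>R u \<in> L" using scaleR_closed val_Ints UD by blast
  then show ?case using refl by (simp add: prefl_def diff)
qed (auto intro: add)

lemma A_linear: "a \<in> A \<Longrightarrow> linear (\<lambda>x. a x - a 0)"
proof (induction rule: A.induct)
  case id
  then show ?case by (simp add: linear_id[unfolded id_def] id_def)
next
  case (trans a l)
  then show ?case by simp
next
  case (refl a u k)
  have "(\<lambda>x. (prefl u k \<circ> a) x - (prefl u k \<circ> a) 0)
      = (\<lambda>w. w - (2 * (w \<bullet> u)) *\<^sub>R u) \<circ> (\<lambda>x. a x - a 0)"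
    by (auto simp: fun_eq_iff prefl_def val_def inner_diff_left algebra_simps)
  moreover have "linear (\<lambda>w. w - (2 * (w \<bullet> u)) *\<^sub>R u)"
    by (rule linearI) (auto simp: inner_add_left algebra_simps)
  ultimately show ?case using linear_compose[OF refl.IH] by simp
qed

text \<open>An affine map is determined by its values at 0 and at a basis taken from
  \<open>L\<close>. These values lie in \<open>L\<close>, and being an isometry confines them to
  balls, which contain finitely many lattice points.\<close>

lemma A_finite: "finite {a \<in> A. dist (a x) y \<le> r}"
proof -
  obtain B where B: "finite B" "B \<subseteq> L" "span B = UNIV" by (rule finite_basis)
  let ?I = "insert 0 B" and ?T = "{a \<in> A. dist (a x) y \<le> r}"
  have IL: "?I \<subseteq> L" using B zero by auto
  have "inj_on (\<lambda>a. restrict a ?I) ?T"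
  proof (rule inj_onI)
    fix a b assume ab: "a \<in> ?T" "b \<in> ?T" "restrict a ?I = restrict b ?I"
    then have eq: "a z = b z" if "z \<in> ?I" for z using that by (metis restrict_apply')
    have "a \<in> A" "b \<in> A" using ab by auto
    then have "(\<lambda>x. a x - a 0) z = (\<lambda>x. b x - b 0) z" for z
      by (rule linear_eq_on_span[OF A_linear A_linear, where B = B]) (simp_all add: eq B(3))
    then show "a = b" using eq[of 0] by (auto simp: fun_eq_iff)
  qed
  moreover have "(\<lambda>a. restrict a ?I) ` ?T \<subseteq> (\<Pi>\<^sub>E b\<in>?I. {l \<in> L. dist l y \<le> dist b x + r})"
  proof clarify
    fix a assume a: "a \<in> A" "dist (a x) y \<le> r"
    have "a b \<in> L \<and> dist (a b) y \<le> dist b x + r" if "b \<in> ?I" for b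
      using a that IL A_L A_dist[of a b x] dist_triangle[of "a b" y "a x"] by force
    then show "restrict a ?I \<in> (\<Pi>\<^sub>E b\<in>?I. {l \<in> L. dist l y \<le> dist b x + r})"
      by (intro PiE_I) (simp_all del: dist_0_norm)
  qed
  moreover have "finite (\<Pi>\<^sub>E b\<in>?I. {l \<in> L. dist l y \<le> dist b x + r})"
    using B(1) finite_cball by (intro finite_PiE) auto
  ultimately show ?thesis using finite_imageD finite_subset by blast
qed

lemma countable_A: "countable A"
proof -
  have "A = (\<Union>n. {a \<in> A. dist (a 0) 0 \<le> real n})"
    using real_arch_simple by blast
  moreover have "countable (\<Union>n. {a \<in> A. dist (a 0) 0 \<le> real n})"
    by (intro countable_UN[OF countableI_type] countable_finite A_finite)
  ultimately show ?thesis by simp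
qed

lemma A_fix_negligible:
  assumes "a \<in> A" "a \<noteq> id"
  shows "negligible {x. a x = x}"
proof -
  obtain y where "a y \<noteq> y" using assms by (auto simp: fun_eq_iff)
  then obtain b where b: "b \<in> Basis" "(a y - y) \<bullet> b \<noteq> 0"
    by (metis euclidean_eqI inner_diff_left right_minus_eq)
  define g where "g = (\<lambda>x. a x - a 0 - x)"
  have lin: "linear g" unfolding g_def
    using linear_compose_sub[OF A_linear[OF assms(1)] linear_id] by (simp add: id_def)
  have gx: "g x \<bullet> b = x \<bullet> adjoint g b" for x
    using adjoint_works[OF lin] by (simp add: inner_commute)
  \<comment> \<open>A fixed point satisfies \<open>g x = - a 0\<close>, and the
    \<open>b\<close>-component of this is one linear equation. If its normal vector vanishes, the
    choice of \<open>b\<close> makes the right-hand side nonzero and the equation has no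
    solution.\<close>
  have "negligible {x. adjoint g b \<bullet> x = - (a 0 \<bullet> b)}"
  proof (cases "adjoint g b = 0")
    case True
    then have "(a y - a 0 - y) \<bullet> b = 0" using gx[of y] by (simp add: g_def)
    then have "a 0 \<bullet> b \<noteq> 0" using b(2) by (auto simp: inner_diff_left)
    then show ?thesis using True by simp
  qed (intro negligible_hyperplane, simp)
  moreover have "{x. a x = x} \<subseteq> {x. adjoint g b \<bullet> x = - (a 0 \<bullet> b)}"
  proof clarify
    fix x assume "a x = x"
    then have "g x \<bullet> b = - (a 0 \<bullet> b)" by (simp add: g_def)
    then show "adjoint g b \<bullet> x = - (a 0 \<bullet> b)" using gx[of x] by (simp add: inner_commute)
  qed
  ultimately show ?thesis using negligible_subset by blast
qed

section \<open>Points with trivial stabiliser\<close>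

definition free :: "'v \<Rightarrow> bool" where
  "free z \<longleftrightarrow> (\<forall>a\<in>A. a z = z \<longrightarrow> a = id)"

text \<open>The group is countable and each nontrivial element fixes only a null set.\<close>

lemma ex_free: "\<exists>c. free c"
proof -
  have "negligible (\<Union>((\<lambda>a. {x. a x = x}) ` (A - {id})))"
    using countable_A A_fix_negligible
    by (intro negligible_countable_Union) (auto intro: countable_image countable_Diff)
  moreover have "\<not> negligible (UNIV :: 'v set)" using non_negligible_UNIV by blast
  ultimately have "(\<Union>((\<lambda>a. {x. a x = x}) ` (A - {id}))) \<noteq> UNIV" by metis
  then show ?thesis unfolding free_def by blast
qed

lemma prefl_neq_id: "u \<in> U \<Longrightarrow> prefl u k \<noteq> id"
proof
  assume u: "u \<in> U" and "prefl u k = id"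
  \<comment> \<open>At this point \<open>val u k\<close> equals 2, so the reflection moves it by
    \<open>2 u\<close>.\<close>
  then have "prefl u k ((1 - k / 2) *\<^sub>R u) = (1 - k / 2) *\<^sub>R u" by simp
  then show False using u UD(2)[OF u] by (auto simp: prefl_def val_def)
qed

lemma free_val:
  assumes "free z" "u \<in> U" "k \<in> \<int>"
  shows "val u k z \<noteq> 0"
proof
  assume "val u k z = 0"
  then have "prefl u k z = z" by (simp add: prefl_def)
  then show False using assms A_refl prefl_neq_id by (auto simp: free_def)
qed

lemma free_A: "free z \<Longrightarrow> a \<in> A \<Longrightarrow> free (a z)"
  unfolding free_def
proof (intro ballI impI)
  fix b assume z: "\<forall>a\<in>A. a z = z \<longrightarrow> a = id" and a: "a \<in> A" and b: "b \<in> A" "b (a z) = a z"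
  obtain a' where a': "a' \<in> A" "a \<circ> a' = id" "a' \<circ> a = id" using A_inverse a by blast
  have "(a' \<circ> b \<circ> a) z = z" using b a' by (auto simp: fun_eq_iff)
  moreover have "a' \<circ> b \<circ> a \<in> A" using a' a b A_comp by blast
  ultimately have "a' \<circ> b \<circ> a = id" using z by blast
  then have "a \<circ> (a' \<circ> b \<circ> a) \<circ> a' = id" using a' by simp
  then show "b = id" using a' by (simp add: fun_eq_iff)
qed

end

section \<open>Simple roots\<close>

locale based_lattice = int_lattice L for L :: "'v::euclidean_space set" +
  fixes c :: 'v
  assumes free_c: "free c"
begin

text \<open>A pair \<open>(u, k)\<close> encodes the affine root
  \<open>2 \<langle>z, u\<rangle> + k\<close>. Because \<open>c\<close> is free no root vanishes
  there, so evaluation at \<open>c\<close> splits the roots into positive and negative ones.\<close>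

definition Pos :: "('v \<times> real) set" where
  "Pos = {x. fst x \<in> U \<and> snd x \<in> \<int> \<and> val (fst x) (snd x) c > 0}"

abbreviation pval :: "'v \<times> real \<Rightarrow> 'v \<Rightarrow> real" where
  "pval x \<equiv> val (fst x) (snd x)"

abbreviation pr :: "'v \<times> real \<Rightarrow> real \<times> 'v \<times> real" where
  "pr x \<equiv> proot (fst x) (snd x)"

text \<open>Indecomposable affine roots: \<open>x\<close> is neither a sum of two positive roots nor
  a positive root plus a positive constant. The constants, with zero linear part, play the part of
  the imaginary roots of an affine root system; excluding them removes all but the nearest of a
  family of parallel mirrors.\<close>

definition Simple :: "('v \<times> real) set" where
  "Simple = {x \<in> Pos. \<forall>y\<in>Pos. x - y \<notin> Pos \<and> \<not> (fst (x - y) = 0 \<and> snd (x - y) > 0)}"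

definition Alc :: "'v set" where
  "Alc = {z. \<forall>x\<in>Pos. pval x z \<ge> 0}"

definition S :: "(real \<times> 'v \<times> real) set" where
  "S = pr ` Simple \<union> sroot ` (L \<inter> Alc)"

lemma PosD: "x \<in> Pos \<Longrightarrow> fst x \<in> U" "x \<in> Pos \<Longrightarrow> snd x \<in> \<int>" "x \<in> Pos \<Longrightarrow> pval x c > 0"
  by (auto simp: Pos_def)

lemma Simple_Pos: "x \<in> Simple \<Longrightarrow> x \<in> Pos"
  by (auto simp: Simple_def)

lemma pval_diff: "pval (x - y) z = pval x z - pval y z"
  by (simp add: val_def inner_diff_right)

lemma pval_uminus: "pval (- x) z = - pval x z"
  by (simp add: val_def)

lemma root_Pos: "fst x \<in> U \<Longrightarrow> snd x \<in> \<int> \<Longrightarrow> x \<in> Pos \<or> - x \<in> Pos"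
  using free_val[OF free_c, of "fst x" "snd x"] pval_uminus[of x c]
  by (auto simp: Pos_def U_def uminus)

lemma finite_Pos_below: "finite {x \<in> Pos. pval x c < r}"
proof -
  have "{x \<in> Pos. pval x c < r} \<subseteq> (\<Union>u\<in>U. Pair u ` {k \<in> \<int>. \<bar>k\<bar> \<le> r + 2 * \<bar>c \<bullet> u\<bar>})"
  proof
    fix x assume x: "x \<in> {x \<in> Pos. pval x c < r}"
    obtain u k where uk: "x = (u, k)" by (cases x)
    show "x \<in> (\<Union>u\<in>U. Pair u ` {k \<in> \<int>. \<bar>k\<bar> \<le> r + 2 * \<bar>c \<bullet> u\<bar>})"
      using x by (intro UN_I[of u]) (auto simp: uk Pos_def val_def)
  qed
  moreover have "finite {k \<in> \<int>. \<bar>k\<bar> \<le> b}" for b :: real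
    using finite_abs_int_segment[of b] by simp
  then have "finite (\<Union>u\<in>U. Pair u ` {k \<in> \<int>. \<bar>k\<bar> \<le> r + 2 * \<bar>c \<bullet> u\<bar>})"
    using finite_U by auto
  ultimately show ?thesis by (rule finite_subset)
qed

text \<open>A decomposable root is a positive root plus another positive root or a positive
  constant, and its root summands are smaller at \<open>c\<close>. The induction counts the positive
  roots with smaller value at \<open>c\<close>, which are finitely many by
  \<open>finite_Pos_below\<close>.\<close>

lemma Simple_suffices:
  assumes "\<And>x. x \<in> Simple \<Longrightarrow> pval x z \<ge> 0"
  shows "z \<in> Alc"
proof -
  have "pval x z \<ge> 0" if "x \<in> Pos" for x
    using that
  proof (induction "card {y \<in> Pos. pval y c < pval x c}" arbitrary: x rule: less_induct)
    case less
    have IH: "pval y z \<ge> 0" if y: "y \<in> Pos" "pval y c < pval x c" for y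
    proof -
      have "{w \<in> Pos. pval w c < pval y c} \<subset> {w \<in> Pos. pval w c < pval x c}"
        using y by force
      from psubset_card_mono[OF finite_Pos_below this] show ?thesis using less.hyps y by blast
    qed
    show ?case
    proof (cases "x \<in> Simple")
      case False
      then obtain y where y: "y \<in> Pos" "x - y \<in> Pos \<or> fst (x - y) = 0 \<and> snd (x - y) > 0"
        using less.prems by (auto simp: Simple_def)
      from y(2) show ?thesis
      proof
        assume xy: "x - y \<in> Pos"
        have "pval y c < pval x c" "pval (x - y) c < pval x c"
          using PosD(3)[OF xy] PosD(3)[OF y(1)] unfolding pval_diff by linarith+
        then have "pval y z \<ge> 0" "pval (x - y) z \<ge> 0" using IH y(1) xy by blast+
        then show ?thesis unfolding pval_diff by linarith
      next
        assume xy: "fst (x - y) = 0 \<and> snd (x - y) > 0"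
        then have gt: "pval x w > pval y w" for w by (simp add: val_def)
        then have "pval y z \<ge> 0" using y(1) by (intro IH)
        then show ?thesis using gt[of z] by simp
      qed
    qed (use assms in auto)
  qed
  then show ?thesis by (simp add: Alc_def)
qed

lemma mform_S_Ints: "s \<in> S \<Longrightarrow> t \<in> S \<Longrightarrow> mform s t \<in> \<int>"
proof -
  have 1: "mform (pr x) (pr y) \<in> \<int>" if "x \<in> Simple" "y \<in> Simple" for x y
    unfolding mform_proot by (intro twice_inner_Ints UD(1) PosD(1) Simple_Pos that)
  have 2: "mform (sroot \<alpha>) (sroot \<beta>) \<in> \<int>" if "\<alpha> \<in> L" "\<beta> \<in> L" for \<alpha> \<beta>
    unfolding mform_sroot using that diff integral by (intro Ints_diff) auto
  have 3: "mform (pr x) (sroot \<alpha>) \<in> \<int>" if "x \<in> Simple" "\<alpha> \<in> L" for x \<alpha>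
    unfolding mform_proot_sroot using that Simple_Pos PosD val_Ints by auto
  show "mform s t \<in> \<int>" if "s \<in> S" "t \<in> S"
    using that unfolding S_def
    by (elim UnE imageE IntE) (simp_all add: 1 2 3 mf.sym[of "sroot _" "pr _"])
qed

lemma unit_eq: "u \<bullet> u = 1 \<Longrightarrow> v \<bullet> v = 1 \<Longrightarrow> u \<bullet> v = 1 \<Longrightarrow> u = v" for u v :: 'v
proof -
  assume "u \<bullet> u = 1" "v \<bullet> v = 1" "u \<bullet> v = 1"
  then have "(u - v) \<bullet> (u - v) = 0" by (simp add: inner_diff_left inner_diff_right inner_commute)
  then show "u = v" by simp
qed

text \<open>By Cauchy-Schwarz a positive integral product of two unit directions is 1 or 2. Product
  2 means parallel roots, which differ by a nonzero constant; product 1 makes the difference again a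
  root. Either way one of the two roots decomposes.\<close>

lemma Simple_obtuse:
  assumes x: "x \<in> Simple" and y: "y \<in> Simple" and ne: "x \<noteq> y"
  shows "mform (pr x) (pr y) \<le> 0"
proof (rule ccontr)
  assume n: "\<not> ?thesis"
  have P: "x \<in> Pos" "y \<in> Pos" using x y Simple_Pos by auto
  have u: "fst x \<in> L" "fst y \<in> L" "fst x \<bullet> fst x = 1" "fst y \<bullet> fst y = 1"
    using P PosD(1) UD by auto
  obtain j where j: "2 * (fst x \<bullet> fst y) = of_int j"
    using Ints_cases[OF twice_inner_Ints[OF u(1,2)]] by blast
  have "fst x \<bullet> fst y \<le> norm (fst x) * norm (fst y)" by (rule norm_cauchy_schwarz)
  then have "fst x \<bullet> fst y \<le> 1" using u by (simp add: norm_eq_sqrt_inner)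
  then have "j = 1 \<or> j = 2" using n j by (auto simp: mform_proot)
  then show False
  proof
    assume "j = 2"
    then have "fst x = fst y" using unit_eq u j by simp
    moreover from this have "snd x \<noteq> snd y" using ne by (auto simp: prod_eq_iff)
    ultimately show False
      using x y P unfolding Simple_def
      by (cases "snd x" "snd y" rule: linorder_cases) fastforce+
  next
    assume "j = 1"
    then have "(fst x - fst y) \<bullet> (fst x - fst y) = 1"
      using u j by (simp add: inner_diff_left inner_diff_right inner_commute)
    then have "fst (x - y) \<in> U" using u diff by (simp add: U_def)
    moreover have "snd (x - y) \<in> \<int>" using P PosD(2) by simp
    ultimately have "x - y \<in> Pos \<or> - (x - y) \<in> Pos" by (rule root_Pos)
    then have "x - y \<in> Pos \<or> y - x \<in> Pos" by simp
    then show False using x y P unfolding Simple_def by blast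
  qed
qed

text \<open>A positive product forces \<open>|\<alpha> - \<beta>| = 1\<close>. Then the bisector of
  the two centres is a mirror separating them, although both lie in one alcove.\<close>

lemma sroot_obtuse:
  assumes a: "\<alpha> \<in> L" "\<alpha> \<in> Alc" and b: "\<beta> \<in> L" "\<beta> \<in> Alc" and ne: "\<alpha> \<noteq> \<beta>"
  shows "mform (sroot \<alpha>) (sroot \<beta>) \<le> 0"
proof (rule ccontr)
  assume n: "\<not> ?thesis"
  let ?u = "\<beta> - \<alpha>"
  have uL: "?u \<in> L" using a b diff by blast
  obtain m where m: "?u \<bullet> ?u = of_int m" using integral[OF uL] by (auto elim: Ints_cases)
  have "?u \<bullet> ?u > 0" using ne by simp
  moreover have "(\<alpha> - \<beta>) \<bullet> (\<alpha> - \<beta>) = ?u \<bullet> ?u"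
    by (simp add: inner_diff_left inner_diff_right inner_commute)
  ultimately have "m = 1" using n m by (auto simp: mform_sroot)
  then have u: "?u \<in> U" using uL m by (simp add: U_def)
  \<comment> \<open>The affine root of the bisector, with value -1 at \<open>\<alpha>\<close> and 1
    at \<open>\<beta>\<close>.\<close>
  define x where "x = (?u, - (2 * (\<alpha> \<bullet> ?u) + 1))"
  have "snd x \<in> \<int>" using twice_inner_Ints[OF a(1) uL] by (simp add: x_def)
  then have "x \<in> Pos \<or> - x \<in> Pos" using u by (intro root_Pos) (simp_all add: x_def)
  moreover have "pval x \<alpha> = - 1" by (simp add: x_def val_def)
  moreover have "pval x \<beta> = 1"
  proof -
    have "pval x \<beta> = 2 * (?u \<bullet> ?u) - 1" by (simp add: x_def val_def inner_diff_left inner_diff_right)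
    then show ?thesis using u UD by simp
  qed
  moreover have "pval w \<alpha> \<ge> 0" "pval w \<beta> \<ge> 0" if "w \<in> Pos" for w
    using a b that by (auto simp: Alc_def)
  ultimately show False by (metis neg_0_le_iff_le not_one_le_zero pval_uminus)
qed

lemma S_norm2: "s \<in> S \<Longrightarrow> mform s s = 2"
  unfolding S_def by (elim UnE imageE) (simp_all add: mform_proot UD(2)[OF PosD(1)[OF Simple_Pos]])

lemma S_obtuse:
  assumes "s \<in> S" "t \<in> S" "s \<noteq> t"
  shows "mform s t \<le> 0"
proof -
  have 3: "mform (pr x) (sroot \<alpha>) \<le> 0" if "x \<in> Simple" "\<alpha> \<in> Alc" for x \<alpha>
    unfolding mform_proot_sroot using that Simple_Pos by (auto simp: Alc_def)
  consider x y where "x \<in> Simple" "y \<in> Simple" "s = pr x" "t = pr y"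
    | x \<alpha> where "x \<in> Simple" "\<alpha> \<in> L" "\<alpha> \<in> Alc" "s = pr x" "t = sroot \<alpha>"
    | x \<alpha> where "x \<in> Simple" "\<alpha> \<in> L" "\<alpha> \<in> Alc" "t = pr x" "s = sroot \<alpha>"
    | \<alpha> \<beta> where "\<alpha> \<in> L" "\<alpha> \<in> Alc" "\<beta> \<in> L" "\<beta> \<in> Alc" "s = sroot \<alpha>" "t = sroot \<beta>"
    using assms(1,2) unfolding S_def by blast
  then show ?thesis
  proof cases
    case 1
    then have "x \<noteq> y" using assms by blast
    then show ?thesis using 1 Simple_obtuse by simp
  next
    case 2
    then show ?thesis using 3 by simp
  next
    case 3
    then show ?thesis using 3 mf.sym[of s t] \<open>\<And>x \<alpha>. _ \<Longrightarrow> _ \<Longrightarrow> mform (pr x) (sroot \<alpha>) \<le> 0\<close> by simp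
  next
    case 4
    then have "\<alpha> \<noteq> \<beta>" using assms by blast
    then show ?thesis using 4 sroot_obtuse by simp
  qed
qed

sublocale T: simple_system mform S
proof
  fix s t assume st: "s \<in> S" "t \<in> S" "s \<noteq> t"
  obtain j where j: "mform s t = of_int j" using Ints_cases[OF mform_S_Ints[OF st(1,2)]] by blast
  then have "j \<le> 0" using S_obtuse[OF st] by simp
  then have "j = 0 \<or> j = -1 \<or> j \<le> -2" by linarith
  then show "mform s t = 0 \<or> mform s t = -1 \<or> mform s t \<le> -2" using j by auto
qed (rule S_norm2)

text \<open>\<open>wlift a ns\<close>: the word \<open>ns\<close> in the vertical simple roots induces \<open>a\<close> on \<open>V\<close>.\<close>

definition wlift :: "('v \<Rightarrow> 'v) \<Rightarrow> (real \<times> 'v \<times> real) list \<Rightarrow> bool" where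
  "wlift a ns \<longleftrightarrow> a \<in> A \<and> set ns \<subseteq> S \<and>
     (\<forall>p. hyp (vmap a p) = word_map mform ns (hyp p)) \<and>
     (\<forall>\<alpha>. word_map mform ns (sroot \<alpha>) = sroot (a \<alpha>))"

text \<open>Among the images of \<open>z\<close> under words of simple reflections that are no
  farther from \<open>c\<close> than \<open>z\<close>, of which there are finitely many, take the
  closest. A simple wall separating it from \<open>c\<close> would yield a closer one.\<close>

lemma to_alcove: obtains a ns where "wlift a ns" "a z \<in> Alc"
proof -
  let ?W = "{a. \<exists>ns. wlift a ns}"
  let ?T = "{a \<in> ?W. dist (a z) c \<le> dist z c}"
  have id: "wlift id []" by (auto simp: wlift_def A.id)
  have fin: "finite ?T"
    by (rule finite_subset[OF _ A_finite[of z c "dist z c"]]) (auto simp: wlift_def)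
  have "id \<in> ?T" using id by auto
  then obtain a where a: "a \<in> ?T" "\<And>b. b \<in> ?T \<Longrightarrow> dist (a z) c \<le> dist (b z) c"
    using ex_min_if_finite[of "(\<lambda>a. dist (a z) c) ` ?T"] fin
    by (metis (mono_tags, lifting) arg_min_least arg_min_if_finite(1) empty_iff)
  then obtain ns where ns: "wlift a ns" by auto
  have "pval x (a z) \<ge> 0" if x: "x \<in> Simple" for x
  proof (rule ccontr)
    assume n: "\<not> ?thesis"
    let ?b = "prefl (fst x) (snd x) \<circ> a"
    have P: "x \<in> Pos" using x Simple_Pos by auto
    have u: "fst x \<bullet> fst x = 1" using PosD(1)[OF P] UD by auto
    have "pr x \<in> S" using x by (auto simp: S_def)
    moreover have "?b \<in> A" using ns PosD[OF P] A.refl by (auto simp: wlift_def)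
    ultimately have "wlift ?b (pr x # ns)"
      using ns hyp_vmap_prefl[OF u] reflection_proot_sroot[OF u]
      by (simp add: wlift_def vmap_comp[symmetric])
    moreover have "(dist (?b z) c)\<^sup>2 < (dist (a z) c)\<^sup>2"
      using dist_prefl_c[OF u, of "snd x" "a z" c] n PosD(3)[OF P] by (simp add: mult_neg_pos)
    then have "dist (?b z) c < dist (a z) c" by (rule power_less_imp_less_base) simp
    ultimately show False using a by force
  qed
  then have "a z \<in> Alc" by (rule Simple_suffices)
  then show ?thesis using that ns by blast
qed

lemma wlift_rev:
  assumes "wlift a ns"
  shows "word_map mform (rev ns) (word_map mform ns x) = x"
    "word_map mform ns (word_map mform (rev ns) x) = x"
  using assms S_norm2 by (auto simp: wlift_def intro!: word_rev)

lemma wlift_maps: "wlift a ns \<Longrightarrow> word_map mform ns \<in> T.maps_of S \<and> word_map mform (rev ns) \<in> T.maps_of S"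
  unfolding wlift_def T.maps_of_def by (metis (mono_tags, lifting) mem_Collect_eq set_rev)

text \<open>\<open>S\<close> contains only the hemispheres over lattice points of the alcove. Any
  other hemisphere is carried to one of these by a vertical word, and its reflection is the
  corresponding conjugate.\<close>

lemma sphere_maps:
  assumes "\<alpha> \<in> L"
  shows "reflection mform (sroot \<alpha>) \<in> T.maps_of S"
proof -
  obtain a ns where a: "wlift a ns" "a \<alpha> \<in> Alc" by (rule to_alcove)
  have "sroot (a \<alpha>) \<in> S" using a assms A_L by (auto simp: S_def wlift_def)
  have "reflection mform (sroot \<alpha>) = word_map mform (rev ns) \<circ> (reflection mform (sroot (a \<alpha>)) \<circ> word_map mform ns)"
  proof
    fix y
    have lin: "linear (word_map mform ns)"
      by (induction ns) (simp_all only: word_map_Nil word_map_Cons linear_id linear_compose[OF _ mf.reflection_linear])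
    have "word_map mform ns (reflection mform (sroot \<alpha>) y)
        = reflection mform (word_map mform ns (sroot \<alpha>)) (word_map mform ns y)"
      using a S_norm2 by (intro mf.reflection_conj lin word_form) (auto simp: wlift_def)
    also have "word_map mform ns (sroot \<alpha>) = sroot (a \<alpha>)" using a by (simp add: wlift_def)
    finally show "reflection mform (sroot \<alpha>) y
      = (word_map mform (rev ns) \<circ> (reflection mform (sroot (a \<alpha>)) \<circ> word_map mform ns)) y"
      using wlift_rev(1)[OF a(1)] by (metis comp_apply)
  qed
  then show ?thesis
    using wlift_maps[OF a(1)] T.r_maps_of[OF \<open>sroot (a \<alpha>) \<in> S\<close>] by (simp add: T.maps_of_comp)
qed

lemma sphere_word_maps: "set ns \<subseteq> sroot ` L \<Longrightarrow> word_map mform ns \<in> T.maps_of S"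
  by (induction ns) (auto simp: T.id_maps_of intro!: T.maps_of_comp sphere_maps)

section \<open>The region outside the unit balls and the chamber\<close>

definition outside :: "('v \<times> real) set" where
  "outside = {p \<in> uhs. \<forall>\<alpha>\<in>L. dist p (\<alpha>, 0) \<ge> 1}"

definition outside_open :: "('v \<times> real) set" where
  "outside_open = {p \<in> uhs. \<forall>\<alpha>\<in>L. dist p (\<alpha>, 0) > 1}"

lemma side_sroot_sign:
  assumes "p \<in> uhs"
  shows "side (sroot \<alpha>) p \<ge> 0 \<longleftrightarrow> dist p (\<alpha>, 0) \<ge> 1" "side (sroot \<alpha>) p > 0 \<longleftrightarrow> dist p (\<alpha>, 0) > 1"
proof -
  have "1 \<le> (dist p (\<alpha>, 0))\<^sup>2 \<longleftrightarrow> 1 \<le> dist p (\<alpha>, 0)" "1 < (dist p (\<alpha>, 0))\<^sup>2 \<longleftrightarrow> 1 < dist p (\<alpha>, 0)"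
    using abs_le_square_iff[of 1 "dist p (\<alpha>, 0)"] abs_le_square_iff[of "dist p (\<alpha>, 0)" 1]
    by (simp_all add: linorder_not_le[symmetric])
  then show "side (sroot \<alpha>) p \<ge> 0 \<longleftrightarrow> dist p (\<alpha>, 0) \<ge> 1" "side (sroot \<alpha>) p > 0 \<longleftrightarrow> dist p (\<alpha>, 0) > 1"
    using uhsD[OF assms] side_sroot[OF assms] by (simp_all add: zero_le_divide_iff zero_less_divide_iff)
qed

lemma outside_vmap:
  assumes "a \<in> A"
  shows "vmap a p \<in> outside \<longleftrightarrow> p \<in> outside" "vmap a p \<in> outside_open \<longleftrightarrow> p \<in> outside_open"
proof -
  obtain b where b: "b \<in> A" "a \<circ> b = id" "b \<circ> a = id" using A_inverse assms by blast
  have d: "dist (vmap a p) (a \<alpha>, 0) = dist p (\<alpha>, 0)" for \<alpha>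
    using A_dist[OF assms] by (simp add: vmap_def dist_prod_def)
  have "L = a ` L"
    using A_L[OF assms] A_L[OF b(1)] b(2) by (auto simp: fun_eq_iff image_iff) metis
  then have "(\<forall>\<alpha>\<in>L. Q (dist (vmap a p) (\<alpha>, 0))) \<longleftrightarrow> (\<forall>\<alpha>\<in>L. Q (dist p (\<alpha>, 0)))" for Q
    using d by (metis (mono_tags, lifting) ball_imageD imageE imageI)
  then show "vmap a p \<in> outside \<longleftrightarrow> p \<in> outside" "vmap a p \<in> outside_open \<longleftrightarrow> p \<in> outside_open"
    by (simp_all add: outside_def outside_open_def vmap_uhs)
qed

text \<open>\<open>Alc\<close> is closed; freeness of the foot keeps it off every vertical mirror
  and turns the weak inequalities of the alcove into strict ones.\<close>

lemma chamberI:
  assumes "p \<in> outside_open" "fst p \<in> Alc" "free (fst p)"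
  shows "hyp p \<in> T.chamber"
proof -
  have u: "p \<in> uhs" using assms by (simp add: outside_open_def)
  have "side (pr x) p > 0" if x: "x \<in> Simple" for x
  proof -
    have P: "x \<in> Pos" using x Simple_Pos by auto
    have "pval x (fst p) \<ge> 0" using assms P by (simp add: Alc_def)
    moreover have "pval x (fst p) \<noteq> 0" using free_val[OF assms(3)] PosD[OF P] by simp
    ultimately show ?thesis using uhsD[OF u] by (simp add: side_proot)
  qed
  moreover have "side (sroot \<alpha>) p > 0" if "\<alpha> \<in> L" for \<alpha>
    using assms(1) that side_sroot_sign(2)[OF u] by (simp add: outside_open_def)
  ultimately have "mform (hyp p) s > 0" if "s \<in> S" for s
    using that by (auto simp: S_def side_def[symmetric])
  then show ?thesis by (simp add: T.chamber_def)
qed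

lemma closed_chamberI:
  assumes "p \<in> outside" "fst p \<in> Alc" "s \<in> S"
  shows "mform (hyp p) s \<ge> 0"
proof -
  have u: "p \<in> uhs" using assms by (simp add: outside_def)
  have "side (pr x) p \<ge> 0" if x: "x \<in> Simple" for x
    using assms(2) Simple_Pos[OF x] uhsD[OF u] by (simp add: side_proot Alc_def)
  moreover have "side (sroot \<alpha>) p \<ge> 0" if "\<alpha> \<in> L" for \<alpha>
    using assms(1) that side_sroot_sign(1)[OF u] by (simp add: outside_def)
  ultimately show ?thesis using assms(3) by (auto simp: S_def side_def[symmetric])
qed

lemma c_Alc: "c \<in> Alc"
  by (auto simp: Alc_def Pos_def less_imp_le)

lemma base_point: "(c, 2) \<in> outside_open"
proof -
  have "dist (2::real) 0 \<le> dist (c, 2 :: real) (\<alpha>, 0)" for \<alpha>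
    using dist_snd_le[of "(c, 2 :: real)" "(\<alpha>, 0)"] by simp
  then have "dist (c, 2 :: real) (\<alpha>, 0) > 1" for \<alpha>
    by (rule less_le_trans[rotated]) simp
  then show ?thesis by (simp add: outside_open_def uhs_iff)
qed

lemma chamber_nonempty: "T.chamber \<noteq> {}"
  using chamberI[OF base_point] c_Alc free_c by auto

end

section \<open>The group\<close>

lemma continuous_prod_fun:
  "continuous_on uhs (\<lambda>p. f (hyp p))" if "continuous_on UNIV f"
  by (rule continuous_on_compose2[OF that continuous_hyp]) simp

lemma BijGroup_simps:
  "carrier (BijGroup uhs) = Bij uhs"
  "f \<in> Bij uhs \<Longrightarrow> g \<in> Bij uhs \<Longrightarrow> f \<otimes>\<^bsub>BijGroup uhs\<^esub> g = compose uhs f g"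
  "\<one>\<^bsub>BijGroup uhs\<^esub> = (\<lambda>p\<in>uhs. p)"
  by (simp_all add: BijGroup_def)

lemma restrict_Bij:
  assumes "\<And>p. p \<in> uhs \<Longrightarrow> f p \<in> uhs \<and> g p \<in> uhs \<and> g (f p) = p \<and> f (g p) = p"
  shows "restrict f uhs \<in> Bij uhs"
proof -
  have "bij_betw (restrict f uhs) uhs uhs"
    by (rule bij_betwI[where g = g]) (use assms in auto)
  then show ?thesis by (simp add: Bij_def)
qed

lemma inv_BijGroup_restrict:
  assumes "\<And>p. p \<in> uhs \<Longrightarrow> f p \<in> uhs \<and> g p \<in> uhs \<and> g (f p) = p \<and> f (g p) = p"
  shows "inv\<^bsub>BijGroup uhs\<^esub> (restrict f uhs) = restrict g uhs"
proof -
  interpret group "BijGroup uhs" by (rule group_BijGroup)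
  have f: "restrict f uhs \<in> Bij uhs" using restrict_Bij assms by blast
  have g: "restrict g uhs \<in> Bij uhs" using restrict_Bij[of g f] assms by blast
  have "compose uhs (restrict g uhs) (restrict f uhs) = (\<lambda>p\<in>uhs. p)"
    using assms by (intro ext) (simp add: compose_def)
  then have "restrict g uhs \<otimes>\<^bsub>BijGroup uhs\<^esub> restrict f uhs = \<one>\<^bsub>BijGroup uhs\<^esub>"
    using f g by (simp add: BijGroup_simps)
  then show ?thesis using f g by (intro inv_equality) (simp_all add: BijGroup_simps)
qed

lemma inv_map_involutive:
  assumes "p \<in> uhs"
  shows "inv_map \<alpha> (inv_map \<alpha> p) = p"
  by (rule hyp_inj) (simp_all add: assms inv_map_uhs hyp_inv_map mf.reflection_involutive)

text \<open>Elements of \<open>BijGroup uhs\<close> are extensional, so a map has to be cut down to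
  \<open>uhs\<close> before it belongs to the group; equality in the group is then equality on
  \<open>uhs\<close>.\<close>

definition Inv :: "'v::euclidean_space \<Rightarrow> 'v \<times> real \<Rightarrow> 'v \<times> real" where
  "Inv \<alpha> = restrict (inv_map \<alpha>) uhs"

definition Vert :: "('v::euclidean_space \<Rightarrow> 'v) \<Rightarrow> 'v \<times> real \<Rightarrow> 'v \<times> real" where
  "Vert a = restrict (vmap a) uhs"

lemma Inv_Bij: "Inv \<alpha> \<in> Bij uhs" "inv\<^bsub>BijGroup uhs\<^esub> (Inv \<alpha>) = Inv \<alpha>"
  unfolding Inv_def
  by (intro restrict_Bij[where g = "inv_map \<alpha>"] inv_BijGroup_restrict;
      simp add: inv_map_uhs inv_map_involutive)+

lemma Vert_Bij:
  assumes "a \<circ> b = id" "b \<circ> a = id"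
  shows "Vert a \<in> Bij uhs" "inv\<^bsub>BijGroup uhs\<^esub> (Vert a) = Vert b"
  unfolding Vert_def
  by (intro restrict_Bij[where g = "vmap b"] inv_BijGroup_restrict;
      simp add: vmap_uhs vmap_comp assms)+

lemma hyp_isometriesI:
  assumes "f \<in> Bij uhs"
    and "\<And>p q. p \<in> uhs \<Longrightarrow> q \<in> uhs \<Longrightarrow> mform (hyp (f p)) (hyp (f q)) = mform (hyp p) (hyp q)"
  shows "f \<in> hyp_isometries"
proof -
  have "f p \<in> uhs" if "p \<in> uhs" for p
    using assms(1) that Bij_imp_funcset by blast
  then show ?thesis using assms by (simp add: hyp_isometries_def hdist_alt)
qed

context int_lattice
begin

definition gens :: "('v \<times> real \<Rightarrow> 'v \<times> real) set" where
  "gens = {Inv \<alpha> | \<alpha>. \<alpha> \<in> L} \<union> {Vert (\<lambda>z. z + l) | l. l \<in> L}"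

text \<open>A concrete copy of the group of the theorem, whose generators are given there only
  through boundary values; \<open>inversion_group_K\<close> identifies the two.\<close>

definition K :: "('v \<times> real \<Rightarrow> 'v \<times> real) set" where
  "K = generate (BijGroup uhs) gens"

lemma translation_inverse: "(\<lambda>z. z + l) \<circ> (\<lambda>z. z + - l) = id" "(\<lambda>z. z + - l) \<circ> (\<lambda>z. z + l) = (id :: 'v \<Rightarrow> 'v)"
  by (auto simp: fun_eq_iff)

lemma gens_Bij: "g \<in> gens \<Longrightarrow> g \<in> Bij uhs"
  unfolding gens_def using Inv_Bij Vert_Bij(1)[OF translation_inverse] by blast

lemma K_subgroup: "subgroup K (BijGroup uhs)"
  unfolding K_def using gens_Bij
  by (intro group.generate_is_subgroup[OF group_BijGroup]) (auto simp: BijGroup_simps)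

lemma K_Bij: "g \<in> K \<Longrightarrow> g \<in> Bij uhs"
  using subgroup.subset[OF K_subgroup] by (auto simp: BijGroup_simps)

lemma K_uhs: "g \<in> K \<Longrightarrow> p \<in> uhs \<Longrightarrow> g p \<in> uhs"
  using K_Bij Bij_imp_funcset by blast

lemma K_comp: "g \<in> K \<Longrightarrow> h \<in> K \<Longrightarrow> compose uhs g h \<in> K"
  using subgroup.m_closed[OF K_subgroup, of g h] K_Bij by (simp add: BijGroup_simps)

lemma K_one: "(\<lambda>p\<in>uhs. p) \<in> K"
  using subgroup.one_closed[OF K_subgroup] by (simp add: BijGroup_simps)

lemma K_ext: "g \<in> K \<Longrightarrow> h \<in> K \<Longrightarrow> (\<And>p. p \<in> uhs \<Longrightarrow> g p = h p) \<Longrightarrow> g = h"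
  using K_Bij Bij_imp_extensional by (metis extensionalityI)

lemma K_inverse:
  assumes "g \<in> K"
  obtains h where "h \<in> K" "\<And>p. p \<in> uhs \<Longrightarrow> h (g p) = p" "\<And>p. p \<in> uhs \<Longrightarrow> g (h p) = p"
proof -
  interpret group "BijGroup uhs" by (rule group_BijGroup)
  let ?h = "inv\<^bsub>BijGroup uhs\<^esub> g"
  have h: "?h \<in> K" using subgroup.m_inv_closed[OF K_subgroup assms] .
  have "compose uhs ?h g = (\<lambda>p\<in>uhs. p)" "compose uhs g ?h = (\<lambda>p\<in>uhs. p)"
    using l_inv[of g] r_inv[of g] K_Bij[OF assms] K_Bij[OF h] by (simp_all add: BijGroup_simps)
  then have "compose uhs ?h g p = p" "compose uhs g ?h p = p" if "p \<in> uhs" for p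
    using that by simp_all
  then show ?thesis using that[OF h] by (simp add: compose_def)
qed

lemma K_inj: "g \<in> K \<Longrightarrow> p \<in> uhs \<Longrightarrow> q \<in> uhs \<Longrightarrow> g p = g q \<Longrightarrow> p = q"
  by (metis K_inverse)

lemma Inv_K: "\<alpha> \<in> L \<Longrightarrow> Inv \<alpha> \<in> K"
  unfolding K_def gens_def by (auto intro: generate.incl)

lemma trans_K: "l \<in> L \<Longrightarrow> Vert (\<lambda>z. z + l) \<in> K"
  unfolding K_def gens_def by (auto intro: generate.incl)

lemma Vert_comp: "compose uhs (Vert a) (Vert b) = Vert (a \<circ> b)"
  by (auto simp: compose_def Vert_def vmap_uhs vmap_comp fun_eq_iff)

text \<open>The reflection in the bisector of \<open>0\<close> and a unit vector \<open>u\<close> of \<open>L\<close> is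
  \<open>\<phi>\<^sub>0 \<phi>\<^sub>u \<phi>\<^sub>0\<close>, because the unit spheres about \<open>0\<close> and \<open>u\<close> meet at the angle \<open>\<pi>/3\<close>.\<close>

lemma bisector_reflection:
  assumes u: "u \<bullet> u = 1" and p: "p \<in> uhs"
  shows "inv_map 0 (inv_map u (inv_map 0 p)) = vmap (prefl u (- 1)) p"
proof (rule hyp_inj)
  have "reflection mform (sroot 0) (sroot u) = - proot u (- 1)"
    using u by (simp add: reflection_def mform_sroot) (simp add: sroot_def proot_def)
  then have "reflection mform (sroot 0) (reflection mform (sroot u) y)
      = reflection mform (proot u (- 1)) (reflection mform (sroot 0) y)" for y
    using mf.reflection_conj[of "reflection mform (sroot 0)" "sroot u" y]
    by (simp add: mf.reflection_uminus mf.reflection_linear mf.reflection_form)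
  then show "hyp (inv_map 0 (inv_map u (inv_map 0 p))) = hyp (vmap (prefl u (- 1)) p)"
    using p by (simp add: hyp_inv_map inv_map_uhs hyp_vmap_prefl[OF u] mf.reflection_involutive)
qed (use p in \<open>simp_all add: inv_map_uhs vmap_uhs\<close>)

lemma Vert_K: "a \<in> A \<Longrightarrow> Vert a \<in> K"
proof (induction rule: A.induct)
  case id
  have "Vert (id :: 'v \<Rightarrow> 'v) = (\<lambda>p\<in>uhs. p)" by (auto simp: Vert_def fun_eq_iff)
  then show ?case using K_one by (simp only:)
next
  case (trans a l)
  then show ?case using K_comp[OF trans_K] by (metis Vert_comp)
next
  case (refl a u k)
  have u: "u \<in> L" "u \<bullet> u = 1" using refl UD by auto
  have "compose uhs (Inv 0) (compose uhs (Inv u) (Inv 0)) = Vert (prefl u (- 1))"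
    using bisector_reflection[OF u(2)]
    by (auto simp: Inv_def Vert_def compose_def fun_eq_iff inv_map_uhs)
  then have 1: "Vert (prefl u (- 1)) \<in> K" using u zero Inv_K K_comp by metis
  \<comment> \<open>Parallel reflections differ by a translation along \<open>u\<close>, so the
    bisector of 0 and \<open>u\<close> (the case \<open>k = -1\<close>) together with lattice
    translations gives all integers \<open>k\<close>.\<close>
  have "(- (k + 1)) *\<^sub>R u \<in> L" using refl u by (intro scaleR_closed) auto
  moreover have "prefl u k = (\<lambda>z. z + (- (k + 1)) *\<^sub>R u) \<circ> prefl u (- 1)"
    by (auto simp: fun_eq_iff prefl_def val_def algebra_simps)
  ultimately have "Vert (prefl u k) \<in> K" using K_comp[OF trans_K 1] by (metis Vert_comp)
  then show ?case using K_comp[OF _ refl.IH] by (metis Vert_comp)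
qed

text \<open>Conjugating the reflection in a hemisphere by a translation shifts its centre within
  \<open>L\<close>. So all translations can be collected on the right.\<close>

lemma K_lift:
  assumes "g \<in> K"
  obtains ns l where "set ns \<subseteq> sroot ` L" "l \<in> L"
    "\<And>p. p \<in> uhs \<Longrightarrow> hyp (g p) = word_map mform ns (tlin l (hyp p))"
proof -
  let ?P = "\<lambda>g. \<exists>ns l. set ns \<subseteq> sroot ` L \<and> l \<in> L \<and>
    (\<forall>p\<in>uhs. hyp (g p) = word_map mform ns (tlin l (hyp p)))"
  have gen: "?P g" if "g \<in> gens" for g
  proof -
    consider \<alpha> where "g = Inv \<alpha>" "\<alpha> \<in> L" | l where "g = Vert (\<lambda>z. z + l)" "l \<in> L"
      using \<open>g \<in> gens\<close> unfolding gens_def by blast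
    then show ?thesis
    proof cases
      case 1
      then show ?thesis using zero
        by (intro exI[of _ "[sroot \<alpha>]"] exI[of _ 0]) (simp add: Inv_def hyp_inv_map)
    next
      case 2
      then show ?thesis
        by (intro exI[of _ "[]"] exI[of _ l]) (simp add: Vert_def hyp_vmap_translation)
    qed
  qed
  have "g \<in> generate (BijGroup uhs) gens" using assms K_def by simp
  then have "?P g"
  proof (induction rule: generate.induct)
    case one
    show ?case using zero by (intro exI[of _ "[]"] exI[of _ 0]) (simp add: BijGroup_simps)
  next
    case (incl g)
    then show ?case using gen by blast
  next
    case (inv g)
    have "inv\<^bsub>BijGroup uhs\<^esub> g \<in> gens"
      using inv Inv_Bij(2) Vert_Bij(2)[OF translation_inverse] uminus unfolding gens_def by blast
    then show ?case using gen by blast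
  next
    case (eng g h)
    then obtain ns l where g: "set ns \<subseteq> sroot ` L" "l \<in> L"
      "\<forall>p\<in>uhs. hyp (g p) = word_map mform ns (tlin l (hyp p))" by blast
    obtain ms m where h: "set ms \<subseteq> sroot ` L" "m \<in> L"
      "\<forall>p\<in>uhs. hyp (h p) = word_map mform ms (tlin m (hyp p))" using eng by blast
    have K: "g \<in> K" "h \<in> K" using eng by (simp_all add: K_def)
    have "hyp ((g \<otimes>\<^bsub>BijGroup uhs\<^esub> h) p)
        = word_map mform (ns @ map (tlin l) ms) (tlin (l + m) (hyp p))" if "p \<in> uhs" for p
      using that g(3) h(3) K_Bij[OF K(1)] K_Bij[OF K(2)] K_uhs[OF K(2)]
      by (simp add: BijGroup_simps compose_def word_map_append tlin_word tlin_tlin)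
    moreover have "tlin l ` sroot ` L \<subseteq> sroot ` L"
      using g(2) add by (auto simp: tlin_sroot)
    then have "set (ns @ map (tlin l) ms) \<subseteq> sroot ` L"
      using g(1) image_mono[OF h(1), of "tlin l"] by (simp only: set_append set_map) blast
    ultimately show ?case using add[OF g(2) h(2)] by blast
  qed
  then show ?thesis using that by blast
qed

lemma sphere_word_norm: "set ns \<subseteq> sroot ` L \<Longrightarrow> n \<in> set ns \<Longrightarrow> mform n n = 2"
  by auto

lemma K_isometries: "K \<subseteq> hyp_isometries"
proof
  fix g assume g: "g \<in> K"
  obtain ns l where ns: "set ns \<subseteq> sroot ` L" "l \<in> L"
    "\<And>p. p \<in> uhs \<Longrightarrow> hyp (g p) = word_map mform ns (tlin l (hyp p))"
    using K_lift[OF g] by blast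
  show "g \<in> hyp_isometries"
    using ns(3) word_form[OF sphere_word_norm[OF ns(1)]]
    by (intro hyp_isometriesI K_Bij g) (simp add: mform_tlin)
qed

text \<open>On the hyperboloid the map is linear, and a point is recovered continuously from its
  image under \<open>hyp\<close> as long as its height is nonzero.\<close>

lemma K_continuous:
  assumes g: "g \<in> K"
  shows "continuous_on uhs g"
proof -
  obtain ns l where ns: "set ns \<subseteq> sroot ` L" "l \<in> L"
    "\<And>p. p \<in> uhs \<Longrightarrow> hyp (g p) = word_map mform ns (tlin l (hyp p))"
    using K_lift[OF g] by blast
  define G where "G = word_map mform ns \<circ> tlin l"
  have "linear (word_map mform ns)"
    by (induction ns) (simp_all only: word_map_Nil word_map_Cons linear_id linear_compose[OF _ mf.reflection_linear])
  then have "linear G" unfolding G_def by (rule linear_compose[OF linear_tlin])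
  then have "continuous_on uhs (\<lambda>p. G (hyp p))"
    by (intro continuous_prod_fun linear_continuous_on linear_conv_bounded_linear[THEN iffD1])
  then have c: "continuous_on uhs (\<lambda>p. hyp (g p))"
    by (rule continuous_on_eq) (simp add: G_def ns(3))
  have nz: "snd (g p) \<noteq> 0" if "p \<in> uhs" for p
    using uhsD[OF K_uhs[OF g that]] by simp
  have eq: "((1 / snd (snd (hyp q))) *\<^sub>R fst (snd (hyp q)), 1 / snd (snd (hyp q))) = q" if "q \<in> uhs" for q :: "'v \<times> real"
    using that by (simp add: hyp_def uhs_def prod_eq_iff)
  have "continuous_on uhs (\<lambda>p. ((1 / snd (snd (hyp (g p)))) *\<^sub>R fst (snd (hyp (g p))), 1 / snd (snd (hyp (g p)))))"
    by (intro continuous_intros c ballI) (simp_all add: hyp_def nz)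
  then show ?thesis
    by (rule continuous_on_eq) (simp add: eq K_uhs[OF g])
qed

end

lemma finite_min:
  fixes f :: "'a \<Rightarrow> real"
  assumes "finite T" "T \<noteq> {}"
  shows "\<exists>a\<in>T. \<forall>b\<in>T. f a \<le> f b"
  using arg_min_least[OF assms] arg_min_if_finite(1)[OF assms] by blast

section \<open>Null vectors of the integral lattice and heights in an orbit\<close>

context int_lattice
begin

definition Zlat :: "(real \<times> 'v \<times> real) set" where
  "Zlat = \<int> \<times> L \<times> \<int>"

lemma Zlat_reflection:
  assumes "\<alpha> \<in> L" "y \<in> Zlat"
  shows "reflection mform (sroot \<alpha>) y \<in> Zlat"
proof -
  obtain k v h where y: "y = (k, v, h)" by (cases y) auto
  then have kvh: "k \<in> \<int>" "v \<in> L" "h \<in> \<int>" using assms by (auto simp: Zlat_def)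
  have eq: "mform y (sroot \<alpha>) = - (2 * (v \<bullet> \<alpha>)) + k - h * (1 - \<alpha> \<bullet> \<alpha>)"
    by (simp add: y sroot_def mform_eq)
  then have m: "mform y (sroot \<alpha>) \<in> \<int>"
    unfolding eq using kvh twice_inner_Ints[OF kvh(2) assms(1)] integral[OF assms(1)]
    by (intro Ints_add Ints_diff Ints_minus Ints_mult[of h] Ints_1)
  have "v - mform y (sroot \<alpha>) *\<^sub>R (- \<alpha>) \<in> L"
    using m assms(1) kvh(2) uminus by (intro diff scaleR_closed) auto
  then show ?thesis
    using m kvh integral[OF assms(1)] unfolding reflection_def
    by (simp add: y sroot_def Zlat_def)
qed

lemma Zlat_tlin: "l \<in> L \<Longrightarrow> y \<in> Zlat \<Longrightarrow> tlin l y \<in> Zlat"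
  unfolding Zlat_def tlin_def using twice_inner_Ints integral add scaleR_closed by auto

lemma Zlat_word: "set ns \<subseteq> sroot ` L \<Longrightarrow> y \<in> Zlat \<Longrightarrow> word_map mform ns y \<in> Zlat"
proof (induction ns)
  case (Cons n ns)
  then obtain \<alpha> where "n = sroot \<alpha>" "\<alpha> \<in> L" by auto
  then show ?case using Cons Zlat_reflection by simp
qed simp

text \<open>The vector \<open>y = g\<^sup>-\<^sup>1 \<infinity>\<close> determines the height of all points \<open>g p\<close>.\<close>

lemma dual_vector:
  assumes "g \<in> K"
  obtains y where "y \<in> Zlat" "mform y y = 0" "\<And>p. p \<in> uhs \<Longrightarrow> - 1 / snd (g p) = mform (hyp p) y"
proof -
  obtain ns l where ns: "set ns \<subseteq> sroot ` L" "l \<in> L"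
    "\<And>p. p \<in> uhs \<Longrightarrow> hyp (g p) = word_map mform ns (tlin l (hyp p))"
    using K_lift[OF assms] by blast
  define y where "y = tlin (- l) (word_map mform (rev ns) einf)"
  have e: "einf \<in> Zlat" using zero by (simp add: Zlat_def einf_def)
  have "y \<in> Zlat" unfolding y_def using ns e uminus by (intro Zlat_tlin Zlat_word) auto
  moreover have "mform y y = 0"
    unfolding y_def mform_tlin using ns(1) by (subst word_form) (auto simp: einf_def mform_eq)
  moreover have "- 1 / snd (g p) = mform (hyp p) y" if "p \<in> uhs" for p
  proof -
    have "- 1 / snd (g p) = mform (tlin l (hyp p)) (word_map mform (rev ns) einf)"
      using mform_hyp_einf[of "g p"] ns(3)[OF that] by (simp add: word_adjoint)
    also have "\<dots> = mform (tlin (- l) (tlin l (hyp p))) y"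
      unfolding y_def mform_tlin by simp
    finally show ?thesis by (simp add: tlin_tlin)
  qed
  ultimately show ?thesis using that by blast
qed

text \<open>With \<open>y\<close> from \<open>dual_vector\<close>, the quantity
  \<open>- mform (hyp p) y\<close> is the reciprocal of the height of \<open>g p\<close>. So over a
  bounded region only finitely many of these vectors raise points above a given level; both maximal
  heights and local finiteness rest on this.\<close>

lemma finite_null:
  assumes t0: "t0 > 0"
  shows "finite {y \<in> Zlat. mform y y = 0 \<and> (\<exists>p\<in>uhs. norm (fst p) \<le> r \<and> t0 \<le> snd p \<and> snd p \<le> t1 \<and>
    0 < - mform (hyp p) y \<and> - mform (hyp p) y \<le> C)}" (is "finite ?X")
proof -
  \<comment> \<open>Bounds in the order in which the coordinates \<open>(k, v, h)\<close> of
    \<open>y\<close> are controlled: \<open>D\<close> for \<open>h\<close>, \<open>W\<close> for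
    \<open>|h z - v|\<^sup>2\<close>, \<open>D2\<close> for \<open>|v|\<close> (\<open>W + 1\<close>
    exceeds the root of \<open>W\<close>), and \<open>D3\<close> for \<open>k\<close>, which is at
    most \<open>k h = |v|\<^sup>2\<close> if \<open>h \<ge> 1\<close> and at most
    \<open>C * t1\<close> if \<open>h = 0\<close>.\<close>
  define D where "D = C / t0"
  define W where "W = D * (C * t1)"
  define D2 where "D2 = D * r + (W + 1)"
  define D3 where "D3 = D2 * D2 + C * t1"
  have "?X \<subseteq> {k \<in> \<int>. \<bar>k\<bar> \<le> D3} \<times> {v \<in> L. dist v 0 \<le> D2} \<times> {h \<in> \<int>. \<bar>h\<bar> \<le> D}"
  proof
    fix y assume y: "y \<in> ?X"
    obtain k v h where kvh: "y = (k, v, h)" by (cases y) auto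
    obtain p where p: "p \<in> uhs" "norm (fst p) \<le> r" "t0 \<le> snd p" "snd p \<le> t1"
      "0 < - mform (hyp p) y" "- mform (hyp p) y \<le> C" using y by blast
    obtain z t where zt: "p = (z, t)" by (cases p)
    have t: "t > 0" "t0 \<le> t" "t \<le> t1" "norm z \<le> r" using p zt by (auto simp: uhs_iff)
    have Zlat: "k \<in> \<int>" "v \<in> L" "h \<in> \<int>" using y by (auto simp: kvh Zlat_def)
    have vv: "v \<bullet> v = k * h" using y by (simp add: kvh mform_eq)
    define N where "N = h * (z \<bullet> z + t * t) + k - 2 * (z \<bullet> v)"
    have N: "- mform (hyp p) y = N / t"
      using t by (simp add: N_def kvh zt hyp_def mform_eq inner_prod_def field_simps)
    have N0: "N > 0" using p(5) t unfolding N by (simp add: zero_less_divide_iff)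
    have NC: "N \<le> C * t" using p(6) t unfolding N by (simp add: divide_le_eq)
    have C: "C > 0" using p(5,6) by simp
    have D: "D > 0" "D \<ge> C / t" using C t t0 by (auto simp: D_def intro!: divide_left_mono)
    have NC1: "N \<le> C * t1" using NC C t by (meson mult_left_mono less_imp_le order_trans)
    have W: "W > 0" using D C t by (auto simp: W_def intro!: mult_pos_pos)
    have r: "r \<ge> 0" using t norm_ge_zero order_trans by blast
    have D2: "D2 > 0" using D W r by (auto simp: D2_def intro!: add_nonneg_pos)
    have Ct1: "C * t1 > 0" using C t by simp
    have "\<bar>k\<bar> \<le> D3 \<and> norm v \<le> D2 \<and> \<bar>h\<bar> \<le> D"
    proof (cases "h = 0")
      case True
      then have "v = 0" using vv by simp
      then have "N = k" using True by (simp add: N_def)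
      moreover have "D2 * D2 > 0" using D2 by (intro mult_pos_pos)
      ultimately have "k \<le> D3" unfolding D3_def using NC1 by linarith
      then show ?thesis using True \<open>v = 0\<close> \<open>N = k\<close> N0 D D2 by simp
    next
      case False
      \<comment> \<open>Completing the square; \<open>y\<close> being null gives
        \<open>|v|\<^sup>2 = k h\<close>. Both summands on the left are nonnegative, so a bound on
        \<open>N\<close> bounds \<open>h t\<close> and \<open>h z - v\<close> separately.\<close>
      have sq: "(h *\<^sub>R z - v) \<bullet> (h *\<^sub>R z - v) + h * h * (t * t) = h * N"
        using vv by (simp add: N_def inner_diff_left inner_diff_right inner_commute algebra_simps)
      have "h * h * (t * t) > 0" 
      proof -
        have "h * h > 0" using False not_real_square_gt_zero by blast
        then show ?thesis using t by simp
      qed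
      then have "h * N > 0" using sq by (metis add_nonneg_pos inner_ge_zero)
      then have h: "h > 0" using N0 by (simp add: zero_less_mult_iff)
      have h1: "h \<ge> 1" using h Zlat(3) by (auto elim!: Ints_cases)
      have "h * (h * (t * t)) \<le> h * N" using sq by (metis inner_ge_zero le_add_same_cancel2 mult.assoc)
      then have "h * (t * t) \<le> N" using h by simp
      then have "(h * t) * t \<le> C * t" using NC by (simp add: mult.assoc)
      then have "h * t \<le> C" using t by simp
      then have hD: "h \<le> D" using D(2) t(1) by (metis order_trans pos_le_divide_eq)
      have "h * N \<le> D * (C * t1)" using hD NC1 h N0 D by (intro mult_mono) auto
      then have "(h *\<^sub>R z - v) \<bullet> (h *\<^sub>R z - v) \<le> W"
        using sq \<open>h * h * (t * t) > 0\<close> by (simp add: W_def)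
      then have "(norm (h *\<^sub>R z - v))\<^sup>2 \<le> W" by (simp add: power2_norm_eq_inner)
      also have "W \<le> (W + 1)\<^sup>2" using W by (simp add: power2_eq_square algebra_simps)
      finally have "norm (h *\<^sub>R z - v) \<le> W + 1" by (rule power2_le_imp_le) (use W in simp)
      moreover have "norm v \<le> norm (h *\<^sub>R z) + norm (h *\<^sub>R z - v)"
        using norm_triangle_ineq4[of "h *\<^sub>R z" "h *\<^sub>R z - v"] by simp
      moreover have "norm (h *\<^sub>R z) \<le> D * r" using h hD t D by (auto intro!: mult_mono)
      ultimately have v: "norm v \<le> D2" by (simp add: D2_def)
      have k0: "k \<ge> 0" using vv h by (metis inner_ge_zero zero_le_mult_iff not_le)
      have "k \<le> k * h" using k0 h1 by (simp add: mult_le_cancel_left1)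
      also have "\<dots> = norm v * norm v" using vv by (simp add: power2_norm_eq_inner[symmetric] power2_eq_square)
      also have "\<dots> \<le> D2 * D2" using v by (intro mult_mono) (auto simp: order_trans[OF norm_ge_zero])
      finally have "\<bar>k\<bar> \<le> D3" using k0 Ct1 by (simp add: D3_def)
      then show ?thesis using v hD h by simp
    qed
    then show "y \<in> {k \<in> \<int>. \<bar>k\<bar> \<le> D3} \<times> {v \<in> L. dist v 0 \<le> D2} \<times> {h \<in> \<int>. \<bar>h\<bar> \<le> D}"
      using Zlat by (simp add: kvh)
  qed
  moreover have "finite {k \<in> \<int>. \<bar>k\<bar> \<le> b}" for b :: real
    using finite_abs_int_segment[of b] by simp
  ultimately show ?thesis
    using finite_cball by (meson finite_SigmaI finite_subset)
qed

end

section \<open>Rigidity, maximal heights and the stabiliser of infinity\<close>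

context based_lattice
begin

lemma K_lift_S:
  assumes "g \<in> K"
  obtains G l where "G \<in> T.maps_of S" "l \<in> L" "\<And>p. p \<in> uhs \<Longrightarrow> hyp (g p) = G (tlin l (hyp p))"
  using K_lift[OF assms] sphere_word_maps by metis

text \<open>Vertical words carry the translated point and its image into the alcove. Between these
  two positions acts an element \<open>H\<close> of the reflection group that maps a chamber point
  to a chamber point, so \<open>chamber_disjoint\<close> leaves only vertical motions.\<close>

lemma rigid:
  assumes g: "g \<in> K" and p: "p \<in> outside_open" "free (fst p)"
    and gp: "g p \<in> outside_open" "free (fst (g p))"
  obtains b where "b \<in> A" "\<And>q. q \<in> uhs \<Longrightarrow> g q = vmap b q"
proof -
  obtain G l where G: "G \<in> T.maps_of S" "l \<in> L" "\<And>p. p \<in> uhs \<Longrightarrow> hyp (g p) = G (tlin l (hyp p))"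
    using K_lift_S[OF g] by blast
  have pu: "p \<in> uhs" using p by (simp add: outside_open_def)
  define p' where "p' = vmap (\<lambda>z. z + l) p"
  have tl: "tlin l (hyp q) = hyp (vmap (\<lambda>z. z + l) q)" if "q \<in> uhs" for q
    using that by (simp add: hyp_vmap_translation)
  obtain a ns where a: "wlift a ns" "a (fst p') \<in> Alc" by (rule to_alcove)
  obtain a2 ns2 where a2: "wlift a2 ns2" "a2 (fst (g p)) \<in> Alc" by (rule to_alcove)
  have aA: "a \<in> A" "a2 \<in> A" using a a2 by (auto simp: wlift_def)
  have w: "word_map mform ns (hyp q) = hyp (vmap a q)" "word_map mform ns2 (hyp q) = hyp (vmap a2 q)" for q
    using a(1) a2(1) unfolding wlift_def by metis+
  have y: "hyp (vmap a p') \<in> T.chamber"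
  proof (rule chamberI)
    have "p' \<in> outside_open" unfolding p'_def using outside_vmap(2)[OF A_trans[OF G(2)]] p(1) by blast
    then show "vmap a p' \<in> outside_open" using outside_vmap(2)[OF aA(1)] by blast
    have "fst p' = (\<lambda>z. z + l) (fst p)" by (simp add: p'_def)
    then have "free (fst p')" using free_A[OF p(2) A_trans[OF G(2)]] by simp
    then show "free (fst (vmap a p'))" using free_A aA(1) by simp
    show "fst (vmap a p') \<in> Alc" using a(2) by simp
  qed
  have y2: "hyp (vmap a2 (g p)) \<in> T.chamber"
    using a2(2) gp aA outside_vmap(2)[OF aA(2)] free_A[OF gp(2) aA(2)] by (intro chamberI) simp_all
  define H where "H = word_map mform ns2 \<circ> (G \<circ> word_map mform (rev ns))"
  have H: "H \<in> T.maps_of S"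
    unfolding H_def using wlift_maps[OF a(1)] wlift_maps[OF a2(1)] G(1) by (intro T.maps_of_comp) auto
  have Hq: "H (hyp (vmap a (vmap (\<lambda>z. z + l) q))) = hyp (vmap a2 (g q))" if q: "q \<in> uhs" for q
    using wlift_rev(1)[OF a(1)] G(3)[OF q] tl[OF q] by (simp add: H_def w[symmetric])
  have "H = id"
    using T.chamber_disjoint[OF H y] y2 Hq[OF pu] by (simp add: p'_def)
  then have eq: "vmap a2 (g q) = vmap (a \<circ> (\<lambda>z. z + l)) q" if q: "q \<in> uhs" for q
    using Hq[OF q] q K_uhs[OF g q] by (intro hyp_inj) (simp_all add: vmap_uhs vmap_comp)
  obtain b where b: "b \<in> A" "a2 \<circ> b = id" "b \<circ> a2 = id" using A_inverse aA by blast
  have "g q = vmap (b \<circ> (a \<circ> (\<lambda>z. z + l))) q" if q: "q \<in> uhs" for q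
  proof -
    have "vmap b (vmap a2 (g q)) = vmap b (vmap (a \<circ> (\<lambda>z. z + l)) q)" using eq[OF q] by simp
    then show ?thesis by (simp add: vmap_comp b(3))
  qed
  moreover have "b \<circ> (a \<circ> (\<lambda>z. z + l)) \<in> A" using b aA A_comp A_trans[OF G(2)] by blast
  ultimately show ?thesis using that by blast
qed

text \<open>The ideal point at infinity pairs to 1 with hemispheres and to 0 with vertical roots, so
  it belongs to the closed chamber. \<open>chamber_minimal\<close> applies once the point has been
  moved over the alcove.\<close>

lemma height_max:
  assumes x: "x \<in> outside" and g: "g \<in> K"
  shows "snd (g x) \<le> snd x"
proof -
  obtain G l where G: "G \<in> T.maps_of S" "l \<in> L" "\<And>p. p \<in> uhs \<Longrightarrow> hyp (g p) = G (tlin l (hyp p))"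
    using K_lift_S[OF g] by blast
  have xu: "x \<in> uhs" using x by (simp add: outside_def)
  define x' where "x' = vmap (\<lambda>z. z + l) x"
  have tl: "tlin l (hyp x) = hyp x'"
    using xu by (simp add: hyp_vmap_translation x'_def)
  have x': "x' \<in> outside" unfolding x'_def using outside_vmap(1)[OF A_trans[OF G(2)]] x by blast
  obtain a ns where a: "wlift a ns" "a (fst x') \<in> Alc" by (rule to_alcove)
  have aA: "a \<in> A" and w: "word_map mform ns (hyp q) = hyp (vmap a q)" for q
    using a(1) unfolding wlift_def by metis+
  define y where "y = vmap a x'"
  have y: "y \<in> outside" "fst y \<in> Alc" using outside_vmap(1)[OF aA] x' a by (auto simp: y_def)
  have "G \<circ> word_map mform (rev ns) \<in> T.maps_of S"
    using wlift_maps[OF a(1)] G(1) by (intro T.maps_of_comp) auto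
  moreover have "mform einf s \<ge> 0" if "s \<in> S" for s
    using that mf.sym[of einf s] by (auto simp: S_def mform_einf)
  ultimately have "mform ((G \<circ> word_map mform (rev ns)) (hyp y)) einf \<le> mform (hyp y) einf"
    using closed_chamberI[OF y] chamber_nonempty by (intro T.chamber_minimal)
  moreover have "(G \<circ> word_map mform (rev ns)) (hyp y) = hyp (g x)"
    using wlift_rev(1)[OF a(1)] G(3)[OF xu] tl by (simp add: y_def w[symmetric])
  ultimately have "- 1 / snd (g x) \<le> - 1 / snd x"
    by (simp add: mform_hyp_einf y_def x'_def)
  then show ?thesis using uhsD[OF xu] uhsD[OF K_uhs[OF g xu]] by (simp add: field_simps)
qed

text \<open>\<open>rigid\<close> can be applied at \<open>(c, 2)\<close> as soon as the foot of its
  image is free. If \<open>b\<close> in \<open>A\<close> fixes that foot, its conjugate by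
  \<open>k\<close> fixes \<open>(c, 2)\<close>; \<open>rigid\<close> then makes this conjugate
  vertical, and freeness of \<open>c\<close> makes it trivial, whence \<open>b = id\<close>.\<close>

lemma stabiliser:
  assumes k: "k \<in> K" and h: "\<And>p. p \<in> uhs \<Longrightarrow> snd (k p) = snd p"
  obtains b where "b \<in> A" "\<And>q. q \<in> uhs \<Longrightarrow> k q = vmap b q"
proof -
  define x where "x = (c, 2 :: real)"
  have x: "x \<in> outside_open" "x \<in> uhs" "fst x = c" "snd x = 2"
    using base_point by (auto simp: x_def uhs_iff)
  have kx: "k x \<in> outside_open"
  proof -
    have "dist (2 :: real) 0 \<le> dist (k x) (\<alpha>, 0)" for \<alpha>
      using dist_snd_le[of "k x" "(\<alpha>, 0)"] h[OF x(2)] x by simp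
    then have "dist (k x) (\<alpha>, 0) > 1" for \<alpha> by (rule less_le_trans[rotated]) simp
    then show ?thesis using K_uhs[OF k x(2)] by (simp add: outside_open_def)
  qed
  have "free (fst (k x))"
    unfolding free_def
  proof (intro ballI impI)
    fix b assume b: "b \<in> A" "b (fst (k x)) = fst (k x)"
    obtain k' where k': "k' \<in> K" "\<And>p. p \<in> uhs \<Longrightarrow> k' (k p) = p" "\<And>p. p \<in> uhs \<Longrightarrow> k (k' p) = p"
      using K_inverse[OF k] by blast
    define g where "g = compose uhs k' (compose uhs (Vert b) k)"
    have gK: "g \<in> K" unfolding g_def by (intro K_comp k k'(1) Vert_K b(1))
    have gq: "g q = k' (vmap b (k q))" if "q \<in> uhs" for q
      using that K_uhs[OF k] by (simp add: g_def compose_def Vert_def)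
    have "vmap b (k x) = k x" using b by (simp add: vmap_def prod_eq_iff)
    then have gx: "g x = x" using gq k'(2) x by simp
    obtain b' where b': "b' \<in> A" "\<And>q. q \<in> uhs \<Longrightarrow> g q = vmap b' q"
      using rigid[OF gK x(1)] unfolding gx x(3) using x(1) free_c by blast
    have "b' c = c" using b'(2)[OF x(2)] gx x by (metis vmap_simps(1))
    then have "b' = id" using free_c b' by (auto simp: free_def)
    then have gid: "g q = q" if "q \<in> uhs" for q using b'(2)[OF that] by simp
    have "b z = z" for z
    proof -
      have u: "(z, 1) \<in> uhs" by (simp add: uhs_iff)
      have u': "k' (z, 1) \<in> uhs" using K_uhs[OF k'(1) u] .
      have "k' (vmap b (z, 1)) = k' (z, 1)" using gq[OF u'] gid[OF u'] k'(3)[OF u] by simp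
      then have "vmap b (z, 1) = (z, 1)" using K_inj[OF k'(1)] u by (simp add: vmap_uhs)
      then show ?thesis by (simp add: vmap_def)
    qed
    then show "b = id" by (simp add: fun_eq_iff)
  qed
  then show ?thesis using rigid[OF k x(1)] x(3) free_c kx that by metis
qed

section \<open>The Dirichlet domain: covering, disjointness and local finiteness\<close>

definition F :: "'v set" where
  "F = {z. \<forall>a\<in>A. dist z c \<le> dist z (a c)}"

definition P :: "('v \<times> real) set" where
  "P = {p \<in> outside. fst p \<in> F}"

definition Pint :: "('v \<times> real) set" where
  "Pint = {p \<in> outside_open. \<forall>a\<in>A - {id}. dist (fst p) c < dist (fst p) (a c)}"

lemma F_bounded:
  obtains R where "R \<ge> 0" "F \<subseteq> cball c R"
    "\<And>z. \<exists>l\<in>L. dist (z - c) l \<le> R"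
proof -
  obtain R where R: "R \<ge> 0" "\<And>z. \<exists>x\<in>L. dist z x \<le> R" using covering by blast
  have "dist c z \<le> R" if "z \<in> F" for z
  proof -
    obtain l where l: "l \<in> L" "dist (z - c) l \<le> R" using R(2) by blast
    have "dist z c \<le> dist z (c + l)" using that A_trans[OF l(1)] by (auto simp: F_def)
    also have "\<dots> = dist (z - c) l" by (simp add: dist_norm algebra_simps)
    finally show ?thesis using l by (simp add: dist_commute)
  qed
  then show ?thesis using that[of R] R by (simp add: subset_iff)
qed

lemma to_F: "\<exists>a\<in>A. a z \<in> F"
proof -
  let ?T = "{a \<in> A. dist (a z) c \<le> dist z c}"
  have "finite ?T" by (rule A_finite)
  moreover have "id \<in> ?T" using A.id by simp
  ultimately obtain a where a: "a \<in> ?T" "\<And>b. b \<in> ?T \<Longrightarrow> dist (a z) c \<le> dist (b z) c"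
    using finite_min[of ?T "\<lambda>a. dist (a z) c"] by blast
  have min: "dist (a z) c \<le> dist (b z) c" if "b \<in> A" for b
    using a that by (cases "b \<in> ?T") force+
  have "dist (a z) c \<le> dist (a z) (b c)" if b: "b \<in> A" for b
  proof -
    obtain b' where b': "b' \<in> A" "b \<circ> b' = id" "b' \<circ> b = id" using A_inverse b by blast
    have "dist (a z) (b c) = dist ((b' \<circ> a) z) ((b' \<circ> b) c)" using A_dist[OF b'(1)] by simp
    also have "\<dots> = dist ((b' \<circ> a) z) c" using b'(3) by simp
    finally show ?thesis using min[of "b' \<circ> a"] A_comp b' a by auto
  qed
  then show ?thesis using a by (auto simp: F_def)
qed

text \<open>The orbit has finitely many heights above that of \<open>p\<close>, by
  \<open>finite_null\<close>, so some orbit point is highest. It lies outside the unit balls, since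
  an inversion centred at distance less than 1 would raise it.\<close>

lemma to_outside:
  assumes p: "p \<in> uhs"
  shows "\<exists>g\<in>K. g p \<in> outside"
proof -
  let ?H = "{s. s \<ge> snd p \<and> (\<exists>g\<in>K. s = snd (g p))}"
  let ?X = "{y \<in> Zlat. mform y y = 0 \<and> (\<exists>q\<in>uhs. norm (fst q) \<le> norm (fst p) \<and> snd p \<le> snd q \<and> snd q \<le> snd p \<and>
    0 < - mform (hyp q) y \<and> - mform (hyp q) y \<le> 1 / snd p)}"
  have t: "snd p > 0" using uhsD[OF p] .
  have "?H \<subseteq> (\<lambda>y. - 1 / mform (hyp p) y) ` ?X"
  proof clarify
    fix g assume g: "g \<in> K" "snd p \<le> snd (g p)"
    obtain y where y: "y \<in> Zlat" "mform y y = 0" "\<And>p. p \<in> uhs \<Longrightarrow> - 1 / snd (g p) = mform (hyp p) y"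
      using dual_vector[OF g(1)] by blast
    have m: "- mform (hyp p) y = 1 / snd (g p)" using y(3)[OF p] by simp
    then have "0 < - mform (hyp p) y" "- mform (hyp p) y \<le> 1 / snd p"
      using t g(2) by (auto simp: frac_le)
    then have "y \<in> ?X" using y p by blast
    moreover have "snd (g p) = - 1 / mform (hyp p) y" using m by (metis divide_divide_eq_right divide_minus_right div_by_1 minus_divide_left mult.left_neutral minus_minus)
    ultimately show "snd (g p) \<in> (\<lambda>y. - 1 / mform (hyp p) y) ` ?X" by blast
  qed
  moreover have "finite ?X" by (rule finite_null[OF t])
  ultimately have fin: "finite ?H" by (meson finite_imageI finite_subset)
  moreover have "snd p \<in> ?H" using K_one p by (auto intro!: bexI[of _ "\<lambda>p\<in>uhs. p"])
  ultimately have "Max ?H \<in> ?H" by (intro Max_in) auto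
  then obtain g where g: "g \<in> K" "snd (g p) = Max ?H" "snd (g p) \<ge> snd p" by auto
  have gu: "g p \<in> uhs" using K_uhs g p by blast
  have "dist (g p) (\<alpha>, 0) \<ge> 1" if "\<alpha> \<in> L" for \<alpha>
  proof (rule ccontr)
    assume n: "\<not> ?thesis"
    have d: "dist (g p) (\<alpha>, 0) > 0" using uhsD[OF gu] by auto
    have "(dist (g p) (\<alpha>, 0))\<^sup>2 < 1" using n d by (simp add: abs_square_less_1)
    then have gt: "snd (inv_map \<alpha> (g p)) > snd (g p)"
      using uhsD[OF gu] d by (simp add: inv_map_uhs[OF gu] less_divide_eq)
    have k: "compose uhs (Inv \<alpha>) g \<in> K" by (intro K_comp Inv_K that g(1))
    have "compose uhs (Inv \<alpha>) g p = inv_map \<alpha> (g p)" using p gu by (simp add: compose_def Inv_def)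
    then have "snd (inv_map \<alpha> (g p)) = snd (compose uhs (Inv \<alpha>) g p)" by simp
    moreover have "snd p \<le> snd (inv_map \<alpha> (g p))" using gt g(3) by simp
    ultimately have "snd (inv_map \<alpha> (g p)) \<in> ?H" using k by blast
    then show False using Max_ge[OF fin] gt g(2) by fastforce
  qed
  then show ?thesis using g(1) gu by (auto simp: outside_def)
qed

lemma K_covers:
  assumes p: "p \<in> uhs"
  shows "\<exists>g\<in>K. g p \<in> P"
proof -
  obtain g where g: "g \<in> K" "g p \<in> outside" using to_outside[OF p] by blast
  obtain a where a: "a \<in> A" "a (fst (g p)) \<in> F" using to_F by blast
  have "compose uhs (Vert a) g p = vmap a (g p)"
    using p K_uhs[OF g(1) p] by (simp add: compose_def Vert_def)
  moreover have "vmap a (g p) \<in> P" using a g outside_vmap(1)[OF a(1)] by (simp add: P_def)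
  ultimately show ?thesis using K_comp[OF Vert_K[OF a(1)] g(1)] by metis
qed

lemma Pint_free:
  assumes "p \<in> Pint"
  shows "free (fst p)"
  unfolding free_def
proof (intro ballI impI, rule ccontr)
  fix a assume a: "a \<in> A" "a (fst p) = fst p" "a \<noteq> id"
  have "dist (fst p) (a c) = dist (fst p) c" using A_dist[OF a(1), of "fst p" c] a(2) by simp
  moreover have "dist (fst p) c < dist (fst p) (a c)" using assms a(1,3) by (simp add: Pint_def)
  ultimately show False by simp
qed

text \<open>\<open>rigid\<close> reduces the claim to vertical maps. There the strict Dirichlet
  inequalities at \<open>p\<close> and at its image, taken with \<open>b\<close> inverse and with
  \<open>b\<close>, contradict each other.\<close>

lemma Pint_disjoint:
  assumes g: "g \<in> K" and p: "p \<in> Pint" and gp: "g p \<in> Pint"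
  shows "g = (\<lambda>p\<in>uhs. p)"
proof -
  have o: "p \<in> outside_open" "g p \<in> outside_open" using p gp by (auto simp: Pint_def)
  have pu: "p \<in> uhs" using o by (simp add: outside_open_def)
  obtain b where b: "b \<in> A" "\<And>q. q \<in> uhs \<Longrightarrow> g q = vmap b q"
    using rigid[OF g o(1) Pint_free[OF p] o(2) Pint_free[OF gp]] by metis
  have "b = id"
  proof (rule ccontr)
    assume n: "b \<noteq> id"
    obtain b' where b': "b' \<in> A" "b \<circ> b' = id" "b' \<circ> b = id" using A_inverse b by blast
    have n': "b' \<noteq> id" using n b' by auto
    have eq: "fst (g p) = b (fst p)" using b(2)[OF pu] by simp
    have "dist (fst p) c < dist (fst p) (b' c)" using p b' n' by (auto simp: Pint_def)
    also have "\<dots> = dist (b (fst p)) ((b \<circ> b') c)" using A_dist[OF b(1)] by simp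
    also have "\<dots> = dist (fst (g p)) c" using b'(2) eq by simp
    also have "\<dots> < dist (fst (g p)) (b c)" using gp b n by (auto simp: Pint_def)
    also have "\<dots> = dist (fst p) c" using A_dist[OF b(1)] eq by simp
    finally show False by simp
  qed
  then show ?thesis using b(2) by (intro K_ext[OF g K_one]) simp
qed

text \<open>Sort the maps \<open>h\<close> that carry a point of a small ball into \<open>P\<close>
  by their dual vectors. There are finitely many of these, and maps with the same dual vector differ
  by an element of \<open>A\<close>, restricted to finitely many because \<open>F\<close> is
  bounded.\<close>

lemma locally_finite_P:
  assumes q0: "q0 \<in> uhs"
  obtains U where "open U" "q0 \<in> U" "U \<subseteq> uhs" "finite {h \<in> K. \<exists>q\<in>U. h q \<in> P}"
proof -
  define t where "t = snd q0"
  have t: "t > 0" using uhsD[OF q0] by (simp add: t_def)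
  define U where "U = ball q0 (t / 2)"
  have Uq: "t / 2 \<le> snd q \<and> snd q \<le> 3 * t / 2 \<and> norm (fst q) \<le> norm (fst q0) + t / 2" if "q \<in> cball q0 (t / 2)" for q
  proof -
    have d: "dist q0 q \<le> t / 2" using that by simp
    have "dist (snd q0) (snd q) \<le> t / 2" using dist_snd_le[of q0 q] d by simp
    moreover have "dist (fst q0) (fst q) \<le> t / 2" using dist_fst_le[of q0 q] d by simp
    moreover have "norm (fst q) \<le> norm (fst q0) + dist (fst q0) (fst q)"
      by (metis dist_commute dist_norm norm_triangle_sub)
    ultimately show ?thesis unfolding dist_real_def t_def by linarith
  qed
  have cu: "cball q0 (t / 2) \<subseteq> uhs" using Uq t by (fastforce simp: uhs_def)
  have Uc: "U \<subseteq> cball q0 (t / 2)" by (auto simp: U_def)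
  define K' where "K' = {h \<in> K. \<exists>q\<in>U. h q \<in> P}"
  let ?X = "{y \<in> Zlat. mform y y = 0 \<and> (\<exists>p\<in>uhs. norm (fst p) \<le> norm (fst q0) + t / 2 \<and> t / 2 \<le> snd p \<and> snd p \<le> 3 * t / 2 \<and>
    0 < - mform (hyp p) y \<and> - mform (hyp p) y \<le> 2 / t)}"
  have "\<exists>y. y \<in> Zlat \<and> mform y y = 0 \<and> (\<forall>p\<in>uhs. - 1 / snd (h p) = mform (hyp p) y)" if hK: "h \<in> K" for h
  proof -
    obtain y where "y \<in> Zlat" "mform y y = 0" "\<And>p. p \<in> uhs \<Longrightarrow> - 1 / snd (h p) = mform (hyp p) y"
      using dual_vector[OF hK] by blast
    then show ?thesis by (intro exI[of _ y]) simp
  qed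
  then have "\<forall>h\<in>K. \<exists>y. y \<in> Zlat \<and> mform y y = 0 \<and> (\<forall>p\<in>uhs. - 1 / snd (h p) = mform (hyp p) y)"
    by blast
  from bchoice[OF this] obtain Y where "\<forall>h\<in>K. Y h \<in> Zlat \<and> mform (Y h) (Y h) = 0 \<and>
    (\<forall>p\<in>uhs. - 1 / snd (h p) = mform (hyp p) (Y h))" ..
  then have Y: "\<And>h. h \<in> K \<Longrightarrow> Y h \<in> Zlat \<and> mform (Y h) (Y h) = 0 \<and>
    (\<forall>p\<in>uhs. - 1 / snd (h p) = mform (hyp p) (Y h))" by (rule bspec)
  have "Y ` K' \<subseteq> ?X"
  proof
    fix y assume "y \<in> Y ` K'"
    then obtain h where h: "h \<in> K" "y = Y h" and "\<exists>q\<in>U. h q \<in> P" by (auto simp: K'_def)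
    then obtain q where q: "q \<in> U" "h q \<in> P" by blast
    have qu: "q \<in> uhs" "q \<in> cball q0 (t / 2)" using q Uc cu by auto
    obtain h' where h': "h' \<in> K" "\<And>p. p \<in> uhs \<Longrightarrow> h' (h p) = p" "\<And>p. p \<in> uhs \<Longrightarrow> h (h' p) = p"
      using K_inverse[OF h(1)] by blast
    \<comment> \<open>Points of \<open>P\<close> are the highest of their orbits, so
      \<open>h q\<close> is at least as high as \<open>q\<close>; this gives the upper bound
      required by \<open>finite_null\<close>.\<close>
    have "snd (h' (h q)) \<le> snd (h q)" using q(2) h'(1) by (intro height_max) (auto simp: P_def)
    then have le: "t / 2 \<le> snd (h q)" using h'(2)[OF qu(1)] Uq[OF qu(2)] by simp
    have "- 1 / snd (h q) = mform (hyp q) y" using bspec[OF conjunct2[OF conjunct2[OF Y[OF h(1)]]] qu(1)] by (simp only: h(2))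
    then have eq: "- mform (hyp q) y = 1 / snd (h q)" by (simp flip: minus_divide_left)
    have "0 < - mform (hyp q) y \<and> - mform (hyp q) y \<le> 2 / t"
      unfolding eq using le t frac_le[of 1 1 "t / 2" "snd (h q)"] by simp
    moreover have "y \<in> Zlat" "mform y y = 0" using Y[OF h(1)] by (simp_all only: h(2))
    ultimately show "y \<in> ?X" using qu(1) Uq[OF qu(2)] by blast
  qed
  moreover have "finite ?X" using t by (intro finite_null) simp
  ultimately have finY: "finite (Y ` K')" by (rule finite_subset)
  obtain R where R: "F \<subseteq> cball c R" using F_bounded by metis
  have fib: "finite {h \<in> K'. Y h = y}" for y
  proof (cases "{h \<in> K'. Y h = y} = {}")
    case False
    then obtain h0 where h0: "h0 \<in> K" "Y h0 = y" by (auto simp: K'_def)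
    have "compact (h0 ` cball q0 (t / 2))"
      using K_continuous[OF h0(1)] cu by (intro compact_continuous_image compact_cball) (rule continuous_on_subset)
    then have "bounded (h0 ` cball q0 (t / 2))" by (rule compact_imp_bounded)
    then obtain D where D: "\<And>q. q \<in> cball q0 (t / 2) \<Longrightarrow> dist (h0 q0) (h0 q) \<le> D"
      using bounded_any_center[of "h0 ` cball q0 (t / 2)" "h0 q0"] by blast
    obtain h0' where h0': "h0' \<in> K" "\<And>p. p \<in> uhs \<Longrightarrow> h0' (h0 p) = p" "\<And>p. p \<in> uhs \<Longrightarrow> h0 (h0' p) = p"
      using K_inverse[OF h0(1)] by blast
    have "{h \<in> K'. Y h = y} \<subseteq> (\<lambda>b. compose uhs (Vert b) h0) ` {b \<in> A. dist (b (fst (h0 q0))) c \<le> D + R}"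
    proof
      fix h assume "h \<in> {h \<in> K'. Y h = y}"
      then have h: "h \<in> K" "Y h = y" and "\<exists>q\<in>U. h q \<in> P" by (auto simp: K'_def)
      then obtain q where q: "q \<in> U" "h q \<in> P" by blast
      have qu: "q \<in> uhs" "q \<in> cball q0 (t / 2)" using q Uc cu by auto
      define k where "k = compose uhs h h0'"
      have kK: "k \<in> K" unfolding k_def by (intro K_comp h(1) h0'(1))
      \<comment> \<open>The dual vector determines the height after applying \<open>h\<close>, so
        maps with equal dual vectors differ by a height-preserving one, to which
        \<open>stabiliser\<close> applies.\<close>
      have "snd (k p) = snd p" if p: "p \<in> uhs" for p
      proof -
        have u: "h0' p \<in> uhs" using K_uhs[OF h0'(1) p] .
        have "- 1 / snd (h (h0' p)) = - 1 / snd (h0 (h0' p))"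
          using Y[OF h(1)] Y[OF h0(1)] h(2) h0(2) u by simp
        then show ?thesis using h0'(3)[OF p] p by (simp add: k_def compose_def)
      qed
      then obtain b where b: "b \<in> A" "\<And>q. q \<in> uhs \<Longrightarrow> k q = vmap b q" using stabiliser[OF kK] by metis
      have hb: "h p = vmap b (h0 p)" if p: "p \<in> uhs" for p
        using b(2)[OF K_uhs[OF h0(1) p]] h0'(2)[OF p] K_uhs[OF h0(1) p] by (simp add: k_def compose_def)
      have "h = compose uhs (Vert b) h0"
        using hb K_uhs[OF h0(1)] K_comp[OF Vert_K[OF b(1)] h0(1)]
        by (intro K_ext[OF h(1)]) (auto simp: compose_def Vert_def)
      \<comment> \<open>\<open>D\<close> bounds the spread of \<open>h0\<close> over the closed ball
        and \<open>R\<close> is the radius of \<open>F\<close>.\<close>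
      moreover have "dist (b (fst (h0 q0))) c \<le> D + R"
      proof -
        have "fst (h q) \<in> F" using q by (simp add: P_def)
        then have "dist (b (fst (h0 q))) c \<le> R" using R hb[OF qu(1)] by (auto simp: dist_commute)
        moreover have "dist (b (fst (h0 q0))) (b (fst (h0 q))) \<le> D"
          using D[OF qu(2)] dist_fst_le[of "h0 q0" "h0 q"] A_dist[OF b(1)] by simp
        ultimately show ?thesis by (metis add_mono dist_triangle order_trans)
      qed
      ultimately show "h \<in> (\<lambda>b. compose uhs (Vert b) h0) ` {b \<in> A. dist (b (fst (h0 q0))) c \<le> D + R}"
        using b(1) by blast
    qed
    then show ?thesis using A_finite finite_subset by blast
  next
    case True
    then show ?thesis by (simp only: finite.emptyI)
  qed
  have "K' = (\<Union>y\<in>Y ` K'. {h \<in> K'. Y h = y})" by auto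
  moreover have "finite (\<Union>y\<in>Y ` K'. {h \<in> K'. Y h = y})" using finY fib by blast
  ultimately have "finite K'" by simp
  moreover have "U \<subseteq> uhs" using Uc cu by blast
  ultimately show ?thesis using that[of U] t by (simp add: U_def K'_def)
qed

end

section \<open>The fundamental polyhedron\<close>

lemma dist_inv_map:
  assumes "p \<in> uhs"
  shows "dist (inv_map \<alpha> p) (\<alpha>, 0) = 1 / dist p (\<alpha>, 0)"
proof -
  have "norm (p - (\<alpha>, 0)) > 0" using assms by (auto simp: uhs_def)
  then show ?thesis
    by (simp add: inv_map_def dist_norm power2_norm_eq_inner[symmetric] power2_eq_square)
qed

lemma inv_map_fixed: "dist p (\<alpha>, 0) = 1 \<Longrightarrow> inv_map \<alpha> p = p"
  by (simp add: inv_map_def dist_norm power2_norm_eq_inner[symmetric])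

context based_lattice
begin

text \<open>The vertical bisector of \<open>c\<close> and \<open>a c\<close>, with \<open>c\<close>
  on the positive side. Its norm is positive but not normalised to 2, which is why polyhedra are
  developed for arbitrary vectors of positive norm.\<close>

definition vroot :: "('v \<Rightarrow> 'v) \<Rightarrow> real \<times> 'v \<times> real" where
  "vroot a = proot (c - a c) (a c \<bullet> a c - c \<bullet> c)"

lemma side_vroot: "side (vroot a) p = ((dist (fst p) (a c))\<^sup>2 - (dist (fst p) c)\<^sup>2) / snd p"
proof -
  have "(dist z (a c))\<^sup>2 - (dist z c)\<^sup>2 = val (c - a c) (a c \<bullet> a c - c \<bullet> c) z" for z
    by (simp add: val_def dist_norm power2_norm_eq_inner inner_diff_left inner_diff_right inner_commute)
  then show ?thesis by (simp add: vroot_def side_proot)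
qed

lemma side_vroot_sign:
  assumes "p \<in> uhs"
  shows "side (vroot a) p \<ge> 0 \<longleftrightarrow> dist (fst p) c \<le> dist (fst p) (a c)"
    "side (vroot a) p > 0 \<longleftrightarrow> dist (fst p) c < dist (fst p) (a c)"
    "side (vroot a) p = 0 \<longleftrightarrow> dist (fst p) c = dist (fst p) (a c)"
proof -
  have le: "x\<^sup>2 \<le> y\<^sup>2 \<longleftrightarrow> x \<le> y" if "x \<ge> 0" "y \<ge> 0" for x y :: real
    using abs_le_square_iff[of x y] that by simp
  then have lt: "x\<^sup>2 < y\<^sup>2 \<longleftrightarrow> x < y" if "x \<ge> 0" "y \<ge> 0" for x y :: real
    using that by (simp add: linorder_not_le[symmetric])
  show "side (vroot a) p \<ge> 0 \<longleftrightarrow> dist (fst p) c \<le> dist (fst p) (a c)"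
    "side (vroot a) p > 0 \<longleftrightarrow> dist (fst p) c < dist (fst p) (a c)"
    "side (vroot a) p = 0 \<longleftrightarrow> dist (fst p) c = dist (fst p) (a c)"
    using uhsD[OF assms] le lt
    by (auto simp: side_vroot zero_le_divide_iff zero_less_divide_iff)
qed

lemma mform_vroot: "a \<in> A \<Longrightarrow> a \<noteq> id \<Longrightarrow> mform (vroot a) (vroot a) > 0"
  using free_c by (auto simp: vroot_def mform_proot free_def)

text \<open>The selected finite set of bisectors must by itself confine a point to a ball about
  \<open>c\<close>; only then can the remaining bisectors and hemispheres be discarded as too far
  away.\<close>

lemma polyhedron:
  obtains N where "finite N" "\<And>n. n \<in> N \<Longrightarrow> mform n n > 0" "P = polyh N" "Pint = polyh_open N"
    "N \<subseteq> vroot ` (A - {id}) \<union> sroot ` L"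
proof -
  obtain R where R: "R \<ge> 0" "F \<subseteq> cball c R" "\<And>z. \<exists>l\<in>L. dist (z - c) l \<le> R" using F_bounded by metis
  \<comment> \<open>The bisectors in \<open>A0\<close> force distance less than \<open>R + 1\<close>
    from \<open>c\<close>. Within that distance an orbit point of \<open>c\<close> more than
    \<open>2 * R + 2\<close> away, or a hemisphere centred more than \<open>R + 2\<close> away,
    imposes a condition that holds strictly.\<close>
  define A0 where "A0 = {a \<in> A. dist (a c) c \<le> 2 * R + 2} - {id}"
  define L0 where "L0 = {\<alpha> \<in> L. dist \<alpha> c \<le> R + 2}"
  define N where "N = vroot ` A0 \<union> sroot ` L0"
  have fin: "finite N" using A_finite finite_cball by (simp add: N_def A0_def L0_def)
  have bd: "dist z c < R + 1" if z: "\<forall>a\<in>A0. dist z c \<le> dist z (a c)" for z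
  proof (rule ccontr)
    assume n: "\<not> ?thesis"
    define s where "s = dist z c"
    have s1: "s \<ge> R + 1" using n by (simp add: s_def)
    have s2: "s > 0" using s1 R(1) by linarith
    have s3: "s = norm (z - c)" by (simp add: s_def dist_norm)
    note s = s1 s2 s3
    \<comment> \<open>The point at distance \<open>R + 1\<close> from \<open>c\<close> on the way to
      \<open>z\<close>. Some translate \<open>c + l\<close> lies within \<open>R\<close> of it,
      hence is closer to \<open>z\<close> than \<open>c\<close> is, and still lies within
      \<open>2 * R + 1\<close> of \<open>c\<close>.\<close>
    define w where "w = c + ((R + 1) / s) *\<^sub>R (z - c)"
    have zc: "z \<noteq> c" using s(2,3) by auto
    have zw: "dist z w = s - (R + 1)"
    proof -
      have "z - w = (1 - (R + 1) / s) *\<^sub>R (z - c)" by (simp add: w_def algebra_simps)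
      then have "dist z w = \<bar>1 - (R + 1) / s\<bar> * s" using s by (simp add: dist_norm)
      also have "\<dots> = (1 - (R + 1) / s) * s" using s by simp
      finally show ?thesis using s2 by (simp add: left_diff_distrib)
    qed
    obtain l where l: "l \<in> L" "dist (w - c) l \<le> R" using R(3) by blast
    have wl: "dist w (c + l) \<le> R" using l by (simp add: dist_norm algebra_simps)
    have lt: "dist z (c + l) < s" using dist_triangle[of z "c + l" w] zw wl by simp
    have wc: "dist w c = R + 1" using s R(1) zc by (simp add: w_def dist_norm)
    have "dist (c + l) c \<le> 2 * R + 1"
      using dist_triangle[of "c + l" c w] wl wc by (simp add: dist_commute)
    moreover have "(\<lambda>z. z + l) \<noteq> id"
    proof
      assume "(\<lambda>z. z + l) = id"
      then have "c + l = c" by (metis id_apply)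
      then show False using lt by (simp add: s_def)
    qed
    ultimately have "(\<lambda>z. z + l) \<in> A0" using A_trans[OF l(1)] by (simp add: A0_def)
    then have "s \<le> dist z (c + l)" using z by (auto simp: s_def)
    then show False using lt by simp
  qed
  have far: "dist z c < dist z (a c)" if z: "dist z c < R + 1" and a: "a \<in> A" "a \<noteq> id" "a \<notin> A0" for z a
  proof -
    have "dist (a c) c > 2 * R + 2" using a by (auto simp: A0_def)
    then show ?thesis using z dist_triangle[of "a c" c z] by (simp add: dist_commute)
  qed
  have farL: "dist p (\<alpha>, 0) > 1" if z: "dist (fst p) c < R + 1" and a: "\<alpha> \<in> L" "\<alpha> \<notin> L0" for p :: "'v \<times> real" and \<alpha>
  proof -
    have "dist \<alpha> c > R + 2" using a by (auto simp: L0_def)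
    then have "dist (fst p) \<alpha> > 1" using z dist_triangle[of \<alpha> c "fst p"] by (simp add: dist_commute)
    then show ?thesis using dist_fst_le[of p "(\<alpha>, 0)"] by simp
  qed
  have "p \<in> P \<longleftrightarrow> p \<in> polyh N" for p
  proof (cases "p \<in> uhs")
    case True
    have 1: "p \<in> polyh N \<longleftrightarrow> (\<forall>a\<in>A0. dist (fst p) c \<le> dist (fst p) (a c)) \<and> (\<forall>\<alpha>\<in>L0. dist p (\<alpha>, 0) \<ge> 1)"
      using True side_vroot_sign[OF True] side_sroot_sign[OF True]
      by (simp add: polyh_def N_def ball_Un del: split_paired_All)
    have 2: "p \<in> P \<longleftrightarrow> (\<forall>a\<in>A. dist (fst p) c \<le> dist (fst p) (a c)) \<and> (\<forall>\<alpha>\<in>L. dist p (\<alpha>, 0) \<ge> 1)"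
      using True by (auto simp: P_def outside_def F_def)
    show ?thesis
    proof
      assume "p \<in> P"
      then show "p \<in> polyh N" unfolding 1 2 by (auto simp: A0_def L0_def)
    next
      assume p: "p \<in> polyh N"
      then have b: "dist (fst p) c < R + 1" using bd 1 by blast
      have "dist (fst p) c \<le> dist (fst p) (a c)" if "a \<in> A" for a
        using far[OF b that] p 1 by (cases "a = id"; cases "a \<in> A0") auto
      moreover have "dist p (\<alpha>, 0) \<ge> 1" if "\<alpha> \<in> L" for \<alpha>
        using farL[OF b that] p 1 by (cases "\<alpha> \<in> L0") auto
      ultimately show "p \<in> P" unfolding 2 by blast
    qed
  qed (auto simp: P_def outside_def polyh_def)
  then have "P = polyh N" by blast
  moreover have "p \<in> Pint \<longleftrightarrow> p \<in> polyh_open N" for p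
  proof (cases "p \<in> uhs")
    case True
    have 1: "p \<in> polyh_open N \<longleftrightarrow> (\<forall>a\<in>A0. dist (fst p) c < dist (fst p) (a c)) \<and> (\<forall>\<alpha>\<in>L0. dist p (\<alpha>, 0) > 1)"
      using True side_vroot_sign[OF True] side_sroot_sign[OF True]
      by (simp add: polyh_open_def N_def ball_Un del: split_paired_All)
    have 2: "p \<in> Pint \<longleftrightarrow> (\<forall>a\<in>A - {id}. dist (fst p) c < dist (fst p) (a c)) \<and> (\<forall>\<alpha>\<in>L. dist p (\<alpha>, 0) > 1)"
      using True by (auto simp: Pint_def outside_open_def)
    show ?thesis
    proof
      assume "p \<in> Pint"
      then show "p \<in> polyh_open N" unfolding 1 2 by (auto simp: A0_def L0_def)
    next
      assume p: "p \<in> polyh_open N"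
      then have b: "dist (fst p) c < R + 1" using bd 1 by (simp add: less_imp_le)
      have "dist (fst p) c < dist (fst p) (a c)" if "a \<in> A - {id}" for a
        using far[OF b] that p 1 by (cases "a \<in> A0") auto
      moreover have "dist p (\<alpha>, 0) > 1" if "\<alpha> \<in> L" for \<alpha>
        using farL[OF b that] p 1 by (cases "\<alpha> \<in> L0") auto
      ultimately show "p \<in> Pint" unfolding 2 by blast
    qed
  qed (auto simp: Pint_def outside_open_def polyh_open_def)
  then have "Pint = polyh_open N" by blast
  moreover have "mform n n > 0" if "n \<in> N" for n
    using that mform_vroot by (auto simp: N_def A0_def)
  ultimately show ?thesis using that[of N] fin by (auto simp: N_def A0_def L0_def)
qed

lemma interior_P: "interior P = Pint"
  and closedin_P: "closedin (top_of_set uhs) P"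
  and convex_P: "hyp_convex P"
  and finite_sides_P: "finite (sides P)"
  and open_Pint: "open Pint"
proof -
  obtain N where N: "finite N" "\<And>n. n \<in> N \<Longrightarrow> mform n n > 0" "P = polyh N" "Pint = polyh_open N"
    using polyhedron by metis
  show "interior P = Pint" "closedin (top_of_set uhs) P" "hyp_convex P" "open Pint"
    using interior_polyh[OF N(1,2)] closedin_polyh hyp_convex_polyh open_polyh_open[OF N(1)] by (simp_all add: N(3,4))
  show "finite (sides P)" using finite_subset[OF sides_polyh[OF N(1,2)]] N by simp
qed

lemma P_uhs: "P \<subseteq> uhs"
  by (auto simp: P_def outside_def)

lemma Pint_P: "Pint \<subseteq> P"
  using interior_P interior_subset by blast

text \<open>At a point equidistant from \<open>c\<close> and \<open>a c\<close>, both are nearest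
  orbit points; pulling back by \<open>a\<close> turns the latter into \<open>c\<close>, so the
  preimage is again over \<open>F\<close>.\<close>

lemma wall_vertical:
  assumes a: "a \<in> A"
  shows "{p \<in> P. side (vroot a) p = 0} = P \<inter> Vert a ` P"
proof -
  obtain b where b: "b \<in> A" "a \<circ> b = id" "b \<circ> a = id" using A_inverse a by blast
  show ?thesis
  proof (intro equalityI subsetI)
    fix p assume p: "p \<in> {p \<in> P. side (vroot a) p = 0}"
    then have pu: "p \<in> uhs" using P_uhs by auto
    have eq: "dist (fst p) c = dist (fst p) (a c)" using side_vroot_sign(3)[OF pu] p by simp
    have ba: "b (a x) = x" for x using b(3) by (metis comp_apply id_apply)
    have "dist (b (fst p)) c \<le> dist (b (fst p)) (a' c)" if "a' \<in> A" for a'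
    proof -
      have "dist (b (fst p)) c = dist ((a \<circ> b) (fst p)) (a c)" using A_dist[OF a] by simp
      also have "\<dots> = dist (fst p) c" using b eq by simp
      also have "\<dots> \<le> dist (fst p) ((a \<circ> a') c)" using p A_comp[OF a that] by (auto simp: P_def F_def)
      also have "\<dots> = dist ((b \<circ> a) (b (fst p))) ((b \<circ> a) (a' c))"
        using A_dist[OF b(1), of "fst p" "(a \<circ> a') c"] ba by simp
      finally show ?thesis using ba by simp
    qed
    then have q: "vmap b p \<in> P"
      using p outside_vmap(1)[OF b(1)] by (auto simp: P_def F_def)
    moreover have "p = Vert a (vmap b p)"
      using pu b(2) by (simp add: Vert_def vmap_uhs vmap_comp)
    ultimately show "p \<in> P \<inter> Vert a ` P" using p by blast
  next
    fix p assume p: "p \<in> P \<inter> Vert a ` P"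
    then obtain q where q: "q \<in> P" "p = Vert a q" by blast
    have pu: "p \<in> uhs" "q \<in> uhs" using p q P_uhs by auto
    have z: "fst p = a (fst q)" using q pu by (simp add: Vert_def)
    have "dist (fst p) (a c) = dist (fst q) c" using A_dist[OF a] z by simp
    also have "\<dots> \<le> dist (fst q) (b c)" using q b(1) by (auto simp: P_def F_def)
    also have "\<dots> = dist (fst p) ((a \<circ> b) c)" using A_dist[OF a] z by simp
    finally have "dist (fst p) (a c) \<le> dist (fst p) c" using b by simp
    moreover have "dist (fst p) c \<le> dist (fst p) (a c)" using p a by (auto simp: P_def F_def)
    ultimately show "p \<in> {p \<in> P. side (vroot a) p = 0}"
      using p side_vroot_sign(3)[OF pu(1)] by simp
  qed
qed

text \<open>The inversion fixes its sphere pointwise. Conversely it inverts the distance to the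
  centre, and both \<open>p\<close> and its preimage have distance at least 1.\<close>

lemma wall_sphere:
  assumes \<alpha>: "\<alpha> \<in> L"
  shows "{p \<in> P. side (sroot \<alpha>) p = 0} = P \<inter> Inv \<alpha> ` P"
proof (intro equalityI subsetI)
  fix p assume p: "p \<in> {p \<in> P. side (sroot \<alpha>) p = 0}"
  then have pu: "p \<in> uhs" using P_uhs by auto
  have "(dist p (\<alpha>, 0))\<^sup>2 = 1" using p side_sroot[OF pu, of \<alpha>] uhsD[OF pu] by simp
  then have "dist p (\<alpha>, 0) = 1" using zero_le_dist[of p "(\<alpha>, 0)"] by (metis abs_of_nonneg abs_square_eq_1)
  then have "Inv \<alpha> p = p" using pu by (simp add: Inv_def inv_map_fixed)
  moreover have "p \<in> P" using p by simp
  ultimately show "p \<in> P \<inter> Inv \<alpha> ` P" using image_eqI[of p "Inv \<alpha>" p P] by simp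
next
  fix p assume p: "p \<in> P \<inter> Inv \<alpha> ` P"
  then obtain q where q: "q \<in> P" "p = Inv \<alpha> q" by blast
  have pu: "p \<in> uhs" "q \<in> uhs" using p q P_uhs by auto
  have "dist p (\<alpha>, 0) = 1 / dist q (\<alpha>, 0)" using q pu dist_inv_map[OF pu(2)] by (simp add: Inv_def)
  moreover have "dist p (\<alpha>, 0) \<ge> 1" "dist q (\<alpha>, 0) \<ge> 1" using p q \<alpha> by (auto simp: P_def outside_def)
  ultimately have "dist p (\<alpha>, 0) = 1" by (simp add: le_divide_eq split: if_splits)
  then show "p \<in> {p \<in> P. side (sroot \<alpha>) p = 0}" using p side_sroot[OF pu(1)] by simp
qed

theorem exact_P: "exact_polyhedron K P"
  unfolding exact_polyhedron_def
proof
  fix C assume C: "C \<in> sides P"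
  obtain N where N: "finite N" "\<And>n. n \<in> N \<Longrightarrow> mform n n > 0" "P = polyh N"
    "N \<subseteq> vroot ` (A - {id}) \<union> sroot ` L"
    using polyhedron by metis
  have "C \<in> (\<lambda>n. {p \<in> P. side n p = 0}) ` N" using sides_polyh[OF N(1,2)] C N(3) by auto
  then obtain n where n: "n \<in> N" "C = {p \<in> P. side n p = 0}" by blast
  then consider a where "a \<in> A" "n = vroot a" | \<alpha> where "\<alpha> \<in> L" "n = sroot \<alpha>" using N(4) by blast
  then show "\<exists>f\<in>K. C = P \<inter> f ` P"
  proof cases
    case 1
    then show ?thesis using wall_vertical n Vert_K by blast
  next
    case 2
    then show ?thesis using wall_sphere n Inv_K by blast
  qed
qed

text \<open>The difference of the two squared distances is affine in the point; it is nonnegative at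
  \<open>z\<close> and positive at \<open>c\<close>.\<close>

lemma F_star:
  assumes "z \<in> F" "0 < s" "s \<le> 1" "a \<in> A" "a \<noteq> id"
  shows "dist ((1 - s) *\<^sub>R z + s *\<^sub>R c) c < dist ((1 - s) *\<^sub>R z + s *\<^sub>R c) (a c)"
proof -
  define f where "f z = (dist z (a c))\<^sup>2 - (dist z c)\<^sup>2" for z
  have f: "f z = val (c - a c) (a c \<bullet> a c - c \<bullet> c) z" for z
    by (simp add: f_def val_def dist_norm power2_norm_eq_inner inner_diff_left inner_diff_right inner_commute)
  have "f ((1 - s) *\<^sub>R z + s *\<^sub>R c) = (1 - s) * f z + s * f c"
    unfolding f by (simp add: val_def inner_add_left algebra_simps)
  moreover have "dist z c \<le> dist z (a c)" using assms by (auto simp: F_def)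
  then have "f z \<ge> 0" by (simp add: f_def power_mono)
  moreover have "f c > 0" using free_c assms(4,5) by (auto simp: f_def free_def)
  ultimately have "f ((1 - s) *\<^sub>R z + s *\<^sub>R c) > 0" using assms(2,3) by (simp add: add_nonneg_pos)
  then have "(dist ((1 - s) *\<^sub>R z + s *\<^sub>R c) c)\<^sup>2 < (dist ((1 - s) *\<^sub>R z + s *\<^sub>R c) (a c))\<^sup>2"
    by (simp add: f_def)
  then show ?thesis by (rule power_less_imp_less_base) simp
qed

text \<open>Points of \<open>P\<close> move into the interior along a path towards the axis over \<open>c\<close> that rises fast
  enough to leave all unit balls.\<close>

lemma push_interior:
  assumes p: "(z, t) \<in> P" and s: "0 < s" "s \<le> 1"
    and D: "D = dist z c"
  shows "((1 - s) *\<^sub>R z + s *\<^sub>R c, sqrt (t\<^sup>2 + s * (2 * (1 + D) * D + 1))) \<in> Pint"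
proof -
  define z' where "z' = (1 - s) *\<^sub>R z + s *\<^sub>R c"
  have D0: "D \<ge> 0" by (simp add: D)
  have t: "t > 0" using p P_uhs by (auto simp: uhs_def)
  \<comment> \<open>Moving by \<open>s\<close> towards \<open>c\<close> lowers the squared distance
    to a centre within reach by at most \<open>2 * s * (1 + D) * D\<close>, because such a centre is
    within \<open>1 + D\<close> of \<open>z\<close>. The height makes up for this, and the extra
    \<open>s\<close> gives strictness.\<close>
  define h where "h = t\<^sup>2 + s * (2 * (1 + D) * D + 1)"
  have h: "h > 0" unfolding h_def using t s D0 by (intro add_pos_nonneg) auto
  have zz: "z' - z = s *\<^sub>R (c - z)" by (simp add: z'_def algebra_simps)
  have zz': "dist z' z \<le> D" using s D0 by (simp add: dist_norm zz D norm_minus_commute mult_left_le_one_le)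
  have out: "dist (z', sqrt h) (\<alpha>, 0) > 1" if \<alpha>: "\<alpha> \<in> L" for \<alpha>
  proof -
    have d: "(dist (z', sqrt h) (\<alpha>, 0))\<^sup>2 = (dist z' \<alpha>)\<^sup>2 + h"
      using h by (simp add: dist_prod_def)
    have "(dist z' \<alpha>)\<^sup>2 + h > 1"
    proof (cases "dist z' \<alpha> > 1")
      case True
      then have "(dist z' \<alpha>)\<^sup>2 > 1" by (simp add: one_less_power)
      then show ?thesis using h by simp
    next
      case False
      have "dist (z, t) (\<alpha>, 0) \<ge> 1" using p \<alpha> by (auto simp: P_def outside_def)
      then have "(dist (z, t) (\<alpha>, 0))\<^sup>2 \<ge> 1" by (simp add: one_le_power)
      then have 1: "(dist z \<alpha>)\<^sup>2 + t\<^sup>2 \<ge> 1" by (simp add: dist_prod_def)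
      have "dist z \<alpha> \<le> 1 + D" using False zz' dist_triangle[of z \<alpha> z'] by (simp add: dist_commute)
      then have "norm (z - \<alpha>) * norm (c - z) \<le> (1 + D) * D"
        using D0 by (intro mult_mono) (auto simp: dist_norm D norm_minus_commute)
      then have "\<bar>(z - \<alpha>) \<bullet> (c - z)\<bar> \<le> (1 + D) * D"
        using Cauchy_Schwarz_ineq2[of "z - \<alpha>" "c - z"] by simp
      then have "- ((1 + D) * D) \<le> (z - \<alpha>) \<bullet> (c - z)" by simp
      then have 2: "s * (- ((1 + D) * D)) \<le> s * ((z - \<alpha>) \<bullet> (c - z))" using s by (intro mult_left_mono) auto
      have sq: "(x + s *\<^sub>R y) \<bullet> (x + s *\<^sub>R y) = x \<bullet> x + 2 * (s * (x \<bullet> y)) + (s * s) * (y \<bullet> y)" for x y :: 'v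
        by (simp add: inner_add_left inner_add_right inner_commute)
      have "z' - \<alpha> = (z - \<alpha>) + s *\<^sub>R (c - z)" using zz by (simp add: algebra_simps)
      then have "(dist z' \<alpha>)\<^sup>2 = (dist z \<alpha>)\<^sup>2 + 2 * (s * ((z - \<alpha>) \<bullet> (c - z))) + (s * s) * ((c - z) \<bullet> (c - z))"
        by (simp only: dist_norm power2_norm_eq_inner sq)
      moreover have "(s * s) * ((c - z) \<bullet> (c - z)) \<ge> 0" by simp
      ultimately have "(dist z' \<alpha>)\<^sup>2 \<ge> (dist z \<alpha>)\<^sup>2 - 2 * (s * ((1 + D) * D))" using 2 by linarith
      moreover have "h = t\<^sup>2 + 2 * (s * ((1 + D) * D)) + s" by (simp add: h_def algebra_simps)
      ultimately show ?thesis using 1 s by linarith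
    qed
    then show ?thesis using d by (metis power_one power_less_imp_less_base zero_le_dist)
  qed
  have "z \<in> F" using p by (simp add: P_def)
  then have "dist z' c < dist z' (a c)" if "a \<in> A - {id}" for a
    unfolding z'_def using F_star s that by blast
  then have "(z', sqrt h) \<in> Pint"
    using out h by (simp add: Pint_def outside_open_def uhs_iff)
  then show ?thesis unfolding z'_def h_def .
qed

lemma closure_Pint: "closure Pint \<inter> uhs = P"
proof
  obtain T where T: "closed T" "P = uhs \<inter> T" using closedin_P by (auto simp: closedin_closed)
  then have "closure Pint \<subseteq> T" using Pint_P by (intro closure_minimal) auto
  then show "closure Pint \<inter> uhs \<subseteq> P" using T(2) by auto
  have "p \<in> closure Pint" if p: "p \<in> P" for p
  proof -
    obtain z t where zt: "p = (z, t)" by (cases p)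
    have t: "t > 0" using p P_uhs by (auto simp: uhs_def zt)
    define D where "D = dist z c"
    \<comment> \<open>\<open>push_interior\<close> with \<open>s = 1 / (n + 1)\<close>, which tends
      to 0 and so returns to \<open>p\<close>.\<close>
    define f where "f n = ((1 - 1 / real (Suc n)) *\<^sub>R z + (1 / real (Suc n)) *\<^sub>R c,
      sqrt (t\<^sup>2 + 1 / real (Suc n) * (2 * (1 + D) * D + 1)))" for n
    have "f n \<in> Pint" for n
      unfolding f_def using p by (intro push_interior) (auto simp: zt D_def)
    moreover have "(\<lambda>n. 1 / real (Suc n)) \<longlonglongrightarrow> 0"
      by (rule LIMSEQ_Suc[OF lim_1_over_n])
    then have "f \<longlonglongrightarrow> ((1 - 0) *\<^sub>R z + 0 *\<^sub>R c, sqrt (t\<^sup>2 + 0 * (2 * (1 + D) * D + 1)))"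
      unfolding f_def by (intro tendsto_intros)
    then have "f \<longlonglongrightarrow> p" using t by (simp add: zt)
    ultimately show ?thesis unfolding closure_sequential by blast
  qed
  then show "P \<subseteq> closure Pint \<inter> uhs" using P_uhs by blast
qed

lemma base_Pint: "(c, t) \<in> Pint" if "t > 1"
proof -
  have "dist (c, t) (\<alpha>, 0) > 1" for \<alpha>
    using dist_snd_le[of "(c, t)" "(\<alpha>, 0)"] that by simp
  moreover have "c \<noteq> a c" if "a \<in> A - {id}" for a using free_c that by (auto simp: free_def)
  ultimately show ?thesis using that by (auto simp: Pint_def outside_open_def uhs_iff)
qed

text \<open>Every point of \<open>Pint\<close> is joined to the point \<open>(c, 2)\<close> by a vertical and then a horizontal segment.\<close>

lemma connected_Pint: "connected Pint"
proof -
  have "\<exists>S. connected S \<and> S \<subseteq> Pint \<and> p \<in> S \<and> (c, 2) \<in> S" if p: "p \<in> Pint" for p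
  proof -
    obtain z t where zt: "p = (z, t)" by (cases p)
    have t: "t > 0" and zo: "dist z c < dist z (a c)" if "a \<in> A - {id}" for a
      using p that by (auto simp: zt Pint_def outside_open_def uhs_iff)
    have tpos: "t > 0" using p by (auto simp: zt Pint_def outside_open_def uhs_iff)
    have zF: "z \<in> F" using p Pint_P by (auto simp: P_def zt)
    define T where "T = max t 2"
    define S1 where "S1 = Pair z ` {t..T}"
    define S2 where "S2 = (\<lambda>s. ((1 - s) *\<^sub>R z + s *\<^sub>R c, T)) ` {0..1}"
    define S3 where "S3 = Pair c ` {2..T}"
    have "connected S1" "connected S2" "connected S3"
      unfolding S1_def S2_def S3_def by (intro connected_continuous_image continuous_intros connected_Icc)+
    moreover have "(z, T) \<in> S1 \<inter> S2" using tpos by (force simp: S1_def S2_def T_def)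
    moreover have "(c, T) \<in> S2 \<inter> S3" by (auto simp: S2_def S3_def T_def intro!: image_eqI[of _ _ 1])
    ultimately have "connected (S1 \<union> S2 \<union> S3)" by (intro connected_Un) auto
    moreover have "S1 \<subseteq> Pint"
    proof
      fix q assume "q \<in> S1"
      then obtain t' where q: "q = (z, t')" "t \<le> t'" by (auto simp: S1_def)
      have "dist p (\<alpha>, 0) \<le> dist q (\<alpha>, 0)" for \<alpha>
        using q tpos by (auto simp: zt dist_prod_def intro!: power_mono)
      moreover have "dist p (\<alpha>, 0) > 1" if "\<alpha> \<in> L" for \<alpha> using p that by (auto simp: Pint_def outside_open_def)
      ultimately have "dist q (\<alpha>, 0) > 1" if "\<alpha> \<in> L" for \<alpha> using that less_le_trans by blast
      then show "q \<in> Pint" using zo q tpos by (simp add: Pint_def outside_open_def uhs_iff)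
    qed
    moreover have "S2 \<subseteq> Pint"
    proof
      fix q assume "q \<in> S2"
      then obtain s where s: "0 \<le> s" "s \<le> 1" "q = ((1 - s) *\<^sub>R z + s *\<^sub>R c, T)" by (auto simp: S2_def)
      have "dist q (\<alpha>, 0) > 1" for \<alpha>
        using dist_snd_le[of q "(\<alpha>, 0)"] s(3) by (simp add: T_def)
      moreover have "dist (fst q) c < dist (fst q) (a c)" if "a \<in> A - {id}" for a
        using F_star[OF zF _ s(2), of a] zo[OF that] that s by (cases "s = 0") auto
      ultimately show "q \<in> Pint" using s(3) by (simp add: Pint_def outside_open_def uhs_iff T_def)
    qed
    moreover have "S3 \<subseteq> Pint" using base_Pint by (auto simp: S3_def)
    moreover have "p \<in> S1" "(c, 2) \<in> S3" by (auto simp: S1_def S3_def T_def zt)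
    ultimately show ?thesis by (intro exI[of _ "S1 \<union> S2 \<union> S3"]) auto
  qed
  then have "Pint = \<Union>{S. connected S \<and> S \<subseteq> Pint \<and> (c, 2) \<in> S}" by blast
  moreover have "connected (\<Union>{S. connected S \<and> S \<subseteq> Pint \<and> (c, 2) \<in> S})"
    by (rule connected_Union) auto
  ultimately show ?thesis by simp
qed

section \<open>The tessellation, discreteness and geometric finiteness\<close>

lemma image_Pint_disjoint:
  assumes "f \<in> K" "g \<in> K" "f \<noteq> g"
  shows "f ` Pint \<inter> g ` Pint = {}"
proof (rule ccontr)
  assume "\<not> ?thesis"
  then obtain p q where pq: "p \<in> Pint" "q \<in> Pint" "f p = g q" by blast
  have u: "p \<in> uhs" "q \<in> uhs" using pq Pint_P P_uhs by auto
  obtain g' where g': "g' \<in> K" "\<And>p. p \<in> uhs \<Longrightarrow> g' (g p) = p" "\<And>p. p \<in> uhs \<Longrightarrow> g (g' p) = p"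
    using K_inverse[OF assms(2)] by blast
  define h where "h = compose uhs g' f"
  have hK: "h \<in> K" unfolding h_def by (intro K_comp g'(1) assms(1))
  have "h p = q" using u pq(3) g'(2)[OF u(2)] by (simp add: h_def compose_def)
  then have "h = (\<lambda>p\<in>uhs. p)" using Pint_disjoint[OF hK pq(1)] pq(2) by simp
  then have "h x = x" if "x \<in> uhs" for x using that by simp
  then have "g' (f x) = x" if "x \<in> uhs" for x using that by (simp add: h_def compose_def)
  then have "f x = g x" if "x \<in> uhs" for x using that g'(3)[OF K_uhs[OF assms(1) that]] by metis
  then show False using K_ext[OF assms(1,2)] assms(3) by blast
qed

lemma K_image_P: "(\<Union>f\<in>K. f ` P) = uhs"
proof
  show "(\<Union>f\<in>K. f ` P) \<subseteq> uhs" using K_uhs P_uhs by blast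
  show "uhs \<subseteq> (\<Union>f\<in>K. f ` P)"
  proof
    fix p :: "'v \<times> real" assume p: "p \<in> uhs"
    obtain g where g: "g \<in> K" "g p \<in> P" using K_covers[OF p] by blast
    obtain g' where g': "g' \<in> K" "\<And>p. p \<in> uhs \<Longrightarrow> g' (g p) = p" "\<And>p. p \<in> uhs \<Longrightarrow> g (g' p) = p"
      using K_inverse[OF g(1)] by blast
    have "p = g' (g p)" using g'(2) p by simp
    then show "p \<in> (\<Union>f\<in>K. f ` P)" using g'(1) g(2) by blast
  qed
qed

lemma fundamental_Pint: "fundamental_domain K Pint"
  unfolding fundamental_domain_def closure_Pint
  using Pint_P P_uhs open_Pint connected_Pint image_Pint_disjoint K_image_P by auto

lemma locally_finite_images: "locally_finite_in (top_of_set uhs) ((\<lambda>f. f ` P) ` K)"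
  unfolding locally_finite_in_def
proof (intro conjI ballI)
  show "\<Union> ((\<lambda>f. f ` P) ` K) \<subseteq> topspace (top_of_set uhs)" using K_image_P by simp
  fix q0 :: "'v \<times> real" assume "q0 \<in> topspace (top_of_set uhs)"
  then have "q0 \<in> uhs" by simp
  then obtain U where U: "open U" "q0 \<in> U" "U \<subseteq> uhs" "finite {h \<in> K. \<exists>q\<in>U. h q \<in> P}"
    using locally_finite_P by blast
  \<comment> \<open>\<open>locally_finite_P\<close> counts maps into \<open>P\<close>, while tiles
    are images of \<open>P\<close>. A chosen inverse \<open>J g\<close> translates between the two,
    and \<open>J (J f) = f\<close> recovers the tile.\<close>
  define J where "J g = (SOME h. h \<in> K \<and> (\<forall>p\<in>uhs. h (g p) = p) \<and> (\<forall>p\<in>uhs. g (h p) = p))" for g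
  have J: "J g \<in> K \<and> (\<forall>p\<in>uhs. J g (g p) = p) \<and> (\<forall>p\<in>uhs. g (J g p) = p)" if gK: "g \<in> K" for g
  proof (rule K_inverse[OF gK])
    fix h assume "h \<in> K" "\<And>p. p \<in> uhs \<Longrightarrow> h (g p) = p" "\<And>p. p \<in> uhs \<Longrightarrow> g (h p) = p"
    then have "\<exists>h. h \<in> K \<and> (\<forall>p\<in>uhs. h (g p) = p) \<and> (\<forall>p\<in>uhs. g (h p) = p)" by blast
    then show ?thesis unfolding J_def by (rule someI_ex)
  qed
  have "{V \<in> (\<lambda>f. f ` P) ` K. V \<inter> U \<noteq> {}} \<subseteq> (\<lambda>h. J h ` P) ` {h \<in> K. \<exists>q\<in>U. h q \<in> P}"
  proof
    fix V assume "V \<in> {V \<in> (\<lambda>f. f ` P) ` K. V \<inter> U \<noteq> {}}"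
    then obtain f p where f: "f \<in> K" "V = f ` P" "p \<in> P" "f p \<in> U" by blast
    have pu: "p \<in> uhs" using f(3) P_uhs by blast
    have Jf: "J f \<in> K" using J[OF f(1)] by simp
    have "J f (f p) \<in> P" using J[OF f(1)] f(3) pu by simp
    then have "J f \<in> {h \<in> K. \<exists>q\<in>U. h q \<in> P}" using Jf f(4) by blast
    moreover have "J (J f) = f"
    proof (rule K_ext)
      fix x :: "'v \<times> real" assume x: "x \<in> uhs"
      have "J (J f) (J f (f x)) = f x" using J[OF Jf] K_uhs[OF f(1) x] by blast
      then show "J (J f) x = f x" using J[OF f(1)] x by simp
    qed (use J Jf f in auto)
    ultimately show "V \<in> (\<lambda>h. J h ` P) ` {h \<in> K. \<exists>q\<in>U. h q \<in> P}" using f(2) by force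
  qed
  then have "finite {V \<in> (\<lambda>f. f ` P) ` K. V \<inter> U \<noteq> {}}" using U(4) finite_surj by blast
  then show "\<exists>V. openin (top_of_set uhs) V \<and> q0 \<in> V \<and> finite {Ua \<in> (\<lambda>f. f ` P) ` K. Ua \<inter> V \<noteq> {}}"
    using U open_subset by blast
qed

theorem convex_fundamental_P: "convex_fundamental_polyhedron K P"
  unfolding convex_fundamental_polyhedron_def convex_polyhedron_def interior_P
proof (intro conjI)
  show "Pint \<noteq> {}" using base_Pint[of 2] by auto
  show "locally_finite_in (top_of_set uhs) (sides P)"
    using finite_sides_P by (intro finite_imp_locally_finite_in) (auto simp: sides_def)
qed (rule closedin_P convex_P fundamental_Pint locally_finite_images)+

lemma discrete_K: "discrete_group K"
  unfolding discrete_group_def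
proof (intro conjI K_subgroup K_isometries discreteI)
  fix f assume f: "f \<in> K"
  obtain f' where f': "f' \<in> K" "\<And>p. p \<in> uhs \<Longrightarrow> f' (f p) = p" "\<And>p. p \<in> uhs \<Longrightarrow> f (f' p) = p"
    using K_inverse[OF f] by blast
  define x where "x = (c, 2 :: real)"
  have x: "x \<in> Pint" "x \<in> uhs" using base_Pint[of 2] by (auto simp: x_def uhs_iff)
  define W where "W = uhs \<inter> f' -` Pint"
  have W: "open W" unfolding W_def
    by (rule continuous_open_preimage[OF K_continuous[OF f'(1)] open_uhs open_Pint])
  have "open {g. g x \<in> W}"
    using open_vimage[OF W continuous_on_product_coordinates[of x]] by (simp add: vimage_def)
  moreover have "{g. g x \<in> W} \<inter> K = {f}"
  proof
    show "{f} \<subseteq> {g. g x \<in> W} \<inter> K" using f x f'(2) K_uhs[OF f] by (simp add: W_def)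
    show "{g. g x \<in> W} \<inter> K \<subseteq> {f}"
    proof
      fix g assume g: "g \<in> {g. g x \<in> W} \<inter> K"
      then have gx: "f' (g x) \<in> Pint" "g x \<in> uhs" by (auto simp: W_def)
      have "g x = f (f' (g x))" using f'(3)[OF gx(2)] by simp
      then have "f ` Pint \<inter> g ` Pint \<noteq> {}" using gx(1) x(1) by blast
      then show "g \<in> {f}" using image_Pint_disjoint[OF f] g by blast
    qed
  qed
  ultimately show "f isolated_in K" using f unfolding isolated_in_def by blast
qed

text \<open>A side without \<open>\<xi>\<close> in its ideal closure eventually disappears near
  \<open>\<xi>\<close>; for finitely many sides this happens simultaneously.\<close>

theorem geometrically_finite_K: "geometrically_finite K"
  unfolding geometrically_finite_def
proof (intro conjI discrete_K exI[of _ P] convex_fundamental_P exact_P)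
  show "geometrically_finite_polyhedron P"
    unfolding geometrically_finite_polyhedron_def
  proof
    fix \<xi> assume "\<xi> \<in> ideal_closure P"
    have "\<forall>\<^sub>F p in ideal_nhds \<xi>. p \<in> S \<longrightarrow> \<xi> \<in> ideal_closure S" for S :: "('v \<times> real) set"
      by (cases "\<xi> \<in> ideal_closure S") (auto simp: ideal_closure_def not_frequently)
    then show "\<forall>\<^sub>F p in ideal_nhds \<xi>. \<forall>S\<in>sides P. p \<in> S \<longrightarrow> \<xi> \<in> ideal_closure S"
      using finite_sides_P by (intro eventually_ball_finite) auto
  qed
qed

end

section \<open>Boundary values\<close>

text \<open>The form of \<open>extends\<close> after \<open>V\<close> has been identified with
  Euclidean space, so that all ideal points are covered.\<close>

definition bext :: "('v::euclidean_space \<times> real \<Rightarrow> 'v \<times> real) \<Rightarrow> ('v option \<Rightarrow> 'v option) \<Rightarrow> bool" where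
  "bext f g \<longleftrightarrow> (\<forall>\<xi>. filterlim f (ideal_nhds (g \<xi>)) (ideal_nhds \<xi>))"

definition sinv :: "'v::euclidean_space \<Rightarrow> 'v option \<Rightarrow> 'v option" where
  "sinv a \<xi> = (case \<xi> of None \<Rightarrow> Some a
     | Some v \<Rightarrow> if v = a then None else Some (a + (1 / ((v - a) \<bullet> (v - a))) *\<^sub>R (v - a)))"

lemma ideal_nhds_simps:
  "ideal_nhds None = inf at_infinity (principal uhs)"
  "ideal_nhds (Some v) = inf (nhds (v, 0)) (principal uhs)"
  by (simp_all add: ideal_nhds_def)

lemma filterlim_uhs:
  assumes "\<And>p. p \<in> uhs \<Longrightarrow> f p = m p \<and> m p \<in> uhs" "filterlim m G (inf F (principal uhs))"
  shows "filterlim f (inf G (principal uhs)) (inf F (principal uhs))"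
proof -
  have ev: "eventually (\<lambda>p. p \<in> uhs) (inf F (principal uhs))"
    by (simp add: eventually_inf_principal)
  have "filterlim f G (inf F (principal uhs))"
    by (rule filterlim_cong[THEN iffD2, OF refl refl _ assms(2)])
      (use ev assms(1) in \<open>auto elim!: eventually_mono\<close>)
  moreover have "eventually (\<lambda>p. f p \<in> uhs) (inf F (principal uhs))"
    using ev assms(1) by (auto elim!: eventually_mono)
  ultimately show ?thesis by (simp add: filterlim_inf filterlim_principal)
qed

lemma filterlim_inf_principalI: "filterlim m G F \<Longrightarrow> filterlim m G (inf F (principal uhs))"
  by (rule filterlim_mono) auto

lemma bext_translation: "bext (Vert (\<lambda>z. z + l)) (map_option (\<lambda>z. z + l))"
  unfolding bext_def
proof
  fix \<xi> :: "'a option"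
  have eq: "Vert (\<lambda>z. z + l) p = vmap (\<lambda>z. z + l) p \<and> vmap (\<lambda>z. z + l) p \<in> uhs" if "p \<in> uhs" for p
    using that by (simp add: Vert_def vmap_uhs)
  show "filterlim (Vert (\<lambda>z. z + l)) (ideal_nhds (map_option (\<lambda>z. z + l) \<xi>)) (ideal_nhds \<xi>)"
  proof (cases \<xi>)
    case None
    have "filterlim (\<lambda>p. (l, 0) + p) at_infinity (at_infinity :: ('a \<times> real) filter)"
      by (rule tendsto_add_filterlim_at_infinity[OF tendsto_const filterlim_ident])
    moreover have "(\<lambda>p. (l, 0) + p) = vmap (\<lambda>z. z + l)"
      by (auto simp: fun_eq_iff vmap_def prod_eq_iff add.commute)
    ultimately have "filterlim (vmap (\<lambda>z. z + l)) at_infinity at_infinity" by simp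
    from filterlim_uhs[OF eq filterlim_inf_principalI[OF this]] show ?thesis
      by (simp add: None ideal_nhds_simps)
  next
    case (Some v)
    have "((\<lambda>p. (fst p + l, snd p)) \<longlongrightarrow> (fst (v, 0 :: real) + l, snd (v, 0 :: real))) (nhds (v, 0))"
      by (intro tendsto_intros tendsto_fst[OF filterlim_ident] tendsto_snd[OF filterlim_ident])
    then have "filterlim (vmap (\<lambda>z. z + l)) (nhds (v + l, 0)) (nhds (v, 0))"
      by (simp add: vmap_def[abs_def])
    from filterlim_uhs[OF eq filterlim_inf_principalI[OF this]] show ?thesis
      by (simp add: Some ideal_nhds_simps)
  qed
qed

lemma norm_inversion: "norm ((1 / (w \<bullet> w)) *\<^sub>R w) = inverse (norm w)" for w :: "'a::real_inner"
  by (cases "w = 0") (simp_all add: power2_norm_eq_inner[symmetric] power2_eq_square divide_inverse)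

lemma bext_Inv: "bext (Inv a) (sinv a)"
  unfolding bext_def
proof
  fix \<xi> :: "'a option"
  have eq: "Inv a p = inv_map a p \<and> inv_map a p \<in> uhs" if "p \<in> uhs" for p
    using that by (simp add: Inv_def inv_map_uhs)
  let ?J = "\<lambda>w :: 'a \<times> real. (1 / (w \<bullet> w)) *\<^sub>R w"
  have inv: "inv_map a = (\<lambda>p. (a, 0) + ?J (p - (a, 0)))" by (simp add: inv_map_def fun_eq_iff)
  show "filterlim (Inv a) (ideal_nhds (sinv a \<xi>)) (ideal_nhds \<xi>)"
  proof (cases \<xi>)
    case None
    have "((\<lambda>w. norm (?J w)) \<longlongrightarrow> 0) at_infinity"
      unfolding norm_inversion by (intro tendsto_inverse_0_at_top filterlim_at_infinity_imp_norm_at_top filterlim_ident)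
    then have "(?J \<longlongrightarrow> 0) at_infinity" by (rule tendsto_norm_zero_cancel)
    moreover have "filterlim (\<lambda>p. - (a, 0) + p) at_infinity (at_infinity :: ('a \<times> real) filter)"
      by (rule tendsto_add_filterlim_at_infinity[OF tendsto_const filterlim_ident])
    ultimately have "((\<lambda>p. ?J (- (a, 0) + p)) \<longlongrightarrow> 0) at_infinity"
      by (rule filterlim_compose)
    from tendsto_add[OF tendsto_const[of "(a, 0)"] this] have "(inv_map a \<longlongrightarrow> (a, 0)) at_infinity"
      unfolding inv by (simp only: uminus_add_conv_diff add_0_right)
    from filterlim_uhs[OF eq filterlim_inf_principalI[OF this]] show ?thesis
      by (simp add: None ideal_nhds_simps sinv_def)
  next
    case (Some v)
    show ?thesis
    proof (cases "v = a")
      case True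
      have "filterlim (\<lambda>w. norm (?J w)) at_top (at 0)"
        unfolding norm_inversion
        by (intro filterlim_inverse_at_top tendsto_eq_intros) (auto simp: eventually_at_filter)
      then have "filterlim ?J at_infinity (at 0)" by (rule filterlim_norm_at_top_imp_at_infinity)
      moreover have "filterlim (\<lambda>p. p - (a, 0)) (at 0) (at (a, 0 :: real))"
        unfolding filterlim_at
        by (intro conjI tendsto_eq_intros) (auto simp: eventually_at_filter)
      ultimately have "filterlim (\<lambda>p. ?J (p - (a, 0))) at_infinity (at (a, 0 :: real))"
        by (rule filterlim_compose)
      then have lim: "filterlim (inv_map a) at_infinity (at (a, 0 :: real))"
        unfolding inv by (rule tendsto_add_filterlim_at_infinity[OF tendsto_const])
      have "(a, 0) \<notin> (uhs :: ('a \<times> real) set)" by (simp add: uhs_iff)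
      then have "(uhs :: ('a \<times> real) set) \<subseteq> - {(a, 0)}" by blast
      \<comment> \<open>The centre lies on the boundary and not in \<open>uhs\<close>, so
        approaching it inside \<open>uhs\<close> is a punctured limit.\<close>
      then have "inf (nhds (a, 0)) (principal uhs) \<le> at (a, 0 :: real)"
        unfolding at_within_def by (intro inf_mono) auto
      then have "filterlim (inv_map a) at_infinity (inf (nhds (a, 0)) (principal uhs))"
        by (rule filterlim_mono[OF lim order_refl])
      from filterlim_uhs[OF eq this] show ?thesis
        by (simp add: Some True ideal_nhds_simps sinv_def)
    next
      case False
      let ?q = "(v, 0 :: real)"
      have ne: "(?q - (a, 0)) \<bullet> (?q - (a, 0)) \<noteq> 0" using False by simp
      have "((\<lambda>p. (a, 0) + ?J (p - (a, 0))) \<longlongrightarrow> (a, 0) + ?J (?q - (a, 0))) (nhds ?q)"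
        by (intro tendsto_intros filterlim_ident ne)
      moreover have "(a, 0) + ?J (?q - (a, 0)) = (a + (1 / ((v - a) \<bullet> (v - a))) *\<^sub>R (v - a), 0)"
        by (simp add: inner_prod_def)
      ultimately have "filterlim (inv_map a) (nhds (a + (1 / ((v - a) \<bullet> (v - a))) *\<^sub>R (v - a), 0)) (nhds ?q)"
        unfolding inv by simp
      from filterlim_uhs[OF eq filterlim_inf_principalI[OF this]] show ?thesis
        by (simp add: Some False ideal_nhds_simps sinv_def)
    qed
  qed
qed

lemma sinv_sinv: "sinv a (sinv a \<xi>) = \<xi>"
proof (cases \<xi>)
  case (Some v)
  show ?thesis
  proof (cases "v = a")
    case False
    define w where "w = v - a"
    have w: "w \<noteq> 0" "v = a + w" using False by (simp_all add: w_def)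
    have "(1 / (((1 / (w \<bullet> w)) *\<^sub>R w) \<bullet> ((1 / (w \<bullet> w)) *\<^sub>R w))) *\<^sub>R ((1 / (w \<bullet> w)) *\<^sub>R w) = w"
      using w by simp
    then show ?thesis using w by (simp add: Some sinv_def)
  qed (simp add: Some sinv_def)
qed (simp add: sinv_def)

lemma isometry_dist:
  assumes "h \<in> hyp_isometries" "x \<in> uhs" "p \<in> uhs"
  shows "(dist (h x) (h p))\<^sup>2 / (snd (h x) * snd (h p)) = (dist x p)\<^sup>2 / (snd x * snd p)"
    "h x \<in> uhs"
proof -
  have u: "h q \<in> uhs" if "q \<in> uhs" for q
    using assms(1) that Bij_imp_funcset by (auto simp: hyp_isometries_def)
  have "hdist (h x) (h p) = hdist x p" using assms by (auto simp: hyp_isometries_def)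
  then have "mform (hyp (h x)) (hyp (h p)) = mform (hyp x) (hyp p)"
    using cosh_hdist(1)[OF assms(2,3)] cosh_hdist(1)[OF u[OF assms(2)] u[OF assms(3)]] by simp
  then show "(dist (h x) (h p))\<^sup>2 / (snd (h x) * snd (h p)) = (dist x p)\<^sup>2 / (snd x * snd p)"
    using mform_hyp[OF assms(2,3)] mform_hyp[OF u[OF assms(2)] u[OF assms(3)]] by simp
  show "h x \<in> uhs" using u assms by blast
qed

definition bus :: "'v::euclidean_space \<Rightarrow> 'v \<times> real \<Rightarrow> real" where
  "bus v x = (dist x (v, 0))\<^sup>2 / snd x"

lemma bus_pos: "x \<in> uhs \<Longrightarrow> bus v x > 0"
proof -
  assume x: "x \<in> uhs"
  then have "x \<noteq> (v, 0)" by (auto simp: uhs_iff)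
  then have "(dist x (v, 0))\<^sup>2 > 0" by simp
  then show ?thesis unfolding bus_def using uhsD[OF x] by (intro divide_pos_pos)
qed

text \<open>An isometry that fixes the ideal boundary scales the exponentiated Busemann functions
  \<open>bus v\<close> by constants \<open>\<kappa> v\<close>. Approaching one ideal point while measuring from another one
  gives \<open>\<kappa> v * \<kappa> w = 1\<close> for \<open>v \<noteq> w\<close>, so that all of them are \<open>1\<close>.\<close>

lemma boundary_identity:
  fixes h :: "'v::euclidean_space \<times> real \<Rightarrow> 'v \<times> real"
  assumes h: "h \<in> hyp_isometries" and lim: "\<And>v. filterlim h (ideal_nhds (Some v)) (ideal_nhds (Some v))"
    and x: "x \<in> uhs"
  shows "h x = x"
proof -
  define p where "p v n = (v :: 'v, 1 / real (Suc n))" for v n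
  have pu: "p v n \<in> uhs" for v n by (simp add: p_def uhs_iff)
  have hu: "h q \<in> uhs" if "q \<in> uhs" for q using isometry_dist(2)[OF h that that] .
  have plim: "p v \<longlonglongrightarrow> (v, 0)" for v
    unfolding p_def by (intro tendsto_intros LIMSEQ_Suc[OF lim_1_over_n])
  have hplim: "(\<lambda>n. h (p v n)) \<longlonglongrightarrow> (v, 0)" for v
  proof -
    have "filterlim (p v) (ideal_nhds (Some v)) sequentially"
      using plim pu by (simp add: ideal_nhds_simps filterlim_inf filterlim_principal)
    from filterlim_compose[OF lim this] show ?thesis by (simp add: ideal_nhds_simps filterlim_inf)
  qed
  \<comment> \<open>The height distortion along a vertical approach to \<open>v\<close>. By
    invariance of \<open>dist\<^sup>2 / (t t')\<close> it can be measured from any point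
    \<open>y\<close>, which expresses its limit through \<open>bus v\<close>.\<close>
  define r where "r v n = snd (h (p v n)) / snd (p v n)" for v n
  have r_eq: "r v n = ((dist (h y) (h (p v n)))\<^sup>2 / snd (h y)) / ((dist y (p v n))\<^sup>2 / snd y)"
    if y: "y \<in> uhs" "y \<noteq> p v n" for y v n
  proof -
    have "(dist y (p v n))\<^sup>2 > 0" using y by simp
    then show ?thesis
      using isometry_dist(1)[OF h y(1) pu[of v n]] uhsD[OF y(1)] uhsD[OF hu[OF y(1)]]
        uhsD[OF pu[of v n]] uhsD[OF hu[OF pu[of v n]]]
      by (simp add: r_def field_simps)
  qed
  have r_lim: "r v \<longlonglongrightarrow> bus v (h y) / bus v y" if y: "y \<in> uhs" for y v
  proof -
    have "y \<noteq> (v, 0)" using y by (auto simp: uhs_iff)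
    then have "\<forall>\<^sub>F n in sequentially. p v n \<noteq> y"
      by (intro tendsto_imp_eventually_ne[OF plim]) auto
    then have ev: "\<forall>\<^sub>F n in sequentially.
        ((dist (h y) (h (p v n)))\<^sup>2 / snd (h y)) / ((dist y (p v n))\<^sup>2 / snd y) = r v n"
      by eventually_elim (rule r_eq[OF y, symmetric], simp)
    have "(\<lambda>n. ((dist (h y) (h (p v n)))\<^sup>2 / snd (h y)) / ((dist y (p v n))\<^sup>2 / snd y))
        \<longlonglongrightarrow> ((dist (h y) (v, 0))\<^sup>2 / snd (h y)) / ((dist y (v, 0))\<^sup>2 / snd y)"
      using bus_pos[OF y, of v] uhsD[OF y] uhsD[OF hu[OF y]]
      by (intro tendsto_intros hplim plim) (auto simp: bus_def)
    then show ?thesis unfolding bus_def by (rule Lim_transform_eventually[OF _ ev])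
  qed
  \<comment> \<open>The sequence \<open>r v\<close> does not involve \<open>y\<close>, so its limit,
    the quotient of the values of \<open>bus v\<close> at \<open>h y\<close> and \<open>y\<close>,
    is the same for all \<open>y\<close>.\<close>
  define \<kappa> where "\<kappa> v = bus v (h x) / bus v x" for v
  have \<kappa>: "bus v (h y) = \<kappa> v * bus v y" if "y \<in> uhs" for v y
    using LIMSEQ_unique[OF r_lim[OF that] r_lim[OF x], of v] bus_pos[OF that, of v] bus_pos[OF x, of v]
    by (simp add: \<kappa>_def field_simps)
  have \<kappa>_pos: "\<kappa> v > 0" for v
    unfolding \<kappa>_def using bus_pos[OF x, of v] bus_pos[OF hu[OF x], of v] by (intro divide_pos_pos)
  have r\<kappa>: "r v \<longlonglongrightarrow> \<kappa> v" for v using r_lim[OF x] by (simp add: \<kappa>_def)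
  have prod: "\<kappa> v * \<kappa> w = 1" if "v \<noteq> w" for v w
  proof -
    have vw: "dist (w, 0 :: real) (v, 0) \<noteq> 0" using that by simp
    \<comment> \<open>Scaling of \<open>bus v\<close> at the points approaching \<open>w\<close>:
      the heights cancel against \<open>r w n\<close>, and the remaining distances to
      \<open>v\<close> have the same limit.\<close>
    have e: "\<kappa> v * r w n = (dist (h (p w n)) (v, 0))\<^sup>2 / (dist (p w n) (v, 0))\<^sup>2" for n
    proof -
      have "p w n \<noteq> (v, 0)" by (simp add: p_def)
      then have "(dist (p w n) (v, 0))\<^sup>2 > 0" by simp
      then show ?thesis
        using \<kappa>[OF pu[of w n], of v] uhsD[OF pu[of w n]] uhsD[OF hu[OF pu[of w n]]]
        by (simp add: bus_def r_def field_simps)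
    qed
    have "(\<lambda>n. \<kappa> v * r w n) \<longlonglongrightarrow> (dist (w, 0 :: real) (v, 0))\<^sup>2 / (dist (w, 0 :: real) (v, 0))\<^sup>2"
      unfolding e using vw
      by (intro tendsto_divide[OF tendsto_power[OF tendsto_dist[OF hplim tendsto_const]]
          tendsto_power[OF tendsto_dist[OF plim tendsto_const]]]) simp
    moreover have "(\<lambda>n. \<kappa> v * r w n) \<longlonglongrightarrow> \<kappa> v * \<kappa> w" by (intro tendsto_intros r\<kappa>)
    ultimately show ?thesis using LIMSEQ_unique vw by fastforce
  qed
  \<comment> \<open>Three distinct ideal points \<open>v\<close>, \<open>v + b\<close>,
    \<open>v - b\<close> with pairwise products 1 force each scaling factor to be 1 or -1.\<close>
  obtain b :: 'v where b: "b \<in> Basis" "b \<noteq> 0" using nonempty_Basis nonzero_Basis by blast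
  have one: "\<kappa> v = 1" for v
  proof -
    have bb: "b + b \<noteq> 0" using b(2) by (simp flip: scaleR_2)
    have "v + b \<noteq> v - b"
    proof
      assume "v + b = v - b"
      then have "(v + b) - (v - b) = 0" by simp
      then show False using bb by simp
    qed
    moreover have "v \<noteq> v + b" "v \<noteq> v - b" using b(2) by auto
    ultimately have "\<kappa> v * \<kappa> (v + b) = 1" "\<kappa> v * \<kappa> (v - b) = 1" "\<kappa> (v + b) * \<kappa> (v - b) = 1"
      using prod by blast+
    then have "\<kappa> v * \<kappa> v = 1"
      by (metis mult.assoc mult.commute mult.left_neutral)
    then have "\<kappa> v = 1 \<or> \<kappa> v = - 1" by (simp only: square_eq_1_iff)
    then show ?thesis using \<kappa>_pos[of v] by auto
  qed
  obtain z t z' t' where zt: "x = (z, t)" "h x = (z', t')" by (cases x, cases "h x") auto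
  have "snd (h x) > 0" "snd x > 0" using uhsD[OF x] uhsD[OF hu[OF x]] by simp_all
  then have t: "t > 0" "t' > 0" unfolding zt(2) unfolding zt(1) by simp_all
  have eq: "((dist z' v)\<^sup>2 + t'\<^sup>2) * t = ((dist z v)\<^sup>2 + t\<^sup>2) * t'" for v
  proof -
    have "bus v (z', t') = bus v (z, t)" using \<kappa>[OF x, of v] unfolding zt(2) unfolding zt(1) by (simp add: one)
    then show ?thesis using t by (simp add: bus_def dist_prod_def field_simps)
  qed
  \<comment> \<open>Evaluation at the two feet gives the same right-hand side, so the heights agree
    and then the feet do.\<close>
  have 1: "((dist z' z)\<^sup>2 + t'\<^sup>2) = t * t'" using eq[of z] t by (simp add: power2_eq_square)
  have 2: "((dist z' z)\<^sup>2 + t\<^sup>2) = t * t'" using eq[of z'] t by (simp add: power2_eq_square dist_commute mult.commute)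
  have "t\<^sup>2 = t'\<^sup>2" using 1 2 by simp
  then have "t = t'" using t by (simp add: power2_eq_iff_nonneg)
  then have "z' = z" using 1 by (simp add: power2_eq_square)
  then show ?thesis using \<open>t = t'\<close> zt by simp
qed

lemma hyp_isometries_compose:
  assumes "f \<in> hyp_isometries" "g \<in> hyp_isometries"
  shows "compose uhs f g \<in> hyp_isometries"
proof -
  have "g p \<in> uhs" if "p \<in> uhs" for p using isometry_dist(2)[OF assms(2) that that] .
  then show ?thesis using assms compose_Bij by (auto simp: hyp_isometries_def compose_def)
qed

text \<open>The composite fixes every finite ideal point, so \<open>boundary_identity\<close>
  applies. This is the uniqueness of extensions from the boundary.\<close>

lemma bext_unique:
  assumes f: "f \<in> hyp_isometries" "bext f g" and e: "e \<in> hyp_isometries" "bext e g'"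
    and "\<And>\<xi>. g' (g \<xi>) = \<xi>" and x: "x \<in> uhs"
  shows "e (f x) = x"
proof -
  have fu: "f p \<in> uhs" if "p \<in> uhs" for p using isometry_dist(2)[OF f(1) that that] .
  have "compose uhs e f x = x"
  proof (rule boundary_identity[OF hyp_isometries_compose[OF e(1) f(1)] _ x])
    fix v :: 'a
    have "filterlim e (ideal_nhds (g' (g (Some v)))) (ideal_nhds (g (Some v)))"
      "filterlim f (ideal_nhds (g (Some v))) (ideal_nhds (Some v))"
      using f(2) e(2) unfolding bext_def by blast+
    then have "filterlim (\<lambda>p. e (f p)) (ideal_nhds (Some v)) (ideal_nhds (Some v))"
      using filterlim_compose assms(5) by metis
    then show "filterlim (compose uhs e f) (ideal_nhds (Some v)) (ideal_nhds (Some v))"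
      by (rule filterlim_cong[THEN iffD1, OF refl refl, rotated])
        (simp add: ideal_nhds_simps eventually_inf_principal compose_def)
  qed
  then show ?thesis using x by (simp add: compose_def)
qed

context int_lattice
begin

text \<open>\<open>Inv\<close> and \<open>Vert\<close> have the prescribed boundary values, and by
  \<open>bext_unique\<close> no other isometry does, so both groups have the same generators. The
  hypotheses on \<open>\<iota>\<close> say that it turns the algebraic maps into the Euclidean
  ones.\<close>

lemma inversion_group_K:
  fixes \<iota> :: "'a::ab_group_add \<Rightarrow> 'v"
  assumes bij: "bij_betw \<iota> V UNIV" and \<Lambda>: "\<Lambda> \<subseteq> V" "\<iota> ` \<Lambda> = L"
    and add\<iota>: "\<And>z \<alpha>. z \<in> V \<Longrightarrow> \<alpha> \<in> \<Lambda> \<Longrightarrow> \<iota> (z + \<alpha>) = \<iota> z + \<iota> \<alpha>"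
    and inv\<iota>: "\<And>z \<alpha>. z \<in> V \<Longrightarrow> \<alpha> \<in> \<Lambda> \<Longrightarrow> z \<noteq> \<alpha> \<Longrightarrow>
      \<iota> (invr (bar (z - \<alpha>)) + \<alpha>) = \<iota> \<alpha> + (1 / ((\<iota> z - \<iota> \<alpha>) \<bullet> (\<iota> z - \<iota> \<alpha>))) *\<^sub>R (\<iota> z - \<iota> \<alpha>)"
  shows "inversion_group invr bar \<iota> V \<Lambda> = K"
proof -
  have all: "(\<forall>\<xi>\<in>insert None (Some ` V). Q (map_option \<iota> \<xi>)) \<longleftrightarrow> (\<forall>\<eta>. Q \<eta>)" for Q
  proof
    assume q: "\<forall>\<xi>\<in>insert None (Some ` V). Q (map_option \<iota> \<xi>)"
    show "\<forall>\<eta>. Q \<eta>"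
    proof
      fix \<eta> show "Q \<eta>"
      proof (cases \<eta>)
        case None
        then show ?thesis using q by force
      next
        case (Some v)
        then obtain z where "z \<in> V" "v = \<iota> z" using bij by (metis UNIV_I bij_betw_imp_surj_on imageE)
        then show ?thesis using q Some by force
      qed
    qed
  qed blast
  have inj: "\<iota> z = \<iota> w \<longleftrightarrow> z = w" if "z \<in> V" "w \<in> V" for z w
    using bij that by (auto simp: bij_betw_def inj_on_def)
  have s: "extends \<iota> V f (sphere_inversion invr bar \<alpha>) \<longleftrightarrow> bext f (sinv (\<iota> \<alpha>))" if \<alpha>: "\<alpha> \<in> \<Lambda>" for f \<alpha>
  proof -
    have m: "map_option \<iota> (sphere_inversion invr bar \<alpha> \<xi>) = sinv (\<iota> \<alpha>) (map_option \<iota> \<xi>)"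
      if "\<xi> \<in> insert None (Some ` V)" for \<xi>
      using that \<alpha> \<Lambda>(1) inv\<iota> inj by (auto simp: sphere_inversion_def sinv_def)
    have "extends \<iota> V f (sphere_inversion invr bar \<alpha>) \<longleftrightarrow>
        (\<forall>\<xi>\<in>insert None (Some ` V). filterlim f (ideal_nhds (sinv (\<iota> \<alpha>) (map_option \<iota> \<xi>))) (ideal_nhds (map_option \<iota> \<xi>)))"
      unfolding extends_def
    proof (rule ball_cong[OF HOL.refl])
      fix \<xi> assume x: "\<xi> \<in> insert None (Some ` V)"
      show "filterlim f (ideal_nhds (map_option \<iota> (sphere_inversion invr bar \<alpha> \<xi>))) (ideal_nhds (map_option \<iota> \<xi>)) \<longleftrightarrow>
        filterlim f (ideal_nhds (sinv (\<iota> \<alpha>) (map_option \<iota> \<xi>))) (ideal_nhds (map_option \<iota> \<xi>))"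
        by (simp only: m[OF x])
    qed
    then show ?thesis
      unfolding bext_def all[of "\<lambda>\<eta>. filterlim f (ideal_nhds (sinv (\<iota> \<alpha>) \<eta>)) (ideal_nhds \<eta>)"] .
  qed
  have t: "extends \<iota> V f (translation \<alpha>) \<longleftrightarrow> bext f (map_option (\<lambda>z. z + \<iota> \<alpha>))" if \<alpha>: "\<alpha> \<in> \<Lambda>" for f \<alpha>
  proof -
    have m: "map_option \<iota> (translation \<alpha> \<xi>) = map_option (\<lambda>z. z + \<iota> \<alpha>) (map_option \<iota> \<xi>)"
      if "\<xi> \<in> insert None (Some ` V)" for \<xi>
      using that \<alpha> add\<iota> by (auto simp: translation_def)
    have "extends \<iota> V f (translation \<alpha>) \<longleftrightarrow>
        (\<forall>\<xi>\<in>insert None (Some ` V). filterlim f (ideal_nhds (map_option (\<lambda>z. z + \<iota> \<alpha>) (map_option \<iota> \<xi>))) (ideal_nhds (map_option \<iota> \<xi>)))"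
      unfolding extends_def
    proof (rule ball_cong[OF HOL.refl])
      fix \<xi> assume x: "\<xi> \<in> insert None (Some ` V)"
      show "filterlim f (ideal_nhds (map_option \<iota> (translation \<alpha> \<xi>))) (ideal_nhds (map_option \<iota> \<xi>)) \<longleftrightarrow>
        filterlim f (ideal_nhds (map_option (\<lambda>z. z + \<iota> \<alpha>) (map_option \<iota> \<xi>))) (ideal_nhds (map_option \<iota> \<xi>))"
        by (simp only: m[OF x])
    qed
    then show ?thesis
      unfolding bext_def all[of "\<lambda>\<eta>. filterlim f (ideal_nhds (map_option (\<lambda>z. z + \<iota> \<alpha>) \<eta>)) (ideal_nhds \<eta>)"] .
  qed
  have iso: "Inv l \<in> hyp_isometries" "Vert (\<lambda>z. z + l) \<in> hyp_isometries" if "l \<in> L" for l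
    using K_isometries Inv_K[OF that] trans_K[OF that] by auto
  have ext: "f = e" if "f \<in> hyp_isometries" "e \<in> hyp_isometries" "\<And>x. x \<in> uhs \<Longrightarrow> f x = e x" for f e :: "'v \<times> real \<Rightarrow> 'v \<times> real"
    using that by (intro extensionalityI[of _ uhs]) (auto simp: hyp_isometries_def Bij_def)
  have S: "f = Inv l" if f: "f \<in> hyp_isometries" "bext f (sinv l)" and l: "l \<in> L" for f l
  proof (rule ext[OF f(1) iso(1)[OF l]])
    fix x :: "'v \<times> real" assume x: "x \<in> uhs"
    have fx: "f x \<in> uhs" using isometry_dist(2)[OF f(1) x x] .
    have "Inv l (f x) = x" by (rule bext_unique[OF f iso(1)[OF l] bext_Inv sinv_sinv x])
    then have "inv_map l (inv_map l (f x)) = inv_map l x" using fx by (simp add: Inv_def)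
    then show "f x = Inv l x" using fx x by (simp add: Inv_def inv_map_involutive)
  qed
  have T: "f = Vert (\<lambda>z. z + l)" if f: "f \<in> hyp_isometries" "bext f (map_option (\<lambda>z. z + l))" and l: "l \<in> L" for f l
  proof (rule ext[OF f(1) iso(2)[OF l]])
    fix x :: "'v \<times> real" assume x: "x \<in> uhs"
    have fx: "f x \<in> uhs" using isometry_dist(2)[OF f(1) x x] .
    have "Vert (\<lambda>z. z + - l) (f x) = x"
      by (rule bext_unique[OF f iso(2)[OF uminus[OF l]] bext_translation _ x])
        (simp add: option.map_comp comp_def option.map_ident)
    then have "vmap (\<lambda>z. z + - l) (f x) = x" using fx by (simp add: Vert_def)
    then have "vmap (\<lambda>z. z + l) (vmap (\<lambda>z. z + - l) (f x)) = vmap (\<lambda>z. z + l) x" by simp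
    then show "f x = Vert (\<lambda>z. z + l) x" using x by (simp add: Vert_def vmap_def prod_eq_iff)
  qed
  have "{f \<in> hyp_isometries. \<exists>\<alpha>\<in>\<Lambda>. extends \<iota> V f (sphere_inversion invr bar \<alpha>) \<or> extends \<iota> V f (translation \<alpha>)} = gens"
  proof (intro equalityI subsetI)
    fix f assume "f \<in> {f \<in> hyp_isometries. \<exists>\<alpha>\<in>\<Lambda>. extends \<iota> V f (sphere_inversion invr bar \<alpha>) \<or> extends \<iota> V f (translation \<alpha>)}"
    then obtain \<alpha> where f: "f \<in> hyp_isometries" "\<alpha> \<in> \<Lambda>" "bext f (sinv (\<iota> \<alpha>)) \<or> bext f (map_option (\<lambda>z. z + \<iota> \<alpha>))"
      using s t by blast
    have "\<iota> \<alpha> \<in> L" using f(2) \<Lambda>(2) by blast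
    then show "f \<in> gens" using f S T unfolding gens_def by blast
  next
    fix f assume "f \<in> gens"
    then obtain \<alpha> where f: "\<alpha> \<in> \<Lambda>" "f = Inv (\<iota> \<alpha>) \<or> f = Vert (\<lambda>z. z + \<iota> \<alpha>)"
      using \<Lambda>(2) unfolding gens_def by blast
    have "\<iota> \<alpha> \<in> L" using f(1) \<Lambda>(2) by blast
    then show "f \<in> {f \<in> hyp_isometries. \<exists>\<alpha>\<in>\<Lambda>. extends \<iota> V f (sphere_inversion invr bar \<alpha>) \<or> extends \<iota> V f (translation \<alpha>)}"
      using f iso bext_Inv bext_translation s t by blast
  qed
  then show ?thesis unfolding inversion_group_def K_def by simp
qed

end

section \<open>Invariance of the hyperbolic volume\<close>

text \<open>The substitution rule \<open>cov_invertible_nonneg_eq\<close> speaks of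
  \<open>real ^ 'n\<close>, and the half-space has type \<open>'v \<times> real\<close>; a
  measure-preserving linear isometry connects them.\<close>

lemma real_isometry:
  assumes card: "CARD('n::{finite,wellorder}) = DIM('e::euclidean_space)"
  obtains T :: "real ^ ('n::{finite,wellorder}) \<Rightarrow> 'e::euclidean_space" where "linear T" "bij T" "\<And>x y. T x \<bullet> T y = x \<bullet> y"
    "distr lborel borel T = lborel"
proof -
  have "card (UNIV :: 'n set) = card (Basis :: 'e set)" using card by simp
  then obtain b where b: "bij_betw b (UNIV :: 'n set) (Basis :: 'e set)"
    by (metis finite_same_card_bij finite finite_Basis)
  have bB: "b i \<in> Basis" for i using b by (auto simp: bij_betw_def)
  have binj: "b i = b j \<longleftrightarrow> i = j" for i j using b by (auto simp: bij_betw_def inj_on_def)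
  have bb: "b i \<bullet> b j = (if i = j then 1 else 0)" for i j
    using inner_Basis[OF bB bB, of i j] binj by simp
  define T where "T x = (\<Sum>i\<in>UNIV. x $ i *\<^sub>R b i)" for x
  define T' where "T' p = (\<chi> i. p \<bullet> b i)" for p :: 'e
  have lin: "linear T"
    by (rule linearI) (simp_all add: T_def scaleR_left_distrib sum.distrib scaleR_right.sum)
  have Tb: "T x \<bullet> b i = x $ i" for x i
    by (simp add: T_def inner_sum_left bb if_distrib cong: if_cong)
  have T'T: "T' (T x) = x" for x by (simp add: T'_def Tb vec_eq_iff)
  have TT': "T (T' p) = p" for p
  proof -
    have "T (T' p) = (\<Sum>i\<in>UNIV. (p \<bullet> b i) *\<^sub>R b i)" by (simp add: T_def T'_def)
    also have "\<dots> = (\<Sum>e\<in>Basis. (p \<bullet> e) *\<^sub>R e)" by (rule sum.reindex_bij_betw[OF b])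
    finally show ?thesis by (simp add: euclidean_representation)
  qed
  have inner: "T x \<bullet> T y = x \<bullet> y" for x y
    by (subst (2) T_def) (simp add: inner_sum_right Tb inner_vec_def mult.commute)
  have bij: "bij T" by (rule bij_betw_byWitness[where f' = T']) (auto simp: T'T TT')
  have meas: "T \<in> borel_measurable borel"
    using lin by (intro borel_measurable_continuous_onI linear_continuous_on linear_conv_bounded_linear[THEN iffD1])
  have "lborel = distr lborel borel T"
  proof (rule lborel_eqI)
    fix l u :: 'e assume lu: "\<And>e. e \<in> Basis \<Longrightarrow> l \<bullet> e \<le> u \<bullet> e"
    have "T -` box l u = box (T' l) (T' u)"
    proof -
      have "(\<forall>e\<in>Basis. Q e) \<longleftrightarrow> (\<forall>i. Q (b i))" for Q
        unfolding bij_betw_imp_surj_on[OF b, symmetric] by simp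
      then have "T y \<in> box l u \<longleftrightarrow> y \<in> box (T' l) (T' u)" for y
        by (simp add: mem_box(1)[of "T y"] mem_box_cart(1) Tb T'_def)
      then show ?thesis by auto
    qed
    then have "emeasure (distr lborel borel T) (box l u) = emeasure lborel (box (T' l) (T' u))"
      using meas by (simp add: emeasure_distr)
    also have "\<dots> = ennreal (\<Prod>e\<in>Basis. (T' u - T' l) \<bullet> e)"
      using lu bB by (subst emeasure_lborel_box) (auto simp: Basis_vec_def inner_axis T'_def)
    also have "(\<Prod>e\<in>Basis. (T' u - T' l) \<bullet> e) = (\<Prod>i\<in>UNIV. (T' u - T' l) \<bullet> axis i 1)"
    proof (rule prod.reindex_bij_betw[symmetric])
      show "bij_betw (\<lambda>i. axis i 1) UNIV (Basis :: (real ^ ('n::{finite,wellorder})) set)"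
        by (auto simp: bij_betw_def inj_on_def axis_eq_axis Basis_vec_def)
    qed
    also have "\<dots> = (\<Prod>i\<in>UNIV. (u - l) \<bullet> b i)"
      by (simp add: inner_axis T'_def inner_diff_left)
    also have "\<dots> = (\<Prod>e\<in>Basis. (u - l) \<bullet> e)" by (rule prod.reindex_bij_betw[OF b])
    finally show "emeasure (distr lborel borel T) (box l u) = (\<Prod>e\<in>Basis. (u - l) \<bullet> e)" .
  qed simp
  then show ?thesis using that[OF lin bij inner] by simp
qed

text \<open>The reflection in the hyperplane orthogonal to \<open>w\<close>, scaled by
  \<open>1 / |w|\<^sup>2\<close>: the derivative of the inversion at offset \<open>w\<close> from
  its centre.\<close>

definition dinv :: "'e::real_inner \<Rightarrow> 'e \<Rightarrow> 'e" where
  "dinv w h = (1 / (w \<bullet> w)) *\<^sub>R (h - (2 * (w \<bullet> h) / (w \<bullet> w)) *\<^sub>R w)"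

lemma inversion_derivative:
  fixes a :: "'e::real_inner"
  assumes "y \<noteq> a"
  shows "((\<lambda>y. a + (1 / ((y - a) \<bullet> (y - a))) *\<^sub>R (y - a)) has_derivative dinv (y - a)) (at y within X)"
proof -
  have ne: "(y - a) \<bullet> (y - a) \<noteq> 0" using assms by simp
  have 1: "((\<lambda>y. y - a) has_derivative (\<lambda>h. h)) (at y within X)"
    by (auto intro!: derivative_eq_intros)
  have 2: "((\<lambda>y. (y - a) \<bullet> (y - a)) has_derivative (\<lambda>h. 2 * ((y - a) \<bullet> h))) (at y within X)"
    by (rule has_derivative_eq_rhs[OF has_derivative_inner[OF 1 1]]) (simp add: inner_commute)
  have 3: "((\<lambda>y. 1 / ((y - a) \<bullet> (y - a))) has_derivative
      (\<lambda>h. (0 * ((y - a) \<bullet> (y - a)) - 1 * (2 * ((y - a) \<bullet> h))) / (((y - a) \<bullet> (y - a)) * ((y - a) \<bullet> (y - a))))) (at y within X)"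
    by (rule has_derivative_divide'[OF has_derivative_const 2 ne])
  show ?thesis
  proof (rule has_derivative_eq_rhs[OF has_derivative_add[OF has_derivative_const has_derivative_scaleR[OF 3 1]]])
    show "(\<lambda>h. 0 + ((1 / ((y - a) \<bullet> (y - a))) *\<^sub>R h +
        ((0 * ((y - a) \<bullet> (y - a)) - 1 * (2 * ((y - a) \<bullet> h))) / (((y - a) \<bullet> (y - a)) * ((y - a) \<bullet> (y - a)))) *\<^sub>R (y - a)))
      = dinv (y - a)"
      unfolding dinv_def scaleR_diff_right by (simp add: fun_eq_iff)
  qed
qed

lemma det_dinv:
  fixes w :: "real ^ 'n"
  assumes "w \<noteq> 0"
  shows "\<bar>det (matrix (dinv w))\<bar> = 1 / (w \<bullet> w) ^ CARD('n)"
proof -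
  define R where "R h = h - (2 * (w \<bullet> h) / (w \<bullet> w)) *\<^sub>R w" for h
  have ww: "w \<bullet> w \<noteq> 0" using assms by simp
  have lin: "linear R" by (rule linearI) (simp_all add: R_def inner_add_right add_divide_distrib algebra_simps)
  have "R v \<bullet> R x = v \<bullet> x" for v x
    using ww by (simp add: R_def inner_diff_left inner_diff_right inner_commute field_simps)
  then have orth: "orthogonal_transformation R" using lin by (simp add: orthogonal_transformation_def)
  have "dinv w = (*\<^sub>R) (1 / (w \<bullet> w)) \<circ> R" by (simp add: dinv_def R_def fun_eq_iff)
  then have "matrix (dinv w) = matrix ((*\<^sub>R) (1 / (w \<bullet> w))) ** matrix R"
    using matrix_compose[OF lin, of "(*\<^sub>R) (1 / (w \<bullet> w))"] by (simp add: linear_scale_self)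
  then show ?thesis
    using orthogonal_transformation_det[OF orth]
    by (simp add: det_mul abs_mult power_divide power_abs[symmetric])
qed

lemma dinv_dinv:
  assumes "w \<noteq> 0"
  shows "dinv w (dinv ((1 / (w \<bullet> w)) *\<^sub>R w) h) = h"
proof -
  have ww: "w \<bullet> w \<noteq> 0" using assms by simp
  then show ?thesis
    by (simp add: dinv_def inner_diff_right scaleR_diff_right divide_simps power2_eq_square)
      (simp add: algebra_simps)?
qed

text \<open>\<open>has_integral\<close> compares finite values only. Two values that agree whenever
  one of them is finite are also infinite together, so volumes can be compared without knowing them
  to be finite.\<close>

lemma ennreal_eqI_real:
  assumes "\<And>b :: real. b \<ge> 0 \<Longrightarrow> X = ennreal b \<longleftrightarrow> Y = ennreal b"
  shows "X = Y"
proof (cases X)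
  case (real r)
  then show ?thesis using assms[of r] by simp
next
  case top
  show ?thesis
  proof (cases Y)
    case (real r)
    then show ?thesis using assms[of r] by simp
  qed (use top in simp)
qed

lemma has_integral_nn_integral_set:
  fixes f :: "'e::euclidean_space \<Rightarrow> real"
  assumes f: "(\<lambda>x. indicator S x * f x) \<in> borel_measurable borel" "\<And>x. x \<in> S \<Longrightarrow> f x \<ge> 0" and b: "b \<ge> 0"
  shows "(f has_integral b) S \<longleftrightarrow> (\<integral>\<^sup>+x. ennreal (indicator S x * f x) \<partial>lborel) = ennreal b"
proof -
  have ind: "(\<lambda>x. indicator S x * f x) = (\<lambda>x. if x \<in> S then f x else 0)" by (auto simp: indicator_def)
  have nn: "indicator S x * f x \<ge> 0" for x using f(2) by (simp add: indicator_def)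
  have "(f has_integral b) S \<longleftrightarrow> ((\<lambda>x. indicator S x * f x) has_integral b) UNIV"
    unfolding ind has_integral_restrict_UNIV ..
  also have "\<dots> \<longleftrightarrow> (\<integral>\<^sup>+x. ennreal (indicator S x * f x) \<partial>lborel) = ennreal b"
    using has_integral_iff_nn_integral_lebesgue[of "\<lambda>x. indicator S x * f x" b] nn b f(1)
    by (simp add: nn_integral_completion measurable_completion)
  finally show ?thesis .
qed

lemma snd_borel: "(snd :: 'v::euclidean_space \<times> real \<Rightarrow> real) \<in> borel_measurable borel"
  by (intro borel_measurable_continuous_onI continuous_on_snd continuous_on_id)

lemma density_measurable: "(\<lambda>p :: 'v::euclidean_space \<times> real. 1 / snd p ^ n) \<in> borel_measurable borel"
proof -
  note snd_borel[measurable]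
  show "(\<lambda>p :: 'v \<times> real. 1 / snd p ^ n) \<in> borel_measurable borel" by simp
qed

lemma uhs_borel: "uhs \<in> sets borel"
  by (rule borel_open[OF open_uhs])

lemma density_indicator_measurable:
  assumes "A \<in> sets borel"
  shows "(\<lambda>p :: 'v::euclidean_space \<times> real. ennreal (indicator A p * (1 / snd p ^ n))) \<in> borel_measurable borel"
  using assms density_measurable
  by (intro measurable_compose[OF _ measurable_ennreal] borel_measurable_times borel_measurable_indicator) auto

lemma hyp_volume_eq:
  fixes A :: "('v::euclidean_space \<times> real) set"
  assumes "A \<in> sets borel" "A \<subseteq> uhs"
  shows "emeasure hyp_volume A = (\<integral>\<^sup>+p. ennreal (indicator A p * (1 / snd p ^ DIM('v \<times> real))) \<partial>lborel)"
proof -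
  have "emeasure hyp_volume A = (\<integral>\<^sup>+p. (indicator uhs p * ennreal (1 / snd p ^ DIM('v \<times> real))) * indicator A p \<partial>lborel)"
  proof -
    have "(\<lambda>p :: 'v \<times> real. indicator uhs p * ennreal (1 / snd p ^ DIM('v \<times> real))) \<in> borel_measurable borel"
      by (intro borel_measurable_times_ennreal borel_measurable_indicator uhs_borel
          measurable_compose[OF density_measurable measurable_ennreal])
    then show ?thesis
      unfolding hyp_volume_def by (intro emeasure_density) (use assms(1) in \<open>simp_all only: measurable_lborel1 measurable_lborel2 sets_lborel\<close>)
  qed
  also have "\<dots> = (\<integral>\<^sup>+p. ennreal (indicator A p * (1 / snd p ^ DIM('v \<times> real))) \<partial>lborel)"
    using assms(2) by (intro nn_integral_cong) (auto simp: indicator_def)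
  finally show ?thesis .
qed

lemma sets_hyp_volume [simp]: "sets hyp_volume = sets borel"
  by (simp add: hyp_volume_def)

lemma image_borel:
  fixes f :: "'v::euclidean_space \<times> real \<Rightarrow> 'v \<times> real"
  assumes "A \<in> sets borel" "A \<subseteq> uhs" and "continuous_on uhs g"
    and "\<And>p. p \<in> uhs \<Longrightarrow> f p \<in> uhs \<and> g p \<in> uhs \<and> g (f p) = p \<and> f (g p) = p"
  shows "f ` A \<in> sets borel" "f ` A = {p \<in> uhs. g p \<in> A}"
proof -
  show eq: "f ` A = {p \<in> uhs. g p \<in> A}"
    using assms(2,4) by (auto simp: image_iff subset_iff del: split_paired_All) (metis assms(4))+
  have "g \<in> borel_measurable (restrict_space borel uhs)"
    by (rule borel_measurable_continuous_on_restrict[OF assms(3)])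
  then have "g -` A \<inter> space (restrict_space borel uhs) \<in> sets (restrict_space borel uhs)"
    using assms(1) by (rule measurable_sets)
  then show "f ` A \<in> sets borel"
    unfolding eq using uhs_borel sets_restrict_space_iff[of uhs borel "{p \<in> uhs. g p \<in> A}"]
    by (simp add: space_restrict_space vimage_def Int_def conj_commute)
qed

lemma hyp_volume_translation:
  fixes A :: "('v::euclidean_space \<times> real) set"
  assumes A: "A \<in> sets borel" "A \<subseteq> uhs"
  shows "emeasure hyp_volume (vmap (\<lambda>z. z + l) ` A) = emeasure hyp_volume A"
proof -
  let ?g = "\<lambda>p. (- l, 0 :: real) + p"
  have g: "?g = vmap (\<lambda>z. z + - l)" by (auto simp: vmap_def fun_eq_iff prod_eq_iff)
  have im: "vmap (\<lambda>z. z + l) ` A \<in> sets borel" "vmap (\<lambda>z. z + l) ` A = {p \<in> uhs. ?g p \<in> A}"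
  proof -
    have c: "continuous_on uhs ?g" by (intro continuous_intros)
    have i: "vmap (\<lambda>z. z + l) p \<in> uhs \<and> ?g p \<in> uhs \<and> ?g (vmap (\<lambda>z. z + l) p) = p \<and> vmap (\<lambda>z. z + l) (?g p) = p"
      if "p \<in> uhs" for p :: "'v \<times> real"
      using that by (simp add: vmap_def uhs_def prod_eq_iff)
    show "vmap (\<lambda>z. z + l) ` A \<in> sets borel" "vmap (\<lambda>z. z + l) ` A = {p \<in> uhs. ?g p \<in> A}"
      using image_borel[OF A c i] by simp_all
  qed
  have sub: "vmap (\<lambda>z. z + l) ` A \<subseteq> uhs" using im(2) by auto
  have ind: "indicator (vmap (\<lambda>z. z + l) ` A) p = (indicator A (?g p) :: real)" for p
    using A(2) by (auto simp: im(2) indicator_def uhs_def)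
  have "emeasure hyp_volume (vmap (\<lambda>z. z + l) ` A)
      = (\<integral>\<^sup>+p. ennreal (indicator A (?g p) * (1 / snd (?g p) ^ DIM('v \<times> real))) \<partial>lborel)"
    by (simp add: hyp_volume_eq[OF im(1) sub] ind)
  also have "\<dots> = (\<integral>\<^sup>+p. ennreal (indicator A p * (1 / snd p ^ DIM('v \<times> real))) \<partial>distr lborel borel ?g)"
    by (rule nn_integral_distr[symmetric])
      (use density_indicator_measurable[OF A(1)] in \<open>simp_all only: measurable_distr_eq1 measurable_lborel1 measurable_lborel2, simp\<close>)
  also have "\<dots> = emeasure hyp_volume A"
    by (simp add: lborel_distr_plus hyp_volume_eq[OF A])
  finally show ?thesis .
qed

text \<open>At distance \<open>\<rho>\<close> from the centre the Jacobian in dimension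
  \<open>n\<close> is \<open>\<rho>\<close> to the power \<open>- 2 n\<close>. The height is divided
  by \<open>\<rho>\<^sup>2\<close>, so the density grows by the inverse factor and the two cancel,
  which is \<open>jac\<close>.\<close>

lemma hyp_volume_inversion:
  fixes A :: "('v::euclidean_space \<times> real) set"
  assumes card: "CARD('n::{finite,wellorder}) = DIM('v \<times> real)"
    and A: "A \<in> sets borel" "A \<subseteq> uhs"
  shows "emeasure hyp_volume (inv_map \<alpha> ` A) = emeasure hyp_volume A"
proof -
  obtain T :: "real ^ ('n::{finite,wellorder}) \<Rightarrow> 'v \<times> real" where T: "linear T" "bij T" "\<And>x y. T x \<bullet> T y = x \<bullet> y"
    "distr lborel borel T = lborel"
    using real_isometry[OF card] by blast
  have Tm: "T \<in> borel_measurable borel"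
    using T(1) by (intro borel_measurable_continuous_onI linear_continuous_on linear_conv_bounded_linear[THEN iffD1])
  have cont: "continuous_on uhs (inv_map \<alpha>)"
    unfolding inv_map_def by (intro continuous_intros) (auto simp: uhs_def)
  have im: "inv_map \<alpha> ` A \<in> sets borel"
    using image_borel(1)[OF A cont, of "inv_map \<alpha>"] by (simp add: inv_map_uhs inv_map_involutive)
  have sub: "inv_map \<alpha> ` A \<subseteq> uhs" using A(2) inv_map_uhs by blast
  define F where "F y = 1 / snd (T y) ^ DIM('v \<times> real)" for y
  obtain a where a: "T a = (\<alpha>, 0)" using T(2) by (metis bij_pointE)
  define J where "J y = a + (1 / ((y - a) \<bullet> (y - a))) *\<^sub>R (y - a)" for y
  have Td: "T (y - a) = T y - (\<alpha>, 0)" for y using T(1) by (simp add: linear_diff a)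
  have TJ: "T (J y) = inv_map \<alpha> (T y)" for y
  proof -
    have "T (J y) = (\<alpha>, 0) + (1 / ((y - a) \<bullet> (y - a))) *\<^sub>R T (y - a)"
      using T(1) unfolding J_def by (simp add: linear_add linear_cmul a)
    moreover have "(y - a) \<bullet> (y - a) = (T y - (\<alpha>, 0)) \<bullet> (T y - (\<alpha>, 0))"
      using T(3)[of "y - a" "y - a"] Td by simp
    ultimately show ?thesis by (simp add: inv_map_def Td)
  qed
  have vol: "emeasure hyp_volume X = (\<integral>\<^sup>+y. ennreal (indicator (T -` X) y * F y) \<partial>lborel)"
    and meas: "(\<lambda>y. indicator (T -` X) y * F y) \<in> borel_measurable borel"
    if X: "X \<in> sets borel" "X \<subseteq> uhs" for X
  proof -
    have "emeasure hyp_volume X = (\<integral>\<^sup>+p. ennreal (indicator X p * (1 / snd p ^ DIM('v \<times> real))) \<partial>distr lborel borel T)"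
      by (simp add: T(4) hyp_volume_eq[OF X])
    also have "\<dots> = (\<integral>\<^sup>+y. ennreal (indicator X (T y) * (1 / snd (T y) ^ DIM('v \<times> real))) \<partial>lborel)"
      by (rule nn_integral_distr)
        (use Tm density_indicator_measurable[OF X(1)] in \<open>simp_all only: measurable_distr_eq1 measurable_lborel1 measurable_lborel2\<close>)
    finally show "emeasure hyp_volume X = (\<integral>\<^sup>+y. ennreal (indicator (T -` X) y * F y) \<partial>lborel)"
      by (simp add: F_def indicator_def)
    have "T -` X \<in> sets borel" using measurable_sets[OF Tm X(1)] by simp
    moreover have "snd \<circ> T \<in> borel_measurable borel" by (rule measurable_comp[OF Tm snd_borel])
    ultimately show "(\<lambda>y. indicator (T -` X) y * F y) \<in> borel_measurable borel"
      unfolding F_def comp_def by (intro borel_measurable_times borel_measurable_indicator borel_measurable_divide borel_measurable_power) auto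
  qed
  have ua: "y \<noteq> a" if "T y \<in> uhs" for y using that a by (auto simp: uhs_iff)
  let ?S = "T -` A" and ?S' = "T -` (inv_map \<alpha> ` A)"
  have key: "((\<lambda>y. \<bar>det (matrix (dinv (y - a)))\<bar> * F (J y)) has_integral b) ?S \<longleftrightarrow> (F has_integral b) ?S'" for b
  proof (rule cov_invertible_nonneg_eq[where h = J and h' = "\<lambda>y. dinv (y - a)"])
    fix y assume y: "y \<in> ?S"
    then have u: "T y \<in> uhs" using A by auto
    show "(J has_derivative dinv (y - a)) (at y within ?S)"
      unfolding J_def by (rule inversion_derivative[OF ua[OF u]])
    show "J y \<in> ?S' \<and> J (J y) = y"
    proof
      show "J y \<in> ?S'" using y by (simp add: TJ)
      have "T (J (J y)) = T y" by (simp add: TJ inv_map_involutive[OF u])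
      then show "J (J y) = y" using T(2) by (metis bij_pointE)
    qed
  next
    fix y assume y: "y \<in> ?S'"
    then have u: "T y \<in> uhs" using sub by auto
    show "(J has_derivative dinv (y - a)) (at y within ?S')"
      unfolding J_def by (rule inversion_derivative[OF ua[OF u]])
    show "0 \<le> F y" using uhsD[OF u] by (simp add: F_def)
    show "J y \<in> ?S \<and> J (J y) = y"
    proof
      obtain p where p: "p \<in> A" "T y = inv_map \<alpha> p" using y by auto
      then have "T (J y) = p" using inv_map_involutive[of p] A(2) by (auto simp: TJ)
      then show "J y \<in> ?S" using p by simp
      have "T (J (J y)) = T y" by (simp add: TJ inv_map_involutive[OF u])
      then show "J (J y) = y" using T(2) by (metis bij_pointE)
    qed
    have "J y - a = (1 / ((y - a) \<bullet> (y - a))) *\<^sub>R (y - a)" by (simp add: J_def)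
    then show "dinv (y - a) \<circ> dinv (J y - a) = id"
      using dinv_dinv[of "y - a"] ua[OF u] by (simp add: fun_eq_iff)
  qed
  have jac: "\<bar>det (matrix (dinv (y - a)))\<bar> * F (J y) = F y" if y: "y \<in> ?S" for y
  proof -
    have u: "T y \<in> uhs" using y A by auto
    have "(y - a) \<bullet> (y - a) = (dist (T y) (\<alpha>, 0))\<^sup>2"
      using T(3)[of "y - a" "y - a"] Td by (simp add: dist_norm power2_norm_eq_inner)
    moreover have "dist (T y) (\<alpha>, 0) \<noteq> 0" using uhsD[OF u] by auto
    ultimately show ?thesis
      using det_dinv[of "y - a"] ua[OF u] uhsD[OF u] card
      by (simp add: F_def TJ inv_map_uhs(2)[OF u] power_divide)
  qed
  have "(F has_integral b) ?S \<longleftrightarrow> (F has_integral b) ?S'" for b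
    using key[of b] has_integral_cong[of ?S "\<lambda>y. \<bar>det (matrix (dinv (y - a)))\<bar> * F (J y)" F] jac by simp
  moreover have F0: "F y \<ge> 0" if "T y \<in> uhs" for y using uhsD[OF that] by (simp add: F_def)
  moreover have "F y \<ge> 0" if "y \<in> ?S" for y by (rule F0) (use that A(2) in blast)
  moreover have "F y \<ge> 0" if "y \<in> ?S'" for y by (rule F0) (use that sub in blast)
  ultimately have "(\<integral>\<^sup>+y. ennreal (indicator ?S y * F y) \<partial>lborel) = ennreal b \<longleftrightarrow>
      (\<integral>\<^sup>+y. ennreal (indicator ?S' y * F y) \<partial>lborel) = ennreal b" if "b \<ge> 0" for b
    using has_integral_nn_integral_set[OF meas[OF A] _ that] has_integral_nn_integral_set[OF meas[OF im sub] _ that]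
    by blast
  then have "(\<integral>\<^sup>+y. ennreal (indicator ?S y * F y) \<partial>lborel) = (\<integral>\<^sup>+y. ennreal (indicator ?S' y * F y) \<partial>lborel)"
    by (rule ennreal_eqI_real)
  then show ?thesis by (simp only: vol[OF A] vol[OF im sub])
qed

context int_lattice
begin

lemma hyp_volume_K:
  assumes card: "CARD('n::{finite,wellorder}) = DIM('v \<times> real)"
    and g: "g \<in> K" and X: "X \<in> sets borel" "X \<subseteq> uhs"
  shows "g ` X \<in> sets borel \<and> emeasure hyp_volume (g ` X) = emeasure hyp_volume X"
proof -
  have meas: "g ` X \<in> sets borel \<and> g ` X \<subseteq> uhs" if g: "g \<in> K" and X: "X \<in> sets borel" "X \<subseteq> uhs" for g X
  proof -
    obtain h where h: "h \<in> K" "\<And>p. p \<in> uhs \<Longrightarrow> h (g p) = p" "\<And>p. p \<in> uhs \<Longrightarrow> g (h p) = p"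
      using K_inverse[OF g] by blast
    have "g ` X \<in> sets borel"
      by (rule image_borel(1)[OF X K_continuous[OF h(1)]])
        (use h K_uhs[OF g] K_uhs[OF h(1)] in simp)
    then show ?thesis using K_uhs[OF g] X(2) by blast
  qed
  have gen: "emeasure hyp_volume (g ` X) = emeasure hyp_volume X" if g: "g \<in> gens" and X: "X \<in> sets borel" "X \<subseteq> uhs" for g X
  proof -
    consider \<alpha> where "g = Inv \<alpha>" | l where "g = Vert (\<lambda>z. z + l)" using g unfolding gens_def by blast
    then show ?thesis
    proof cases
      case 1
      then have "g ` X = inv_map \<alpha> ` X" using X(2) by (auto simp: Inv_def)
      then show ?thesis using hyp_volume_inversion[OF card X] by simp
    next
      case 2
      then have "g ` X = vmap (\<lambda>z. z + l) ` X" using X(2) by (auto simp: Vert_def)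
      then show ?thesis using hyp_volume_translation[OF X] by simp
    qed
  qed
  have "g \<in> generate (BijGroup uhs) gens" using g K_def by simp
  then have "\<forall>X. X \<in> sets borel \<longrightarrow> X \<subseteq> uhs \<longrightarrow> emeasure hyp_volume (g ` X) = emeasure hyp_volume X"
  proof (induction rule: generate.induct)
    case one
    have "\<one>\<^bsub>BijGroup uhs\<^esub> ` X = X" if "X \<subseteq> uhs" for X :: "('v \<times> real) set"
      using that by (auto simp: BijGroup_simps)
    then show ?case by simp
  next
    case (incl g)
    then show ?case using gen by blast
  next
    case (inv g)
    have "inv\<^bsub>BijGroup uhs\<^esub> g \<in> gens"
      using inv Inv_Bij(2) Vert_Bij(2)[OF translation_inverse] uminus unfolding gens_def by blast
    then show ?case using gen by blast
  next
    case (eng g h)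
    have K: "g \<in> K" "h \<in> K" using eng by (simp_all add: K_def)
    have "(g \<otimes>\<^bsub>BijGroup uhs\<^esub> h) ` X = g ` h ` X" if "X \<subseteq> uhs" for X
      using that K_Bij[OF K(1)] K_Bij[OF K(2)]
      by (auto simp: BijGroup_simps compose_def image_image intro!: image_cong)
    then show ?case using eng.IH meas[OF K(2)] by simp
  qed
  then show ?thesis using meas[OF g X] X by blast
qed

end

section \<open>The lattice criterion\<close>

context int_lattice
begin

definition covered :: bool where
  "covered \<longleftrightarrow> (\<forall>z. \<exists>\<alpha>\<in>L. dist z \<alpha> \<le> 1)"

text \<open>Near a point at distance exactly \<open>1\<close> from \<open>L\<close>, the distance to \<open>L\<close> drops at a linear
  rate in every direction, because the unit balls about \<open>L\<close> cover a neighbourhood.\<close>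

lemma linear_drop:
  assumes cov: covered
  obtains k r where "k > 0" "r > 0" "\<And>z'. dist z' z < r \<Longrightarrow> \<exists>\<alpha>\<in>L. (dist z' \<alpha>)\<^sup>2 \<le> 1 - k * dist z' z"
proof (cases "\<exists>\<alpha>\<in>L. dist z \<alpha> < 1")
  case True
  then obtain \<alpha> where \<alpha>: "\<alpha> \<in> L" "dist z \<alpha> < 1" by blast
  \<comment> \<open>Half the slack: \<open>z'\<close> keeps distance at most \<open>1 - r\<close>
    from \<open>\<alpha>\<close>, so its square is below 1 by at least \<open>r\<close>, which
    exceeds \<open>dist z' z\<close>.\<close>
  define r where "r = (1 - dist z \<alpha>) / 2"
  have r: "r > 0" using \<alpha> by (simp add: r_def)
  have "(dist z' \<alpha>)\<^sup>2 \<le> 1 - 1 * dist z' z" if z': "dist z' z < r" for z'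
  proof -
    have "dist z' \<alpha> \<le> dist z' z + dist z \<alpha>" by (rule dist_triangle)
    then have d: "dist z' \<alpha> \<le> 1 - r" using z' by (simp add: r_def field_simps)
    have "dist z' \<alpha> * dist z' \<alpha> \<le> dist z' \<alpha> * 1" using d r by (intro mult_left_mono) auto
    then show ?thesis using d z' by (simp add: power2_eq_square)
  qed
  then show ?thesis using r \<alpha>(1) by (intro that[of 1 r]) auto
next
  case False
  then have hole: "dist z \<alpha> \<ge> 1" if "\<alpha> \<in> L" for \<alpha> using that by force
  let ?D = "(\<lambda>\<alpha>. dist z \<alpha>) ` {\<alpha> \<in> L. dist \<alpha> z \<le> 2}"
  have "finite ?D" using finite_cball by simp
  \<comment> \<open>Only finitely many lattice points lie within 2 of \<open>z\<close>, so distances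
    above 1 stay away from 1; 2 is inserted to keep the set of candidates nonempty.\<close>
  then obtain \<eta> where \<eta>: "\<eta> > 0" "\<And>x. x \<in> ?D \<Longrightarrow> x > 1 \<Longrightarrow> x \<ge> 1 + \<eta>"
  proof -
    define G where "G = insert 2 {x \<in> ?D. x > 1}"
    have "finite G" "G \<noteq> {}" using \<open>finite ?D\<close> by (simp_all add: G_def)
    then have "Min G \<in> G" "\<And>x. x \<in> G \<Longrightarrow> Min G \<le> x" by simp_all
    then have "Min G - 1 > 0" "\<And>x. x \<in> ?D \<Longrightarrow> x > 1 \<Longrightarrow> x \<ge> 1 + (Min G - 1)"
      by (auto simp: G_def)
    then show ?thesis using that by blast
  qed
  \<comment> \<open>A lattice point covering \<open>z + e w\<close> is within \<open>1 + e\<close>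
    of \<open>z\<close>. As \<open>e < \<eta>\<close> and no lattice point is closer than 1, its
    distance from \<open>z\<close> is exactly 1.\<close>
  define e where "e = min (\<eta> / 2) 1"
  have e: "e > 0" "e < \<eta>" "e \<le> 1" using \<eta> by (auto simp: e_def min_def)
  have "\<exists>\<alpha>\<in>L. (dist z' \<alpha>)\<^sup>2 \<le> 1 - (e / 2) * dist z' z" if z': "dist z' z < e / 2" for z'
  proof (cases "z' = z")
    case True
    obtain \<alpha> where "\<alpha> \<in> L" "dist z \<alpha> \<le> 1" using cov by (auto simp: covered_def)
    then show ?thesis using True by (intro bexI[of _ \<alpha>]) (auto simp: power_le_one)
  next
    case False
    define d where "d = dist z' z"
    define w where "w = (1 / d) *\<^sub>R (z' - z)"
    have d: "d > 0" using False by (simp add: d_def)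
    have ww: "w \<bullet> w = 1"
      using d by (simp add: w_def d_def dist_norm power2_norm_eq_inner[symmetric] power2_eq_square)
    have zw: "z' - z = d *\<^sub>R w" using d by (simp add: w_def)
    obtain \<alpha> where \<alpha>: "\<alpha> \<in> L" "dist (z + e *\<^sub>R w) \<alpha> \<le> 1" using cov by (auto simp: covered_def)
    have nw: "norm w = 1" using ww by (simp add: norm_eq_sqrt_inner)
    have "dist z \<alpha> \<le> dist z (z + e *\<^sub>R w) + dist (z + e *\<^sub>R w) \<alpha>" by (rule dist_triangle)
    then have za: "dist z \<alpha> \<le> 1 + e" using \<alpha>(2) e nw by (simp add: dist_norm)
    then have "dist z \<alpha> \<in> ?D" using \<alpha>(1) e by (auto simp: dist_commute)
    then have "\<not> dist z \<alpha> > 1" using \<eta>(2) za e by force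
    then have one: "dist z \<alpha> = 1" using hole[OF \<alpha>(1)] by simp
    define u where "u = \<alpha> - z"
    have "norm u = 1" using one by (simp add: u_def dist_norm norm_minus_commute)
    then have uu: "u \<bullet> u = 1" by (simp add: norm_eq_1)
    have "(dist (z + s *\<^sub>R w) \<alpha>)\<^sup>2 = s * s - 2 * s * (w \<bullet> u) + 1" for s
    proof -
      have "z + s *\<^sub>R w - \<alpha> = s *\<^sub>R w - u" by (simp add: u_def)
      then have "(dist (z + s *\<^sub>R w) \<alpha>)\<^sup>2 = (s *\<^sub>R w - u) \<bullet> (s *\<^sub>R w - u)"
        by (simp only: dist_norm power2_norm_eq_inner)
      then show ?thesis using ww uu by (simp add: inner_diff_left inner_diff_right inner_commute)
    qed
    note eq = this
    have "(dist (z + e *\<^sub>R w) \<alpha>)\<^sup>2 \<le> 1" using \<alpha>(2) by (simp add: power_le_one)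
    then have "e * e \<le> e * (2 * (w \<bullet> u))" unfolding eq by simp
    \<comment> \<open>Covering at the fixed distance \<open>e\<close> bounds the slope in direction
      \<open>w\<close> from below, uniformly in \<open>w\<close>; this yields the linear rate for
      all closer points.\<close>
    then have wu: "e \<le> 2 * (w \<bullet> u)" using e by simp
    have "z' = z + d *\<^sub>R w" using zw by (simp add: algebra_simps)
    then have "(dist z' \<alpha>)\<^sup>2 = d * d - d * (2 * (w \<bullet> u)) + 1" using eq[of d] by simp
    moreover have "d * e \<le> d * (2 * (w \<bullet> u))" using wu d by simp
    moreover have "d * d \<le> d * (e / 2)" using z' d by (simp add: d_def[symmetric])
    ultimately have "(dist z' \<alpha>)\<^sup>2 \<le> 1 - (e / 2) * d" by (simp add: algebra_simps)
    then show ?thesis using \<alpha>(1) by (auto simp: d_def)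
  qed
  then show ?thesis using that[of "e / 2" "e / 2"] e by auto
qed

text \<open>Finitely many lattice points lie within distance 2, so a minimum exists; the inserted 2
  stands for all the others.\<close>

lemma gap:
  assumes z: "\<And>\<alpha>. \<alpha> \<in> L \<Longrightarrow> dist z \<alpha> > 1"
  shows "\<exists>\<eta>>0. \<forall>\<alpha>\<in>L. dist z \<alpha> \<ge> 1 + \<eta>"
proof -
  let ?D = "insert 2 ((\<lambda>\<alpha>. dist z \<alpha>) ` {\<alpha> \<in> L. dist \<alpha> z \<le> 2})"
  have fin: "finite ?D" using finite_cball by simp
  define \<eta> where "\<eta> = Min ?D - 1"
  have "Min ?D \<in> ?D" using fin by (intro Min_in) auto
  then have "\<eta> > 0" using z by (auto simp: \<eta>_def)
  moreover have "dist z \<alpha> \<ge> 1 + \<eta>" if "\<alpha> \<in> L" for \<alpha>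
  proof (cases "dist \<alpha> z \<le> 2")
    case True
    then have "Min ?D \<le> dist z \<alpha>" using that fin by (intro Min_le) auto
    then show ?thesis by (simp add: \<eta>_def)
  next
    case False
    have "Min ?D \<le> 2" using fin by (intro Min_le) auto
    then show ?thesis using False by (simp add: \<eta>_def dist_commute)
  qed
  ultimately show ?thesis by blast
qed

text \<open>Finitely many neighbourhoods from \<open>linear_drop\<close> cover the ball. In the one
  about \<open>z\<close>, a point of the slice satisfies
  \<open>k * dist z' z \<le> t\<^sup>2\<close>, so the slice lies in finitely many balls of radius
  proportional to \<open>t\<^sup>2\<close>.\<close>

lemma slice_bound:
  assumes cov: covered
  obtains C where "C \<ge> 0" "\<And>t. 0 < t \<Longrightarrow> t \<le> 1 \<Longrightarrow>
    emeasure lborel {z \<in> cball c R. \<forall>\<alpha>\<in>L. (dist z \<alpha>)\<^sup>2 + t\<^sup>2 \<ge> 1} \<le> ennreal (C * t ^ (2 * DIM('v)))"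
proof -
  have "\<forall>z. \<exists>k r. k > 0 \<and> r > 0 \<and> (\<forall>z'. dist z' z < r \<longrightarrow> (\<exists>\<alpha>\<in>L. (dist z' \<alpha>)\<^sup>2 \<le> 1 - k * dist z' z))"
    using linear_drop[OF cov] by metis
  then obtain k r where kr: "\<And>z. k z > 0" "\<And>z. r z > 0"
    "\<And>z z'. dist z' z < r z \<Longrightarrow> \<exists>\<alpha>\<in>L. (dist z' \<alpha>)\<^sup>2 \<le> 1 - k z * dist z' z"
    by metis
  have "cball c R \<subseteq> (\<Union>z\<in>cball c R. ball z (r z))" using kr(2) by force
  then obtain Z where Z: "finite Z" "cball c R \<subseteq> (\<Union>z\<in>Z. ball z (r z))"
    using compactE_image[OF compact_cball, of "cball c R" "\<lambda>z. ball z (r z)"] by (metis open_ball)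
  define d where "d = DIM('v)"
  define C where "C = (\<Sum>z\<in>Z. unit_ball_vol d * (1 / k z) ^ d)"
  have C: "C \<ge> 0" unfolding C_def using kr(1) by (intro sum_nonneg) (auto simp: less_imp_le)
  have "emeasure lborel {z \<in> cball c R. \<forall>\<alpha>\<in>L. (dist z \<alpha>)\<^sup>2 + t\<^sup>2 \<ge> 1} \<le> ennreal (C * t ^ (2 * d))" for t
  proof -
    have "{z \<in> cball c R. \<forall>\<alpha>\<in>L. (dist z \<alpha>)\<^sup>2 + t\<^sup>2 \<ge> 1} \<subseteq> (\<Union>z\<in>Z. cball z (t\<^sup>2 / k z))"
    proof
      fix z' assume z': "z' \<in> {z \<in> cball c R. \<forall>\<alpha>\<in>L. (dist z \<alpha>)\<^sup>2 + t\<^sup>2 \<ge> 1}"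
      then obtain z where z: "z \<in> Z" "z' \<in> ball z (r z)" using Z(2) by blast
      then obtain \<alpha> where "\<alpha> \<in> L" "(dist z' \<alpha>)\<^sup>2 \<le> 1 - k z * dist z' z"
        using kr(3)[of z' z] by (auto simp: dist_commute)
      then have "k z * dist z' z \<le> t\<^sup>2" using z' by force
      then have "dist z z' \<le> t\<^sup>2 / k z" using kr(1)[of z] by (simp add: pos_le_divide_eq mult.commute dist_commute)
      then show "z' \<in> (\<Union>z\<in>Z. cball z (t\<^sup>2 / k z))" using z(1) by auto
    qed
    then have "emeasure lborel {z \<in> cball c R. \<forall>\<alpha>\<in>L. (dist z \<alpha>)\<^sup>2 + t\<^sup>2 \<ge> 1}
        \<le> emeasure lborel (\<Union>z\<in>Z. cball z (t\<^sup>2 / k z))"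
      using Z(1) by (intro emeasure_mono) auto
    also have "\<dots> \<le> (\<Sum>z\<in>Z. emeasure lborel (cball z (t\<^sup>2 / k z)))"
      using Z(1) by (intro emeasure_subadditive_finite) auto
    also have "\<dots> = (\<Sum>z\<in>Z. ennreal (unit_ball_vol d * (t\<^sup>2 / k z) ^ d))"
      by (intro sum.cong HOL.refl, subst emeasure_cball) (use kr(1) in \<open>auto simp: d_def less_imp_le\<close>)
    also have "\<dots> = ennreal (\<Sum>z\<in>Z. unit_ball_vol d * (t\<^sup>2 / k z) ^ d)"
      using kr(1) by (intro sum_ennreal) (simp add: less_imp_le)
    also have "(\<Sum>z\<in>Z. unit_ball_vol d * (t\<^sup>2 / k z) ^ d) = C * t ^ (2 * d)"
      unfolding C_def sum_distrib_right
      by (intro sum.cong HOL.refl) (simp add: power_divide power_mult)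
    finally show ?thesis .
  qed
  then show ?thesis using that C d_def by blast
qed

end

lemma hyp_volume_fubini:
  fixes A :: "('v::euclidean_space \<times> real) set"
  assumes A: "A \<in> sets borel" "A \<subseteq> uhs"
  shows "emeasure hyp_volume A =
    (\<integral>\<^sup>+t. emeasure lborel {z. (z, t) \<in> A} * ennreal (indicator {0<..} t * (1 / t ^ DIM('v \<times> real))) \<partial>lborel)"
proof -
  let ?f = "\<lambda>p :: 'v \<times> real. ennreal (indicator A p * (1 / snd p ^ DIM('v \<times> real)))"
  have m: "?f \<in> borel_measurable (lborel \<Otimes>\<^sub>M lborel)"
    unfolding lborel_prod using density_indicator_measurable[OF A(1)] by (simp only: measurable_lborel1 measurable_lborel2)
  have "emeasure hyp_volume A = (\<integral>\<^sup>+p. ?f p \<partial>(lborel \<Otimes>\<^sub>M lborel))"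
    by (simp add: hyp_volume_eq[OF A] lborel_prod)
  also have "\<dots> = (\<integral>\<^sup>+t. (\<integral>\<^sup>+z. ?f (z, t) \<partial>lborel) \<partial>lborel)"
    by (rule lborel_pair.nn_integral_snd[OF m, symmetric])
  also have "\<dots> = (\<integral>\<^sup>+t. emeasure lborel {z. (z, t) \<in> A} * ennreal (indicator {0<..} t * (1 / t ^ DIM('v \<times> real))) \<partial>lborel)"
  proof (intro nn_integral_cong)
    fix t :: real
    have "(\<lambda>z. (z, t)) -` A \<in> sets borel"
      using measurable_sets[OF _ A(1), of "\<lambda>z. (z, t)" borel] 
      by (simp add: borel_measurable_continuous_onI continuous_on_Pair)
    then have s: "{z. (z, t) \<in> A} \<in> sets borel" by (simp add: vimage_def)
    have "?f (z, t) = ennreal (indicator {0<..} t * (1 / t ^ DIM('v \<times> real))) * indicator {z. (z, t) \<in> A} z" for z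
      using A(2) by (auto simp: indicator_def uhs_def)
    then have "(\<integral>\<^sup>+z. ?f (z, t) \<partial>lborel) =
        (\<integral>\<^sup>+z. ennreal (indicator {0<..} t * (1 / t ^ DIM('v \<times> real))) * indicator {z. (z, t) \<in> A} z \<partial>lborel)"
      by simp
    also have "\<dots> = ennreal (indicator {0<..} t * (1 / t ^ DIM('v \<times> real))) * emeasure lborel {z. (z, t) \<in> A}"
      using s by (subst nn_integral_cmult_indicator) simp_all
    finally show "(\<integral>\<^sup>+z. ?f (z, t) \<partial>lborel) = emeasure lborel {z. (z, t) \<in> A} * ennreal (indicator {0<..} t * (1 / t ^ DIM('v \<times> real)))"
      by (simp add: mult.commute)
  qed
  finally show ?thesis .
qed

section \<open>Volume of the polyhedron and of other fundamental domains\<close>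

context based_lattice
begin

lemma Pint_borel: "Pint \<in> sets borel"
  using open_Pint by simp

lemma Pint_uhs: "Pint \<subseteq> uhs"
  using Pint_P P_uhs by blast

text \<open>Below height 1 the slice bound times the density leaves \<open>C\<close> times
  \<open>t\<close> to the power \<open>d - 1\<close>, which is bounded as \<open>d \<ge> 1\<close>.
  Above height 1 the base is bounded and the density is at most
  \<open>1 / t\<^sup>2\<close>.\<close>

lemma finite_volume:
  assumes cov: covered
  shows "emeasure hyp_volume Pint < \<infinity>"
proof -
  obtain R where R: "F \<subseteq> cball c R" using F_bounded by metis
  obtain C where C: "C \<ge> 0" "\<And>t. 0 < t \<Longrightarrow> t \<le> 1 \<Longrightarrow>
    emeasure lborel {z \<in> cball c R. \<forall>\<alpha>\<in>L. (dist z \<alpha>)\<^sup>2 + t\<^sup>2 \<ge> 1} \<le> ennreal (C * t ^ (2 * DIM('v)))"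
    using slice_bound[OF cov, where R = R and c = c] by blast
  define d where "d = DIM('v)"
  have d: "d \<ge> 1" by (simp add: d_def Suc_le_eq)
  define M where "M = measure lborel (cball c R)"
  have M: "emeasure lborel (cball c R) = ennreal M" "M \<ge> 0"
    using emeasure_bounded_finite[OF bounded_cball, of c R] by (simp_all add: M_def emeasure_eq_ennreal_measure)
  have slice: "emeasure lborel {z. (z, t) \<in> Pint} * ennreal (indicator {0<..} t * (1 / t ^ DIM('v \<times> real)))
      \<le> ennreal C * indicator {0..1} t + ennreal M * (ennreal (1 / t\<^sup>2) * indicator {1..} t)" for t
  proof -
    consider "t \<le> 0" | "0 < t" "t \<le> 1" | "t > 1" by linarith
    then show ?thesis
    proof cases
      case 2
      have "{z. (z, t) \<in> Pint} \<subseteq> {z \<in> cball c R. \<forall>\<alpha>\<in>L. (dist z \<alpha>)\<^sup>2 + t\<^sup>2 \<ge> 1}"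
      proof
        fix z assume "z \<in> {z. (z, t) \<in> Pint}"
        then have z: "(z, t) \<in> Pint" by simp
        have "z \<in> F" using z Pint_P by (auto simp: P_def)
        moreover have "(dist z \<alpha>)\<^sup>2 + t\<^sup>2 \<ge> 1" if "\<alpha> \<in> L" for \<alpha>
        proof -
          have "dist (z, t) (\<alpha>, 0) > 1" using z that by (auto simp: Pint_def outside_open_def)
          then have "(dist (z, t) (\<alpha>, 0))\<^sup>2 \<ge> 1" by (simp add: one_le_power)
          then show ?thesis by (simp add: dist_prod_def)
        qed
        ultimately show "z \<in> {z \<in> cball c R. \<forall>\<alpha>\<in>L. (dist z \<alpha>)\<^sup>2 + t\<^sup>2 \<ge> 1}" using R by auto
      qed
      moreover have "{z \<in> cball c R. \<forall>\<alpha>\<in>L. (dist z \<alpha>)\<^sup>2 + t\<^sup>2 \<ge> 1} = cball c R \<inter> (\<Inter>\<alpha>\<in>L. {z. (dist z \<alpha>)\<^sup>2 + t\<^sup>2 \<ge> 1})"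
        by auto
      moreover have "closed (cball c R \<inter> (\<Inter>\<alpha>\<in>L. {z. (dist z \<alpha>)\<^sup>2 + t\<^sup>2 \<ge> 1}))"
        by (intro closed_Int closed_INT closed_cball ballI closed_Collect_le continuous_intros)
      ultimately have "emeasure lborel {z. (z, t) \<in> Pint} \<le> emeasure lborel {z \<in> cball c R. \<forall>\<alpha>\<in>L. (dist z \<alpha>)\<^sup>2 + t\<^sup>2 \<ge> 1}"
        by (intro emeasure_mono) auto
      also have "\<dots> \<le> ennreal (C * t ^ (2 * d))" using C(2)[OF 2] by (simp add: d_def)
      finally have "emeasure lborel {z. (z, t) \<in> Pint} * ennreal (1 / t ^ (d + 1)) \<le> ennreal (C * t ^ (2 * d)) * ennreal (1 / t ^ (d + 1))"
        by (rule mult_right_mono) simp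
      also have "\<dots> = ennreal (C * t ^ (2 * d) * (1 / t ^ (d + 1)))"
        using C(1) 2 by (intro ennreal_mult[symmetric]) auto
      also have "C * t ^ (2 * d) * (1 / t ^ (d + 1)) = C * t ^ (d - 1)"
      proof -
        have "2 * d = (d - 1) + (d + 1)" using d by simp
        then have "t ^ (2 * d) = t ^ (d - 1) * t ^ (d + 1)" by (metis power_add)
        then show ?thesis using 2 by simp
      qed
      also have "ennreal (C * t ^ (d - 1)) \<le> ennreal C"
        using C(1) 2 by (intro ennreal_leI) (simp add: mult_left_le power_le_one)
      finally have "emeasure lborel {z. (z, t) \<in> Pint} * ennreal (1 / t ^ (d + 1)) \<le> ennreal C" .
      then show ?thesis using 2 by (simp add: d_def add_increasing2)
    next
      case 3
      have "{z. (z, t) \<in> Pint} \<subseteq> cball c R" using Pint_P R by (auto simp: P_def)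
      then have "emeasure lborel {z. (z, t) \<in> Pint} \<le> ennreal M"
        unfolding M(1)[symmetric] by (intro emeasure_mono) auto
      moreover have "1 / t ^ (d + 1) \<le> 1 / t\<^sup>2"
        using 3 d by (intro divide_left_mono power_increasing) auto
      ultimately have "emeasure lborel {z. (z, t) \<in> Pint} * ennreal (1 / t ^ (d + 1)) \<le> ennreal M * ennreal (1 / t\<^sup>2)"
        by (intro mult_mono ennreal_leI) auto
      then show ?thesis using 3 by (simp add: d_def)
    qed simp
  qed
  have "emeasure hyp_volume Pint \<le> (\<integral>\<^sup>+t. (ennreal C * indicator {0..1} t + ennreal M * (ennreal (1 / t\<^sup>2) * indicator {1..} t)) \<partial>lborel)"
    unfolding hyp_volume_fubini[OF Pint_borel Pint_uhs] by (intro nn_integral_mono slice)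
  also have "\<dots> = ennreal C * emeasure lborel {0..1::real} + ennreal M * (\<integral>\<^sup>+t. ennreal (1 / t\<^sup>2) * indicator {1..} t \<partial>lborel)"
    by (subst nn_integral_add) (auto simp: nn_integral_cmult nn_integral_cmult_indicator)
  also have "(\<integral>\<^sup>+t. ennreal (1 / t\<^sup>2) * indicator {1..} t \<partial>lborel) = ennreal (0 - - 1 / 1)"
  proof (rule nn_integral_FTC_atLeast[where F = "\<lambda>t. - 1 / t"])
    show "((\<lambda>t. - 1 / t) has_real_derivative 1 / t\<^sup>2) (at t)" if "1 \<le> t" for t :: real
      using that by (auto intro!: derivative_eq_intros simp: power2_eq_square)
    show "((\<lambda>t :: real. - 1 / t) \<longlongrightarrow> 0) at_top"
      by (intro tendsto_divide_0[OF tendsto_const] filterlim_at_top_imp_at_infinity filterlim_ident)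
  qed auto
  also have "ennreal C * emeasure lborel {0..1::real} + ennreal M * ennreal (0 - - 1 / 1) < \<infinity>"
    by (simp add: ennreal_mult_less_top)
  finally show ?thesis .
qed

text \<open>An uncovered point can be moved by \<open>A\<close> into \<open>F\<close> and then off
  its walls. Over a small ball about it \<open>Pint\<close> contains the whole vertical cylinder
  down to the boundary, where the density is at least \<open>1 / t\<^sup>2\<close>.\<close>

lemma infinite_volume:
  assumes ncov: "\<not> covered"
  shows "emeasure hyp_volume Pint = \<infinity>"
proof -
  obtain z0 where z0: "\<And>\<alpha>. \<alpha> \<in> L \<Longrightarrow> dist z0 \<alpha> > 1" using ncov unfolding covered_def by (meson not_le)
  obtain \<eta> where \<eta>: "\<eta> > 0" and far0: "\<And>\<alpha>. \<alpha> \<in> L \<Longrightarrow> dist z0 \<alpha> \<ge> 1 + \<eta>"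
    using gap[OF z0] by blast
  obtain a where a: "a \<in> A" "a z0 \<in> F" using to_F by blast
  obtain b where b: "b \<in> A" "a \<circ> b = id" "b \<circ> a = id" using A_inverse a by blast
  define z1 where "z1 = a z0"
  have far1: "dist z1 \<alpha> \<ge> 1 + \<eta>" if "\<alpha> \<in> L" for \<alpha>
  proof -
    have "dist z1 ((a \<circ> b) \<alpha>) = dist z0 (b \<alpha>)" using A_dist[OF a(1)] by (simp add: z1_def)
    then show ?thesis using far0[OF A_L[OF b(1) that]] b(2) by simp
  qed
  \<comment> \<open>Any positive \<open>s\<close> makes the Dirichlet inequalities strict; this one
    moves the point by at most \<open>\<eta> / 2\<close>, so a margin of \<open>\<eta> / 2\<close>
    to the unit balls survives.\<close>
  define s where "s = min 1 (\<eta> / (2 * (dist z1 c + 1)))"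
  have pos: "2 * (dist z1 c + 1) > 0" by (simp add: add_nonneg_pos)
  have s: "0 < s" "s \<le> 1" using \<eta> pos by (simp_all add: s_def)
  define z2 where "z2 = (1 - s) *\<^sub>R z1 + s *\<^sub>R c"
  have "s * dist z1 c \<le> \<eta> / 2"
  proof -
    have "s * (2 * (dist z1 c + 1)) \<le> \<eta>"
    proof -
      have "s \<le> \<eta> / (2 * (dist z1 c + 1))" by (simp add: s_def)
      then show ?thesis using pos by (simp only: pos_le_divide_eq)
    qed
    then show ?thesis using s by (simp add: algebra_simps)
  qed
  moreover have "z2 - z1 = s *\<^sub>R (c - z1)" by (simp add: z2_def algebra_simps)
  then have "dist z2 z1 = s * dist z1 c" using s by (simp add: dist_norm norm_minus_commute)
  ultimately have near: "dist z2 z1 \<le> \<eta> / 2" by simp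
  have far2: "dist z2 \<alpha> \<ge> 1 + \<eta> / 2" if "\<alpha> \<in> L" for \<alpha>
    using far1[OF that] near dist_triangle[of z1 \<alpha> z2] by (simp add: dist_commute)
  have strict: "dist z2 c < dist z2 (a' c)" if "a' \<in> A - {id}" for a'
    unfolding z2_def using F_star[OF a(2)[folded z1_def] s] that by auto
  have "(z2, 2) \<in> Pint"
  proof -
    have "dist (z2, 2 :: real) (\<alpha>, 0) > 1" for \<alpha>
      using dist_snd_le[of "(z2, 2 :: real)" "(\<alpha>, 0)"] by simp
    then show ?thesis using strict by (simp add: Pint_def outside_open_def uhs_iff)
  qed
  then obtain r0 where r0: "r0 > 0" "ball (z2, 2) r0 \<subseteq> Pint" using open_Pint openE by blast
  define r where "r = min r0 (\<eta> / 2)"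
  have r: "r > 0" using r0 \<eta> by (simp add: r_def)
  have sub: "(z, t) \<in> Pint" if z: "z \<in> ball z2 r" and t: "t > 0" for z t
  proof -
    have "(z, 2) \<in> Pint" using z r0(2) by (auto simp: r_def dist_prod_def subset_iff)
    then have "\<forall>a\<in>A - {id}. dist z c < dist z (a c)" by (simp add: Pint_def)
    moreover have "dist (z, t) (\<alpha>, 0) > 1" if "\<alpha> \<in> L" for \<alpha>
    proof -
      have "dist z \<alpha> > 1" using far2[OF that] z dist_triangle[of z2 \<alpha> z] by (simp add: r_def)
      then show ?thesis using dist_fst_le[of "(z, t)" "(\<alpha>, 0)"] by simp
    qed
    ultimately show ?thesis using t by (simp add: Pint_def outside_open_def uhs_iff)
  qed
  define m where "m = measure lborel (ball z2 r)"
  have me: "emeasure lborel (ball z2 r) = ennreal m"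
    using emeasure_bounded_finite[OF bounded_ball, of z2 r] by (simp add: m_def emeasure_eq_ennreal_measure)
  have m: "m > 0" using content_ball_pos[OF r, of z2] by (simp add: m_def)
  \<comment> \<open>The part of the cylinder below height \<open>e\<close> has base volume
    \<open>m\<close>, length \<open>e\<close> and density at least
    \<open>1 / e\<^sup>2\<close>.\<close>
  have big: "ennreal (m / e) \<le> emeasure hyp_volume Pint" if e: "0 < e" "e \<le> 1" for e
  proof -
    have "ennreal m * ennreal (1 / e\<^sup>2) * indicator {0<..<e} t
        \<le> emeasure lborel {z. (z, t) \<in> Pint} * ennreal (indicator {0<..} t * (1 / t ^ DIM('v \<times> real)))" for t
    proof (cases "t \<in> {0<..<e}")
      case True
      have meas: "{z. (z, t) \<in> Pint} \<in> sets lborel"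
      proof -
        have "open ((\<lambda>z. (z, t)) -` Pint)" by (intro open_vimage open_Pint continuous_intros)
        then show ?thesis by (simp add: vimage_def)
      qed
      have "ball z2 r \<subseteq> {z. (z, t) \<in> Pint}" using sub True by auto
      then have "ennreal m \<le> emeasure lborel {z. (z, t) \<in> Pint}"
        unfolding me[symmetric] using meas by (intro emeasure_mono)
      moreover have "1 / e\<^sup>2 \<le> 1 / t ^ DIM('v \<times> real)"
      proof -
        have "t ^ DIM('v \<times> real) \<le> t\<^sup>2" using True e by (intro power_decreasing) (auto simp: Suc_le_eq)
        also have "t\<^sup>2 \<le> e\<^sup>2" using True by (intro power_mono) auto
        finally show ?thesis using True e by (intro divide_left_mono) auto
      qed
      ultimately have "ennreal m * ennreal (1 / e\<^sup>2) \<le> emeasure lborel {z. (z, t) \<in> Pint} * ennreal (1 / t ^ DIM('v \<times> real))"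
        by (intro mult_mono ennreal_leI) auto
      then show ?thesis using True by simp
    qed simp
    then have "(\<integral>\<^sup>+t. ennreal m * ennreal (1 / e\<^sup>2) * indicator {0<..<e} t \<partial>lborel) \<le> emeasure hyp_volume Pint"
      unfolding hyp_volume_fubini[OF Pint_borel Pint_uhs] by (rule nn_integral_mono)
    moreover have "(\<integral>\<^sup>+t. ennreal m * ennreal (1 / e\<^sup>2) * indicator {0<..<e} t \<partial>lborel) = ennreal m * ennreal (1 / e\<^sup>2) * ennreal e"
      using e by (subst nn_integral_cmult_indicator) simp_all
    moreover have "ennreal m * ennreal (1 / e\<^sup>2) * ennreal e = ennreal (m / e)"
      using e m by (simp add: ennreal_mult[symmetric] power2_eq_square)
    ultimately show ?thesis by simp
  qed
  show ?thesis
  proof (rule ccontr)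
    assume "emeasure hyp_volume Pint \<noteq> \<infinity>"
    then obtain V where V: "emeasure hyp_volume Pint = ennreal V" "V \<ge> 0"
      by (cases "emeasure hyp_volume Pint") auto
    \<comment> \<open>Chosen so that \<open>m / e\<close> is at least \<open>V + 1\<close>.\<close>
    define e where "e = min 1 (m / (V + 1))"
    have e: "0 < e" "e \<le> 1" using m V(2) by (simp_all add: e_def)
    have "m / e \<le> V" using big[OF e] V m by (simp add: ennreal_le_iff)
    then have "m \<le> V * e" using e by (simp add: pos_divide_le_eq)
    also have "\<dots> \<le> V * (m / (V + 1))" using V(2) by (intro mult_left_mono) (auto simp: e_def)
    also have "\<dots> < m" using V(2) m by (simp add: field_simps)
    finally show False by simp
  qed
qed

text \<open>Together with \<open>countable_K\<close> this permits an enumeration of \<open>K\<close>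
  by the natural numbers without repetition, as countable additivity in \<open>volume_le\<close>
  requires.\<close>

lemma infinite_K: "infinite K"
proof -
  have "\<exists>l\<in>L. l \<noteq> 0"
  proof (rule ccontr)
    assume "\<not> ?thesis"
    then have "L \<subseteq> {0}" by auto
    then have "(UNIV :: 'v set) \<subseteq> {0}" using span span_mono[of L "{0}"] by (simp add: span_0 span_insert_0)
    moreover obtain b :: 'v where "b \<in> Basis" using nonempty_Basis by blast
    ultimately show False using nonzero_Basis by fastforce
  qed
  then obtain l where l: "l \<in> L" "l \<noteq> 0" by blast
  have "inj (\<lambda>n :: nat. Vert (\<lambda>z. z + real n *\<^sub>R l))"
  proof (rule injI)
    fix m n :: nat assume eq: "Vert (\<lambda>z. z + real m *\<^sub>R l) = Vert (\<lambda>z. z + real n *\<^sub>R l)"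
    have "(0 :: 'v, 1 :: real) \<in> uhs" by (simp add: uhs_iff)
    then have "real m *\<^sub>R l = real n *\<^sub>R l" using fun_cong[OF eq, of "(0, 1)"] by (simp add: Vert_def vmap_def)
    then show "m = n" using l by simp
  qed
  then have "infinite (range (\<lambda>n :: nat. Vert (\<lambda>z. z + real n *\<^sub>R l)))" by (rule range_inj_infinite)
  moreover have "range (\<lambda>n :: nat. Vert (\<lambda>z. z + real n *\<^sub>R l)) \<subseteq> K"
    using trans_K scaleR_closed[OF l(1)] by auto
  ultimately show ?thesis using infinite_super by blast
qed

text \<open>The tiles are disjoint nonempty open sets of a separable space and determine the group
  element.\<close>

lemma countable_K: "countable K"
proof -
  have "countable ((\<lambda>g. g ` Pint) ` K)"
  proof (rule countable_disjoint_open_subsets)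
    fix S assume "S \<in> (\<lambda>g. g ` Pint) ` K"
    then obtain g where g: "g \<in> K" "S = g ` Pint" by blast
    obtain h where h: "h \<in> K" "\<And>p. p \<in> uhs \<Longrightarrow> h (g p) = p" "\<And>p. p \<in> uhs \<Longrightarrow> g (h p) = p"
      using K_inverse[OF g(1)] by blast
    have "g ` Pint = uhs \<inter> h -` Pint"
    proof (intro equalityI subsetI)
      fix q assume "q \<in> g ` Pint"
      then show "q \<in> uhs \<inter> h -` Pint" using Pint_uhs h(2) K_uhs[OF g(1)] by (auto simp: subset_iff)
    next
      fix q assume "q \<in> uhs \<inter> h -` Pint"
      then show "q \<in> g ` Pint" using h(3) by (metis IntE image_eqI vimageE)
    qed
    then show "open S"
      unfolding g(2) using continuous_open_preimage[OF K_continuous[OF h(1)] open_uhs open_Pint] by simp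
  next
    show "disjoint ((\<lambda>g. g ` Pint) ` K)"
      unfolding disjoint_def using image_Pint_disjoint by blast
  qed
  moreover have "inj_on (\<lambda>g. g ` Pint) K"
  proof (rule inj_onI, rule ccontr)
    fix f g assume "f \<in> K" "g \<in> K" "f ` Pint = g ` Pint" "f \<noteq> g"
    then show False using image_Pint_disjoint[of f g] base_Pint[of 2] by auto
  qed
  ultimately show ?thesis using countable_image_inj_on by blast
qed

text \<open>Cutting \<open>Pint\<close> along the translates of another fundamental domain \<open>D\<close> and moving the pieces
  into \<open>D\<close> shows that \<open>D\<close> has at least the volume of \<open>Pint\<close>.\<close>

lemma volume_le:
  assumes card: "CARD('n::{finite,wellorder}) = DIM('v \<times> real)"
    and D: "fundamental_domain K D" "emeasure hyp_volume (frontier D) = 0"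
  shows "emeasure hyp_volume Pint \<le> emeasure hyp_volume D"
proof -
  define e where "e = from_nat_into K"
  have e: "bij_betw e UNIV K" unfolding e_def using countable_K infinite_K by (rule bij_betw_from_nat_into)
  have eK: "e n \<in> K" for n using e by (auto simp: bij_betw_def)
  have "\<exists>h. h \<in> K \<and> (\<forall>p\<in>uhs. h (e n p) = p) \<and> (\<forall>p\<in>uhs. e n (h p) = p)" for n
    by (rule K_inverse[OF eK[of n]]) blast
  then obtain i where i: "\<And>n. i n \<in> K" "\<And>n p. p \<in> uhs \<Longrightarrow> i n (e n p) = p" "\<And>n p. p \<in> uhs \<Longrightarrow> e n (i n p) = p"
    by metis
  define C where "C = closure D \<inter> uhs"
  have C: "C \<in> sets borel" "C \<subseteq> uhs" using uhs_borel by (auto simp: C_def)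
  have cover: "(\<Union>f\<in>K. f ` C) = uhs" using D(1) by (simp add: fundamental_domain_def C_def)
  define X where "X n = Pint \<inter> e n ` C" for n
  have X: "X n \<in> sets borel" "X n \<subseteq> uhs" for n
    using hyp_volume_K[OF card eK C] Pint_borel Pint_uhs by (auto simp: X_def)
  have iX: "i n ` X n \<in> sets borel" "emeasure hyp_volume (i n ` X n) = emeasure hyp_volume (X n)" for n
    using hyp_volume_K[OF card i(1) X] by auto
  have iXP: "i n ` X n \<subseteq> i n ` Pint" for n by (auto simp: X_def)
  have iXC: "i n ` X n \<subseteq> C" for n using i(2) C(2) by (auto simp: X_def subset_iff)
  have "Pint \<subseteq> (\<Union>n. X n)"
  proof
    fix p assume p: "p \<in> Pint"
    then have "p \<in> (\<Union>f\<in>K. f ` C)" using cover Pint_uhs by blast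
    then obtain f where "f \<in> K" "p \<in> f ` C" by blast
    moreover obtain n where "f = e n" using \<open>f \<in> K\<close> e by (metis bij_betw_imp_surj_on imageE)
    ultimately show "p \<in> (\<Union>n. X n)" using p by (auto simp: X_def)
  qed
  then have "emeasure hyp_volume Pint \<le> emeasure hyp_volume (\<Union>n. X n)"
    using X(1) by (intro emeasure_mono) auto
  also have "\<dots> \<le> (\<Sum>n. emeasure hyp_volume (X n))"
    using X(1) by (intro emeasure_subadditive_countably) auto
  also have "\<dots> = (\<Sum>n. emeasure hyp_volume (i n ` X n))" by (simp only: iX(2))
  \<comment> \<open>The moved pieces lie in different translates of \<open>Pint\<close> and are
    therefore disjoint.\<close>
  also have "\<dots> = emeasure hyp_volume (\<Union>n. i n ` X n)"
  proof (rule suminf_emeasure)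
    show "range (\<lambda>n. i n ` X n) \<subseteq> sets hyp_volume" using iX(1) by auto
    have "i m \<noteq> i n" if "m \<noteq> n" for m n
    proof
      assume eq: "i m = i n"
      have "e m p = e n p" if p: "p \<in> uhs" for p
      proof -
        have "e m p = e n (i n (e m p))" using i(3)[OF K_uhs[OF eK p]] by simp
        then show ?thesis using i(2)[OF p] eq by metis
      qed
      then have "e m = e n" using K_ext[OF eK eK] by blast
      then show False using e that by (auto simp: bij_betw_def inj_on_def)
    qed
    then have dis: "i m ` Pint \<inter> i n ` Pint = {}" if "m \<noteq> n" for m n
      using that by (intro image_Pint_disjoint i(1))
    show "disjoint_family (\<lambda>n. i n ` X n)"
      unfolding disjoint_family_on_def
    proof (intro ballI impI)
      fix m n :: nat assume "m \<noteq> n"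
      then have "i m ` Pint \<inter> i n ` Pint = {}" by (rule dis)
      then show "i m ` X m \<inter> i n ` X n = {}" using iXP[of m] iXP[of n] by blast
    qed
  qed
  \<comment> \<open>Translates of the open set \<open>D\<close> need not cover, so the pieces were
    cut along its closure; the excess lies in the frontier, which is null.\<close>
  also have "\<dots> \<le> emeasure hyp_volume (D \<union> frontier D)"
  proof (rule emeasure_mono)
    have "C \<subseteq> D \<union> frontier D" by (auto simp: C_def frontier_def interior_open[OF conjunct1[OF conjunct2[OF D(1)[unfolded fundamental_domain_def]]]])
    then show "(\<Union>n. i n ` X n) \<subseteq> D \<union> frontier D" using iXC by blast
    show "D \<union> frontier D \<in> sets hyp_volume" using D(1) by (auto simp: fundamental_domain_def frontier_closed)
  qed
  also have "\<dots> \<le> emeasure hyp_volume D + emeasure hyp_volume (frontier D)"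
    using D(1) by (intro emeasure_subadditive) (auto simp: fundamental_domain_def frontier_closed)
  finally show ?thesis using D(2) by simp
qed

text \<open>Inside the half-space the frontier is contained in finitely many spheres and
  hyperplanes. The part on the ideal boundary has volume 0 because the density vanishes off
  \<open>uhs\<close>.\<close>

lemma frontier_null: "emeasure hyp_volume (frontier Pint) = 0"
proof -
  obtain N where N: "finite N" "\<And>n. n \<in> N \<Longrightarrow> mform n n > 0" "P = polyh N" "Pint = polyh_open N"
    "N \<subseteq> vroot ` (A - {id}) \<union> sroot ` L"
    using polyhedron by metis
  have neg: "negligible {p \<in> uhs. side n p = 0}" if n: "n \<in> N" for n
  proof -
    consider a where "a \<in> A - {id}" "n = vroot a" | \<alpha> where "n = sroot \<alpha>" using N(5) n by blast
    then show ?thesis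
    proof cases
      case 1
      let ?v = "(c - a c, 0 :: real)"
      have "c \<noteq> a c" using 1 free_c by (auto simp: free_def)
      then have "negligible {p. ?v \<bullet> p = - (a c \<bullet> a c - c \<bullet> c) / 2}" by (intro negligible_hyperplane) (simp add: zero_prod_def)
      moreover have "{p \<in> uhs. side n p = 0} \<subseteq> {p. ?v \<bullet> p = - (a c \<bullet> a c - c \<bullet> c) / 2}"
      proof
        fix p assume "p \<in> {p \<in> uhs. side n p = 0}"
        then have "p \<in> uhs" "side n p = 0" by auto
        then have "val (c - a c) (a c \<bullet> a c - c \<bullet> c) (fst p) = 0"
          using uhsD[of p] by (simp add: 1 vroot_def side_proot)
        then show "p \<in> {p. ?v \<bullet> p = - (a c \<bullet> a c - c \<bullet> c) / 2}"
          by (simp add: val_def inner_prod_def inner_commute)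
      qed
      ultimately show ?thesis by (rule negligible_subset)
    next
      case 2
      have "{p \<in> uhs. side n p = 0} \<subseteq> sphere (\<alpha>, 0) 1"
      proof
        fix p assume "p \<in> {p \<in> uhs. side n p = 0}"
        then have p: "p \<in> uhs" "side n p = 0" by auto
        then have "(dist p (\<alpha>, 0))\<^sup>2 = 1" using uhsD[OF p(1)] by (simp add: 2 side_sroot)
        then have "dist p (\<alpha>, 0) = 1 \<or> dist p (\<alpha>, 0) = - 1" by (simp add: power2_eq_1_iff)
        then have "dist p (\<alpha>, 0) = 1" using zero_le_dist[of p "(\<alpha>, 0)"] by linarith
        then show "p \<in> sphere (\<alpha>, 0) 1" by (simp add: dist_commute)
      qed
      then show ?thesis using negligible_sphere negligible_subset by blast
    qed
  qed
  have "frontier Pint \<inter> uhs \<subseteq> (\<Union>n\<in>N. {p \<in> uhs. side n p = 0})"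
  proof
    fix p assume p: "p \<in> frontier Pint \<inter> uhs"
    then have "p \<in> closure Pint \<inter> uhs" "p \<notin> Pint"
      using open_Pint by (auto simp: frontier_def interior_open)
    then have "p \<in> polyh N" "p \<notin> polyh_open N" using closure_Pint N(3,4) by auto
    then show "p \<in> (\<Union>n\<in>N. {p \<in> uhs. side n p = 0})"
      unfolding polyh_def polyh_open_def by (force simp: order_less_le)
  qed
  moreover have "negligible (\<Union>n\<in>N. {p \<in> uhs. side n p = 0})"
    using N(1) neg by (intro negligible_Union) auto
  ultimately have "negligible (frontier Pint \<inter> uhs)" by (rule negligible_subset[rotated])
  moreover have b: "frontier Pint \<inter> uhs \<in> sets borel" using uhs_borel by (auto simp: frontier_closed)
  ultimately have null: "frontier Pint \<inter> uhs \<in> null_sets lborel"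
    by (metis negligible_iff_null_sets null_sets_completion_iff sets_lborel)
  have "emeasure hyp_volume (frontier Pint) =
      (\<integral>\<^sup>+p. indicator uhs p * ennreal (1 / snd p ^ DIM('v \<times> real)) * indicator (frontier Pint) p \<partial>lborel)"
  proof -
    have "(\<lambda>p :: 'v \<times> real. indicator uhs p * ennreal (1 / snd p ^ DIM('v \<times> real))) \<in> borel_measurable borel"
      by (intro borel_measurable_times_ennreal borel_measurable_indicator uhs_borel
          measurable_compose[OF density_measurable measurable_ennreal])
    moreover have "frontier Pint \<in> sets borel" by (simp add: frontier_closed)
    ultimately show ?thesis
      unfolding hyp_volume_def by (intro emeasure_density) (simp_all only: measurable_lborel1 measurable_lborel2 sets_lborel)
  qed
  also have "\<dots> = (\<integral>\<^sup>+p. ennreal (1 / snd p ^ DIM('v \<times> real)) * indicator (frontier Pint \<inter> uhs) p \<partial>lborel)"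
    by (intro nn_integral_cong) (auto simp: indicator_def)
  also have "\<dots> = 0" by (rule nn_integral_null_set[OF null])
  finally show ?thesis .
qed

theorem lattice_iff:
  assumes card: "CARD('n::{finite,wellorder}) = DIM('v \<times> real)"
  shows "hyp_lattice K \<longleftrightarrow> covered"
proof
  assume "hyp_lattice K"
  then obtain D where D: "fundamental_domain K D" "emeasure hyp_volume (frontier D) = 0"
    "emeasure hyp_volume D < \<infinity>"
    by (auto simp: hyp_lattice_def)
  then have "emeasure hyp_volume Pint < \<infinity>"
    using volume_le[OF card D(1,2)] by simp
  then show covered using infinite_volume by fastforce
next
  assume covered
  then show "hyp_lattice K"
    unfolding hyp_lattice_def using discrete_K fundamental_Pint frontier_null finite_volume by blast
qed

end

section \<open>Orders are integral lattices\<close>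

text \<open>Neither \<open>K\<close> nor \<open>covered\<close> depends on the base point, so any
  free point may be taken, and the locale with base point is entered inside the proof.\<close>

lemma (in int_lattice) main:
  assumes card: "CARD('n::{finite,wellorder}) = DIM('v \<times> real)"
  shows "(hyp_lattice K \<longleftrightarrow> covered) \<and>
    (\<exists>P. convex_fundamental_polyhedron K P \<and> finite (sides P)) \<and> geometrically_finite K"
proof -
  obtain c where "free c" using ex_free by blast
  then interpret based_lattice L c by unfold_locales
  show ?thesis
    using lattice_iff[OF card] convex_fundamental_P finite_sides_P geometrically_finite_K by blast
qed

text \<open>The covering radius involves an infimum, \<open>covered\<close> an actual lattice point.
  By \<open>gap\<close>, distances that all exceed 1 do so by a fixed margin, so the two conditions
  agree.\<close>

lemma (in int_lattice) covering_radius_iff: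
  assumes \<iota>: "\<iota> ` V = UNIV" "\<iota> ` \<Lambda> = L"
    and nrm: "\<And>v l. v \<in> V \<Longrightarrow> l \<in> \<Lambda> \<Longrightarrow> sqrt (nrm (v - l)) = dist (\<iota> v) (\<iota> l)"
  shows "covering_radius nrm V \<Lambda> \<le> 1 \<longleftrightarrow> covered"
proof
  assume c: "covering_radius nrm V \<Lambda> \<le> 1"
  show covered
    unfolding covered_def
  proof (rule allI, rule ccontr)
    fix z assume "\<not> (\<exists>\<alpha>\<in>L. dist z \<alpha> \<le> 1)"
    then obtain \<eta> where \<eta>: "\<eta> > 0" "\<And>\<alpha>. \<alpha> \<in> L \<Longrightarrow> dist z \<alpha> \<ge> 1 + \<eta>"
      using gap[of z] by force
    obtain v where v: "v \<in> V" "z = \<iota> v" using \<iota>(1) by (metis UNIV_I imageE)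
    have "ereal (1 + \<eta>) \<le> (INF l\<in>\<Lambda>. ereal (sqrt (nrm (v - l))))"
      using \<eta>(2) \<iota>(2) v by (intro INF_greatest) (auto simp: nrm)
    also have "\<dots> \<le> covering_radius nrm V \<Lambda>"
      unfolding covering_radius_def using v(1) by (rule SUP_upper)
    also have "\<dots> \<le> ereal 1" using c by (simp add: one_ereal_def)
    finally show False using \<eta>(1) by simp
  qed
next
  assume c: covered
  show "covering_radius nrm V \<Lambda> \<le> 1"
    unfolding covering_radius_def
  proof (rule SUP_least)
    fix v assume v: "v \<in> V"
    obtain \<alpha> where "\<alpha> \<in> L" "dist (\<iota> v) \<alpha> \<le> 1" using c by (auto simp: covered_def)
    then obtain l where l: "l \<in> \<Lambda>" "dist (\<iota> v) (\<iota> l) \<le> 1" using \<iota>(2) by auto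
    then have "ereal (sqrt (nrm (v - l))) \<le> 1" using nrm[OF v l(1)] by (simp add: one_ereal_def)
    then show "(INF l\<in>\<Lambda>. ereal (sqrt (nrm (v - l)))) \<le> 1" using l(1) by (rule INF_lower2[rotated])
  qed
qed

section \<open>Integrality of norms in orders\<close>

interpretation int_mod: module "\<lambda>(k::int) (x :: 'a::real_vector). of_int k *\<^sub>R x"
  by unfold_locales (simp_all add: scaleR_right_distrib scaleR_left_distrib)

interpretation rat_mod: module "\<lambda>(r::rat) (x :: 'a::real_vector). of_rat r *\<^sub>R x"
  by unfold_locales (simp_all add: scaleR_right_distrib scaleR_left_distrib of_rat_add of_rat_mult)

lemma rat_span_subset_span: "rat_span X \<subseteq> span X"
proof
  fix x assume "x \<in> rat_span X"
  then show "x \<in> span X"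
    by (induction rule: rat_mod.span_induct_alt) (auto intro: span_zero span_add span_scale span_base)
qed

text \<open>If \<open>r = p / q\<close> in lowest terms, every power of \<open>q\<close> divides
  \<open>M\<close>, which forces \<open>q = 1\<close>; the exponent \<open>M\<close> already
  suffices, since \<open>2 ^ M\<close> exceeds \<open>M\<close>.\<close>

lemma bounded_denominators_imp_Int:
  fixes r :: real
  assumes M: "M > 0" and pow: "\<And>k. of_nat M * r ^ k \<in> \<int>"
  shows "r \<in> \<int>"
proof -
  obtain m where m: "of_nat M * r = of_int m" using pow[of 1] by (auto elim: Ints_cases)
  then have "r = of_int m / of_int (int M)" using M by (simp add: field_simps)
  then have "r \<in> \<rat>" by simp
  then obtain p q :: int where pq: "q > 0" "coprime p q" "r = of_int p / of_int q"
    by (auto elim: Rats_cases')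
  have dvd: "q ^ k dvd int M" for k
  proof -
    obtain j where "of_nat M * r ^ k = of_int j" using pow[of k] by (auto elim: Ints_cases)
    then have "real_of_int (int M * p ^ k) = real_of_int (j * q ^ k)"
      using pq by (simp add: power_divide field_simps)
    then have "int M * p ^ k = j * q ^ k" by (simp only: of_int_eq_iff)
    then have "q ^ k dvd int M * p ^ k" by simp
    moreover have "coprime (q ^ k) (p ^ k)" using pq(2) by (simp add: coprime_commute)
    ultimately show ?thesis by (simp add: coprime_dvd_mult_left_iff)
  qed
  have "q = 1"
  proof (rule ccontr)
    assume "q \<noteq> 1"
    then have "q \<ge> 2" using pq(1) by simp
    then have "(2 :: int) ^ M \<le> q ^ M" by (intro power_mono) auto
    moreover have "q ^ M \<le> int M" using dvd[of M] M by (intro zdvd_imp_le) auto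
    moreover have "int M < 2 ^ M" using less_exp[of M] by (metis of_nat_less_iff of_nat_numeral of_nat_power)
    ultimately show False by simp
  qed
  then show ?thesis using pq by simp
qed

text \<open>The powers of \<open>x\<close> stay in the order, where norms have bounded denominators,
  and the norm is multiplicative. So all powers of \<open>nrm x\<close> have bounded
  denominators.\<close>

lemma order_norm_integral:
  assumes "e \<in> R" "\<And>x y. x \<in> R \<Longrightarrow> y \<in> R \<Longrightarrow> mlt x y \<in> R"
    and "nrm e = (1 :: real)" "\<And>x y. nrm (mlt x y) = nrm x * nrm y"
    and "M > 0" "\<And>x. x \<in> R \<Longrightarrow> of_nat M * nrm x \<in> \<int>" and x: "x \<in> R"
  shows "nrm x \<in> \<int>"
proof -
  define pw where "pw k = (mlt x ^^ k) e" for k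
  have "pw k \<in> R \<and> nrm (pw k) = nrm x ^ k" for k
    by (induction k) (use assms in \<open>auto simp: pw_def\<close>)
  then show ?thesis using bounded_denominators_imp_Int[OF assms(5)] assms(6) by metis
qed

lemma common_denominator:
  assumes "finite X" "X \<subseteq> (\<rat> :: real set)"
  shows "\<exists>N :: nat > 0. \<forall>x\<in>X. of_nat N * x \<in> \<int>"
  using assms
proof (induction X)
  case empty
  then show ?case by (intro exI[of _ 1]) simp
next
  case (insert x X)
  then obtain N :: nat where N: "N > 0" "\<forall>x\<in>X. of_nat N * x \<in> \<int>" by auto
  obtain p q :: int where pq: "q > 0" "x = of_int p / of_int q"
    using insert.prems by (auto elim: Rats_cases')
  have "of_nat (N * nat q) * y \<in> \<int>" if "y \<in> insert x X" for y
  proof (cases "y = x")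
    case True
    then have "of_nat (N * nat q) * y = of_int (int N * p)" using pq by simp
    then show ?thesis by (metis Ints_of_int)
  next
    case False
    then have "of_nat N * y \<in> \<int>" using N that by auto
    then have "of_nat (nat q) * (of_nat N * y) \<in> \<int>" by (rule Ints_mult[OF Ints_of_nat])
    then show ?thesis by (simp add: mult_ac)
  qed
  then show ?case using N pq by (intro exI[of _ "N * nat q"]) auto
qed

subsection \<open>Imaginary quadratic orders\<close>

lemma imag_quadratic_lattice:
  assumes d: "d > 0" and R: "is_order (*) 1 (imag_quadratic_field d) R"
  shows "int_lattice R"
proof
  obtain B where B: "finite B" "R = int_span B" using R by (auto simp: is_order_def full_int_lattice_def)
  have rs: "rat_span R = imag_quadratic_field d" using R by (simp add: is_order_def full_int_lattice_def)
  show "0 \<in> R" by (simp add: B(2) int_mod.span_zero)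
  show "x - y \<in> R" if "x \<in> R" "y \<in> R" for x y
    using that by (simp add: B(2) int_mod.span_diff)
  define w where "w = \<i> * of_real (sqrt (real d))"
  have "1 \<in> imag_quadratic_field d" "w \<in> imag_quadratic_field d"
    unfolding imag_quadratic_field_def w_def
    by (rule CollectI, rule exI[of _ 1], rule exI[of _ 0], simp, rule CollectI, rule exI[of _ 0], rule exI[of _ 1], simp)
  then have 1: "1 \<in> span R" "w \<in> span R" using rs rat_span_subset_span by blast+
  show "span R = UNIV"
  proof
    show "UNIV \<subseteq> span R"
    proof
      fix z :: complex
      have "z = Re z *\<^sub>R 1 + (Im z / sqrt (real d)) *\<^sub>R w"
        using d by (simp add: complex_eq_iff w_def)
      then show "z \<in> span R" using 1 by (metis span_add span_scale)
    qed
  qed simp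
  have "\<exists>u v :: rat. b = of_rat u + of_rat v * w" if "b \<in> R" for b
  proof -
    have "b \<in> imag_quadratic_field d" using that rs rat_mod.span_superset by blast
    then show ?thesis by (auto simp: imag_quadratic_field_def w_def)
  qed
  then obtain u v :: "complex \<Rightarrow> rat" where uv: "\<And>b. b \<in> R \<Longrightarrow> b = of_rat (u b) + of_rat (v b) * w"
    by metis
  have BR: "B \<subseteq> R" by (simp add: B(2) int_mod.span_superset)
  obtain N :: nat where N: "N > 0" "\<forall>x\<in>(\<lambda>b. real_of_rat (u b)) ` B \<union> (\<lambda>b. real_of_rat (v b)) ` B. of_nat N * x \<in> \<int>"
    using common_denominator[of "(\<lambda>b. real_of_rat (u b)) ` B \<union> (\<lambda>b. real_of_rat (v b)) ` B"] B(1)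
    by (auto simp: image_subset_iff)
  \<comment> \<open>\<open>N\<close> clears the coordinates of the finitely many generators and
    hence of all integral combinations.\<close>
  have int: "\<exists>m n :: int. of_nat N * x = of_int m + of_int n * w" if "x \<in> int_span B" for x
    using that
  proof (induction rule: int_mod.span_induct_alt)
    case base
    show ?case by (intro exI[of _ 0]) simp
  next
    case (step k b y)
    obtain m n :: int where y: "of_nat N * y = of_int m + of_int n * w" using step by auto
    obtain m' where m': "of_nat N * real_of_rat (u b) = of_int m'" using N(2) step(1) by (auto elim!: Ints_cases)
    obtain n' where n': "of_nat N * real_of_rat (v b) = of_int n'" using N(2) step(1) by (auto elim!: Ints_cases)
    have c: "of_nat N * (of_rat q :: complex) = of_int j" if "of_nat N * real_of_rat q = of_int j" for q :: rat and j
    proof -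
      have "(of_rat q :: complex) = of_real (real_of_rat q)" by (cases q) (simp add: of_rat_rat)
      then show ?thesis by (metis (mono_tags, lifting) of_real_mult of_real_of_int_eq of_real_of_nat_eq that)
    qed
    have "of_nat N * b = of_nat N * of_rat (u b) + of_nat N * of_rat (v b) * w"
      using uv[of b] BR step(1) by (metis distrib_left mult.assoc subsetD)
    then have "of_nat N * b = of_int m' + of_int n' * w" using c[OF m'] c[OF n'] by simp
    then have "of_nat N * (of_int k *\<^sub>R b + y) = of_int (k * m' + m) + of_int (k * n' + n) * w"
      using y by (simp add: scaleR_conv_of_real algebra_simps) (metis (no_types, lifting) distrib_left mult.left_commute)
    then show ?case by blast
  qed
  show "x \<bullet> x \<in> \<int>" if x: "x \<in> R" for x
  proof -
    have "(cmod x)\<^sup>2 \<in> \<int>"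
    proof (rule order_norm_integral[where e = 1 and R = R and mlt = "(*)" and M = "N * N" and nrm = "\<lambda>z. (cmod z)\<^sup>2"])
      fix y assume "y \<in> R"
      then have "y \<in> int_span B" using B(2) by simp
      from int[OF this] obtain m n :: int where "of_nat N * y = of_int m + of_int n * w" by blast
      then have "(cmod (of_nat N * y))\<^sup>2 = (cmod (of_int m + of_int n * w))\<^sup>2" by simp
      also have "\<dots> = of_int (m\<^sup>2 + int d * n\<^sup>2)"
        by (simp only: cmod_power2) (simp add: w_def power_mult_distrib)
      finally have "of_nat (N * N) * (cmod y)\<^sup>2 = of_int (m\<^sup>2 + int d * n\<^sup>2)"
        by (simp add: norm_mult power2_eq_square mult_ac)
      then show "of_nat (N * N) * (cmod y)\<^sup>2 \<in> \<int>" by (metis Ints_of_int)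
    qed (use R N x in \<open>auto simp: is_order_def norm_mult power_mult_distrib\<close>)
    then show ?thesis by (simp add: power2_norm_eq_inner[symmetric])
  qed
qed

lemma complex_inversion:
  fixes w :: complex
  assumes "w \<noteq> 0"
  shows "inverse (cnj w) = (1 / (w \<bullet> w)) *\<^sub>R w"
proof -
  have "w \<bullet> w = (cmod w)\<^sup>2" by (simp add: power2_norm_eq_inner)
  moreover have "of_real ((cmod w)\<^sup>2) = w * cnj w" by (rule complex_norm_square)
  ultimately show ?thesis using assms by (simp add: scaleR_conv_of_real field_simps)
qed

subsection \<open>Quaternion orders\<close>

lemma vec4_eq_iff: "p = q \<longleftrightarrow> p $ 1 = q $ 1 \<and> p $ 2 = q $ 2 \<and> p $ 3 = q $ 3 \<and> p $ 4 = q $ 4"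
  for p q :: quat
  by (simp add: vec_eq_iff forall_4)

lemma quat_nrm_mult: "quat_nrm a b (quat_mult a b p q) = quat_nrm a b p * quat_nrm a b q"
  by (simp add: quat_nrm_eq quat_mult_def vector_4 power2_eq_square algebra_simps)

lemma quat_nrm_nonneg: "a < 0 \<Longrightarrow> b < 0 \<Longrightarrow> quat_nrm a b q \<ge> 0"
proof -
  assume ab: "a < 0" "b < 0"
  then have "a * (q $ 2)\<^sup>2 \<le> 0" "b * (q $ 3)\<^sup>2 \<le> 0" "a * b * (q $ 4)\<^sup>2 \<ge> 0"
    by (auto simp: mult_le_0_iff zero_le_mult_iff)
  then show ?thesis unfolding quat_nrm_eq using zero_le_power2[of "q $ 1"] by linarith
qed

lemma quat_inverse_conj: "quat_inverse a b (quat_conj q) = (1 / quat_nrm a b q) *\<^sub>R q"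
proof -
  have "quat_nrm a b (quat_conj q) = quat_nrm a b q" by (simp add: quat_nrm_eq quat_conj_def vector_4)
  moreover have "quat_conj (quat_conj q) = q" by (simp add: quat_conj_def vector_4 vec4_eq_iff)
  ultimately show ?thesis by (simp add: quat_inverse_def)
qed

lemma quat_coords5_linear: "linear (quat_coords5 a b)"
  by (rule linearI) (simp_all add: quat_coords5_def vector_4 vec4_eq_iff algebra_simps)

lemma quat_coords4_linear: "linear (quat_coords4 a b)"
  by (rule linearI) (simp_all add: quat_coords4_def vec_eq_iff forall_3 algebra_simps)

lemma quat_order_integral:
  fixes a b :: rat
  assumes R: "is_order (quat_mult (of_rat a) (of_rat b)) quat_one rat_quat R" and x: "x \<in> R"
  shows "quat_nrm (of_rat a) (of_rat b) x \<in> \<int>"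
proof -
  obtain B where B: "finite B" "R = int_span B" using R by (auto simp: is_order_def full_int_lattice_def)
  have "rat_span R = rat_quat" using R by (simp add: is_order_def full_int_lattice_def)
  then have rat: "q $ i \<in> \<rat>" if "q \<in> R" for q i
    using that rat_mod.span_superset[of R] by (auto simp: rat_quat_def)
  have BR: "B \<subseteq> R" by (simp add: B(2) int_mod.span_superset)
  let ?X = "(\<lambda>(q, i). q $ i) ` (B \<times> UNIV)"
  have "finite ?X" "?X \<subseteq> \<rat>" using B(1) BR rat by auto
  then obtain N :: nat where N: "N > 0" "\<forall>x\<in>?X. of_nat N * x \<in> \<int>" using common_denominator by blast
  have int: "\<forall>i. of_nat N * q $ i \<in> \<int>" if "q \<in> int_span B" for q
    using that
  proof (induction rule: int_mod.span_induct_alt)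
    case (step k q y)
    have "of_nat N * (of_int k *\<^sub>R q + y) $ i = of_int k * (of_nat N * q $ i) + of_nat N * y $ i" for i
      by (simp add: algebra_simps)
    moreover have "of_nat N * q $ i \<in> \<int>" for i using N(2) step(1) by force
    ultimately show ?case using step by (metis Ints_add Ints_mult Ints_of_int)
  qed simp
  let ?a = "real_of_rat a" and ?b = "real_of_rat b"
  \<comment> \<open>The norm form has the coefficients \<open>a\<close>, \<open>b\<close> and
    \<open>ab\<close>; \<open>M\<close> clears these and \<open>N\<close> squared clears the
    coordinates.\<close>
  obtain M :: nat where M: "M > 0" "\<forall>x\<in>{?a, ?b, ?a * ?b}. of_nat M * x \<in> \<int>"
    using common_denominator[of "{?a, ?b, ?a * ?b}"] by auto
  show ?thesis
  proof (rule order_norm_integral[where e = quat_one and R = R and mlt = "quat_mult ?a ?b" and M = "M * (N * N)"])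
    show "quat_nrm ?a ?b quat_one = 1" by (simp add: quat_nrm_eq quat_one_def vector_4)
    fix q assume "q \<in> R"
    then have q: "of_nat N * q $ i \<in> \<int>" for i using int B(2) by auto
    have "of_nat (M * (N * N)) * quat_nrm ?a ?b q =
      of_nat M * ((of_nat N * q $ 1) * (of_nat N * q $ 1)) - (of_nat M * ?a) * ((of_nat N * q $ 2) * (of_nat N * q $ 2))
      - (of_nat M * ?b) * ((of_nat N * q $ 3) * (of_nat N * q $ 3))
      + (of_nat M * (?a * ?b)) * ((of_nat N * q $ 4) * (of_nat N * q $ 4))"
      by (simp add: quat_nrm_eq power2_eq_square algebra_simps)
    also have "\<dots> \<in> \<int>"
    proof -
      have "of_nat M * ?a \<in> \<int>" "of_nat M * ?b \<in> \<int>" "of_nat M * (?a * ?b) \<in> \<int>" using M(2) by simp_all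
      then show ?thesis
        by (intro Ints_add Ints_diff Ints_mult[OF _ Ints_mult[OF q q]]) simp_all
    qed
    finally show "of_nat (M * (N * N)) * quat_nrm ?a ?b q \<in> \<int>" .
  qed (use R N M x in \<open>auto simp: is_order_def quat_nrm_mult\<close>)
qed

lemma quat_order_span:
  assumes "is_order m e rat_quat R"
  shows "axis i 1 \<in> rat_span R"
  using assms by (auto simp: is_order_def full_int_lattice_def rat_quat_def axis_def)

lemma quat_order_diff:
  assumes "is_order m e X R"
  shows "0 \<in> R" "x \<in> R \<Longrightarrow> y \<in> R \<Longrightarrow> x - y \<in> R" "x \<in> R \<Longrightarrow> y \<in> R \<Longrightarrow> x + y \<in> R"
  using assms by (auto simp: is_order_def full_int_lattice_def int_mod.span_zero int_mod.span_diff int_mod.span_add)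

lemma quat_basis_expansion:
  "q = q $ 1 *\<^sub>R axis 1 1 + q $ 2 *\<^sub>R axis 2 1 + q $ 3 *\<^sub>R axis 3 1 + q $ 4 *\<^sub>R axis 4 1"
  for q :: quat
  by (simp add: vec4_eq_iff axis_def)

lemma quat_coords5_bij:
  assumes "a < 0" "b < 0"
  shows "bij (quat_coords5 a b)"
proof (rule bijI)
  show "inj (quat_coords5 a b)"
    using assms mult_neg_neg[OF assms] by (auto intro!: injI simp: quat_coords5_def vec4_eq_iff vector_4)
  have "y = quat_coords5 a b (vector [y $ 1, y $ 2 / sqrt (- a), y $ 3 / sqrt (- b), y $ 4 / sqrt (a * b)])" for y
    using assms mult_neg_neg[OF assms] by (simp add: quat_coords5_def vec4_eq_iff vector_4)
  then show "surj (quat_coords5 a b)" by (rule surjI[OF sym])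
qed

lemma quat_coords4_bij:
  assumes "a < 0" "b < 0"
  shows "bij_betw (quat_coords4 a b) quat_V4 UNIV"
proof (rule bij_betw_byWitness[where f' = "\<lambda>y. vector [y $ 1, y $ 2 / sqrt (- a), y $ 3 / sqrt (- b), 0]"])
  show "\<forall>q\<in>quat_V4. vector [quat_coords4 a b q $ 1, quat_coords4 a b q $ 2 / sqrt (- a), quat_coords4 a b q $ 3 / sqrt (- b), 0] = q"
    using assms by (simp add: quat_coords4_def vec4_eq_iff vector_4 quat_V4_def)
  show "\<forall>y\<in>UNIV. quat_coords4 a b (vector [y $ 1, y $ 2 / sqrt (- a), y $ 3 / sqrt (- b), 0]) = y"
    using assms by (simp add: quat_coords4_def vec_eq_iff forall_3 vector_4)
qed (auto simp: quat_V4_def vector_4)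

lemma quat_coords5_inner:
  assumes "a < 0" "b < 0"
  shows "quat_coords5 a b q \<bullet> quat_coords5 a b q = quat_nrm a b q"
  using norm_quat_coords5[OF assms, of q] quat_nrm_nonneg[OF assms, of q]
  by (simp add: power2_norm_eq_inner[symmetric])

lemma quat_coords4_inner:
  assumes "a < 0" "b < 0" "q \<in> quat_V4"
  shows "quat_coords4 a b q \<bullet> quat_coords4 a b q = quat_nrm a b q"
  using norm_quat_coords4[OF assms] quat_nrm_nonneg[OF assms(1,2), of q]
  by (simp add: power2_norm_eq_inner[symmetric])

lemma quat_lattice5:
  fixes a b :: rat
  assumes ab: "a < 0" "b < 0" and R: "is_order (quat_mult (of_rat a) (of_rat b)) quat_one rat_quat R"
  shows "int_lattice (quat_coords5 (of_rat a) (of_rat b) ` R)"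
proof
  let ?\<iota> = "quat_coords5 (of_rat a) (of_rat b)"
  have ab': "real_of_rat a < 0" "real_of_rat b < 0" using ab by simp_all
  show "0 \<in> ?\<iota> ` R"
    by (rule image_eqI[of 0 ?\<iota> 0, OF linear_0[OF quat_coords5_linear, symmetric] quat_order_diff(1)[OF R]])
  show "x - y \<in> ?\<iota> ` R" if "x \<in> ?\<iota> ` R" "y \<in> ?\<iota> ` R" for x y
    using that quat_order_diff(2)[OF R] by (auto simp: linear_diff[OF quat_coords5_linear, symmetric])
  show "x \<bullet> x \<in> \<int>" if "x \<in> ?\<iota> ` R" for x
    using that quat_order_integral[OF R] by (auto simp: quat_coords5_inner[OF ab'])
  have "axis i 1 \<in> span R" for i using quat_order_span[OF R] rat_span_subset_span by blast
  then have "q \<in> span R" for q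
    by (subst quat_basis_expansion) (intro span_add span_scale)
  then have "span R = UNIV" by auto
  then show "span (?\<iota> ` R) = UNIV"
    using bij_is_surj[OF quat_coords5_bij[OF ab']] linear_span_image[OF quat_coords5_linear, of "of_rat a" "of_rat b" R] by simp
qed

lemma quat_ddag_linear: "linear quat_ddag"
  by (rule linearI) (simp_all add: quat_ddag_def vec4_eq_iff vector_4)

lemma quat_ddag_fixed: "quat_ddag q = q \<longleftrightarrow> q \<in> quat_V4"
  by (auto simp: quat_ddag_def vec4_eq_iff vector_4 quat_V4_def)

text \<open>The fixed elements are not closed under multiplication, so integrality is taken from the
  whole order. Stability under \<open>quat_ddag\<close> is what makes them span: symmetrising the
  order produces enough of them.\<close>

lemma quat_lattice4:
  fixes a b :: rat
  assumes ab: "a < 0" "b < 0" and R: "is_order (quat_mult (of_rat a) (of_rat b)) quat_one rat_quat R"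
    and dd: "quat_ddag ` R = R"
  shows "int_lattice (quat_coords4 (of_rat a) (of_rat b) ` {z \<in> R. quat_ddag z = z})"
proof
  let ?\<iota> = "quat_coords4 (of_rat a) (of_rat b)" and ?L = "{z \<in> R. quat_ddag z = z}"
  have ab': "real_of_rat a < 0" "real_of_rat b < 0" using ab by simp_all
  note lin = quat_ddag_linear
  have "0 \<in> ?L" using quat_order_diff(1)[OF R] linear_0[OF lin] by simp
  then show "0 \<in> ?\<iota> ` ?L" by (rule image_eqI[of 0 ?\<iota> 0, OF linear_0[OF quat_coords4_linear, symmetric]])
  have "x - y \<in> ?L" if "x \<in> ?L" "y \<in> ?L" for x y
    using that quat_order_diff(2)[OF R] by (simp add: linear_diff[OF lin])
  then show "x - y \<in> ?\<iota> ` ?L" if "x \<in> ?\<iota> ` ?L" "y \<in> ?\<iota> ` ?L" for x y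
    using that by (auto simp: linear_diff[OF quat_coords4_linear, symmetric])
  show "x \<bullet> x \<in> \<int>" if "x \<in> ?\<iota> ` ?L" for x
    using that quat_order_integral[OF R] by (auto simp: quat_coords4_inner[OF ab'] quat_ddag_fixed)
  \<comment> \<open>Symmetrisation maps the order into its fixed elements and is linear, so it maps
    the rational span into their real span. Applied to the first three axis vectors it doubles
    them.\<close>
  have sym: "q + quat_ddag q \<in> span ?L" if "q \<in> rat_span R" for q
    using that
  proof (induction rule: rat_mod.span_induct_alt)
    case base
    then show ?case by (simp add: linear_0[OF lin] span_zero)
  next
    case (step k x y)
    have "quat_ddag (quat_ddag x) = x" by (simp add: quat_ddag_def vec4_eq_iff vector_4)
    moreover have "quat_ddag x \<in> R" using dd step(1) by blast
    ultimately have "x + quat_ddag x \<in> ?L"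
      using step(1) quat_order_diff(3)[OF R] by (simp add: linear_add[OF lin] add.commute)
    then have "of_rat k *\<^sub>R (x + quat_ddag x) + (y + quat_ddag y) \<in> span ?L"
      using step(2) by (intro span_add[OF span_scale[OF span_base]])
    then show ?case by (simp add: linear_add[OF lin] linear_cmul[OF lin] algebra_simps)
  qed
  have ax: "axis i 1 \<in> span ?L" if "i \<noteq> 4" for i
  proof -
    have "axis i 1 + quat_ddag (axis i 1) = 2 *\<^sub>R axis i (1 :: real)"
      using that by (simp add: vec4_eq_iff quat_ddag_def vector_4 axis_def)
    then have "2 *\<^sub>R axis i (1 :: real) \<in> span ?L" using sym[OF quat_order_span[OF R, of i]] by simp
    then have "(1 / 2) *\<^sub>R (2 *\<^sub>R axis i (1 :: real)) \<in> span ?L" by (rule span_scale)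
    then show ?thesis by simp
  qed
  have "y \<in> span (?\<iota> ` ?L)" for y
  proof -
    obtain q where q: "q \<in> quat_V4" "y = ?\<iota> q" using quat_coords4_bij[OF ab'] by (metis UNIV_I bij_betw_imp_surj_on imageE)
    have "q = q $ 1 *\<^sub>R axis 1 1 + q $ 2 *\<^sub>R axis 2 1 + q $ 3 *\<^sub>R axis 3 1"
      using quat_basis_expansion[of q] q(1) by (simp add: quat_V4_def)
    also have "\<dots> \<in> span ?L" by (intro span_add span_scale ax) simp_all
    finally have "q \<in> span ?L" .
    then show ?thesis using q(2) linear_span_image[OF quat_coords4_linear, of "of_rat a" "of_rat b" ?L] by blast
  qed
  then show "span (?\<iota> ` ?L) = UNIV" by auto
qed

theorem theorem3:
  shows
    "(\<forall>d \<O>. d > 0 \<and> is_order (*) 1 (imag_quadratic_field d) \<O> \<longrightarrow>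
        (let K = inversion_group inverse cnj (\<lambda>z::complex. z) UNIV \<O> in
           (hyp_lattice K \<longleftrightarrow> covering_radius (\<lambda>z. (cmod z)\<^sup>2) UNIV \<O> \<le> 1) \<and>
           (\<exists>P. convex_fundamental_polyhedron K P \<and> finite (sides P)) \<and>
           geometrically_finite K))
   \<and> (\<forall>(a::rat) (b::rat) \<O>. a < 0 \<and> b < 0 \<and>
        is_order (quat_mult (of_rat a) (of_rat b)) quat_one rat_quat \<O> \<and>
        quat_ddag ` \<O> = \<O> \<longrightarrow>
        (let \<Lambda> = {z \<in> \<O>. quat_ddag z = z};
             K = inversion_group (quat_inverse (of_rat a) (of_rat b)) quat_conj
                   (quat_coords4 (of_rat a) (of_rat b)) quat_V4 \<Lambda> in
           (hyp_lattice K \<longleftrightarrow>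
              covering_radius (quat_nrm (of_rat a) (of_rat b)) quat_V4 \<Lambda> \<le> 1) \<and>
           (\<exists>P. convex_fundamental_polyhedron K P \<and> finite (sides P)) \<and>
           geometrically_finite K))
   \<and> (\<forall>(a::rat) (b::rat) \<O>. a < 0 \<and> b < 0 \<and>
        is_order (quat_mult (of_rat a) (of_rat b)) quat_one rat_quat \<O> \<longrightarrow>
        (let K = inversion_group (quat_inverse (of_rat a) (of_rat b)) quat_conj
                   (quat_coords5 (of_rat a) (of_rat b)) UNIV \<O> in
           (hyp_lattice K \<longleftrightarrow>
              covering_radius (quat_nrm (of_rat a) (of_rat b)) UNIV \<O> \<le> 1) \<and>
           (\<exists>P. convex_fundamental_polyhedron K P \<and> finite (sides P)) \<and>
           geometrically_finite K))"
proof (intro conjI allI impI)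
  fix d \<O> assume "d > 0 \<and> is_order (*) 1 (imag_quadratic_field d) \<O>"
  then interpret int_lattice \<O> using imag_quadratic_lattice by blast
  have K: "inversion_group inverse cnj (\<lambda>z::complex. z) UNIV \<O> = K"
    \<comment> \<open>Distributing \<open>cnj\<close> over the difference would hide the pattern
      \<open>inverse (cnj w)\<close> of \<open>complex_inversion\<close>, hence the deleted simp
      rule.\<close>
    by (rule inversion_group_K) (auto simp: complex_inversion bij_betw_def simp del: complex_cnj_diff)
  have cov: "covering_radius (\<lambda>z. (cmod z)\<^sup>2) UNIV \<O> \<le> 1 \<longleftrightarrow> covered"
    by (rule covering_radius_iff[where \<iota> = "\<lambda>z. z"]) (auto simp: dist_norm)
  show "let K = inversion_group inverse cnj (\<lambda>z::complex. z) UNIV \<O> in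
           (hyp_lattice K \<longleftrightarrow> covering_radius (\<lambda>z. (cmod z)\<^sup>2) UNIV \<O> \<le> 1) \<and>
           (\<exists>P. convex_fundamental_polyhedron K P \<and> finite (sides P)) \<and>
           geometrically_finite K"
    \<comment> \<open>\<open>'n\<close> only records the dimension of the half-space, which is 3 for
      complex numbers and a real height.\<close>
    unfolding Let_def K cov by (rule main[where 'n = 3]) simp
next
  fix a b :: rat and \<O>
  assume asm: "a < 0 \<and> b < 0 \<and> is_order (quat_mult (of_rat a) (of_rat b)) quat_one rat_quat \<O> \<and> quat_ddag ` \<O> = \<O>"
  define \<iota> where "\<iota> = quat_coords4 (of_rat a) (of_rat b)"
  define \<Lambda> where "\<Lambda> = {z \<in> \<O>. quat_ddag z = z}"
  have ab: "real_of_rat a < 0" "real_of_rat b < 0" using asm by simp_all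
  interpret int_lattice "\<iota> ` \<Lambda>" unfolding \<iota>_def \<Lambda>_def using asm quat_lattice4 by blast
  have lin: "linear \<iota>" unfolding \<iota>_def by (rule quat_coords4_linear)
  have bij: "bij_betw \<iota> quat_V4 UNIV" unfolding \<iota>_def by (rule quat_coords4_bij[OF ab])
  have \<Lambda>V: "\<Lambda> \<subseteq> quat_V4" by (auto simp: \<Lambda>_def quat_ddag_fixed)
  have V: "v - l \<in> quat_V4" if "v \<in> quat_V4" "l \<in> \<Lambda>" for v l using that \<Lambda>V by (auto simp: quat_V4_def)
  have K: "inversion_group (quat_inverse (of_rat a) (of_rat b)) quat_conj \<iota> quat_V4 \<Lambda> = K"
  proof (rule inversion_group_K[OF bij \<Lambda>V HOL.refl])
    fix z \<alpha> assume z: "z \<in> quat_V4" "\<alpha> \<in> \<Lambda>"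
    show "\<iota> (z + \<alpha>) = \<iota> z + \<iota> \<alpha>" by (rule linear_add[OF lin])
    have "\<iota> (z - \<alpha>) \<bullet> \<iota> (z - \<alpha>) = quat_nrm (of_rat a) (of_rat b) (z - \<alpha>)"
      unfolding \<iota>_def by (rule quat_coords4_inner[OF ab V[OF z]])
    then show "\<iota> (quat_inverse (of_rat a) (of_rat b) (quat_conj (z - \<alpha>)) + \<alpha>)
        = \<iota> \<alpha> + (1 / ((\<iota> z - \<iota> \<alpha>) \<bullet> (\<iota> z - \<iota> \<alpha>))) *\<^sub>R (\<iota> z - \<iota> \<alpha>)"
      by (simp add: quat_inverse_conj linear_add[OF lin] linear_cmul[OF lin] linear_diff[OF lin, symmetric])
  qed
  have cov: "covering_radius (quat_nrm (of_rat a) (of_rat b)) quat_V4 \<Lambda> \<le> 1 \<longleftrightarrow> covered"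
  proof (rule covering_radius_iff[OF bij_betw_imp_surj_on[OF bij] HOL.refl])
    fix v l assume "v \<in> quat_V4" "l \<in> \<Lambda>"
    then have "norm (\<iota> (v - l)) = sqrt (quat_nrm (of_rat a) (of_rat b) (v - l))"
      unfolding \<iota>_def by (rule norm_quat_coords4[OF ab V])
    then show "sqrt (quat_nrm (of_rat a) (of_rat b) (v - l)) = dist (\<iota> v) (\<iota> l)"
      by (simp add: dist_norm linear_diff[OF lin])
  qed
  show "let \<Lambda> = {z \<in> \<O>. quat_ddag z = z};
             K = inversion_group (quat_inverse (of_rat a) (of_rat b)) quat_conj
                   (quat_coords4 (of_rat a) (of_rat b)) quat_V4 \<Lambda> in
           (hyp_lattice K \<longleftrightarrow>
              covering_radius (quat_nrm (of_rat a) (of_rat b)) quat_V4 \<Lambda> \<le> 1) \<and>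
           (\<exists>P. convex_fundamental_polyhedron K P \<and> finite (sides P)) \<and>
           geometrically_finite K"
    unfolding Let_def \<Lambda>_def[symmetric] \<iota>_def[symmetric] K cov by (rule main[where 'n = 4]) simp
next
  fix a b :: rat and \<O>
  assume asm: "a < 0 \<and> b < 0 \<and> is_order (quat_mult (of_rat a) (of_rat b)) quat_one rat_quat \<O>"
  define \<iota> where "\<iota> = quat_coords5 (of_rat a) (of_rat b)"
  have ab: "real_of_rat a < 0" "real_of_rat b < 0" using asm by simp_all
  interpret int_lattice "\<iota> ` \<O>" unfolding \<iota>_def using asm quat_lattice5 by blast
  have lin: "linear \<iota>" unfolding \<iota>_def by (rule quat_coords5_linear)
  have bij: "bij \<iota>" unfolding \<iota>_def by (rule quat_coords5_bij[OF ab])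
  have K: "inversion_group (quat_inverse (of_rat a) (of_rat b)) quat_conj \<iota> UNIV \<O> = K"
  proof (rule inversion_group_K[OF bij subset_UNIV HOL.refl])
    fix z \<alpha>
    show "\<iota> (z + \<alpha>) = \<iota> z + \<iota> \<alpha>" by (rule linear_add[OF lin])
    have "\<iota> (z - \<alpha>) \<bullet> \<iota> (z - \<alpha>) = quat_nrm (of_rat a) (of_rat b) (z - \<alpha>)"
      unfolding \<iota>_def by (rule quat_coords5_inner[OF ab])
    then show "\<iota> (quat_inverse (of_rat a) (of_rat b) (quat_conj (z - \<alpha>)) + \<alpha>)
        = \<iota> \<alpha> + (1 / ((\<iota> z - \<iota> \<alpha>) \<bullet> (\<iota> z - \<iota> \<alpha>))) *\<^sub>R (\<iota> z - \<iota> \<alpha>)"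
      by (simp add: quat_inverse_conj linear_add[OF lin] linear_cmul[OF lin] linear_diff[OF lin, symmetric])
  qed
  have cov: "covering_radius (quat_nrm (of_rat a) (of_rat b)) UNIV \<O> \<le> 1 \<longleftrightarrow> covered"
  proof (rule covering_radius_iff[OF bij_is_surj[OF bij] HOL.refl])
    fix v l
    have "norm (\<iota> (v - l)) = sqrt (quat_nrm (of_rat a) (of_rat b) (v - l))"
      unfolding \<iota>_def by (rule norm_quat_coords5[OF ab])
    then show "sqrt (quat_nrm (of_rat a) (of_rat b) (v - l)) = dist (\<iota> v) (\<iota> l)"
      by (simp add: dist_norm linear_diff[OF lin])
  qed
  show "let K = inversion_group (quat_inverse (of_rat a) (of_rat b)) quat_conj
                   (quat_coords5 (of_rat a) (of_rat b)) UNIV \<O> in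
           (hyp_lattice K \<longleftrightarrow>
              covering_radius (quat_nrm (of_rat a) (of_rat b)) UNIV \<O> \<le> 1) \<and>
           (\<exists>P. convex_fundamental_polyhedron K P \<and> finite (sides P)) \<and>
           geometrically_finite K"
    unfolding Let_def \<iota>_def[symmetric] K cov by (rule main[where 'n = 5]) simp
qed

end
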